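(* Let $G$ be a Lie group with Lie algebra $\mathfrak g$ and let $n\geq1$. The $n$th order iterated tangent group $T^{(n)}G$ has the structure of a cocycle double cross product of the $n$th order tangent group $T^nG$ by $\mathfrak g^{\times\,2^n-1-n}$. That is, there is an isomorphism of Lie groups $$T^{(n)}G\cong\mathfrak g^{\times\,2^n-1-n}\bowtie_\gamma T^nG$$ for some $\gamma:\mathfrak g^{\times\,2^n-1-n}\times\mathfrak g^{\times\,2^n-1-n}\to T^nG$, i.e. for some cocycle matched pair structure on the pair $(\mathfrak g^{\times\,2^n-1-n},T^nG)$ (with the manifold $\mathfrak g^{\times\,2^n-1-n}$ in the role of $M$ and the Lie group $T^nG$ in the role of $H$) whose twisted cocycle is $\gamma$.
   Context: Cocycle matched pair. $M$ is a smooth manifold with a distinguished element $o$, $H$ is a Lie group (product $*$, identity $1$) with a smooth left action $H\times M\to M$, $(h,m)\mapsto h\triangleright m$, satisfying $h\triangleright o=o$. There are smooth maps $\sigma:H\times M\to H$, $\Phi:M\times M\to M$ (written $m_1\cdot m_2$), $\gamma:M\times M\to H$ with $\sigma(h,o)=h$, $\sigma(1,m)=1$, $\gamma(o,o)=1$, and (i) $o\cdot m=m=m\cdot o$; (ii) $\gamma(m,o)=1=\gamma(o,m)$; (iii) $h\triangleright(m_1\cdot m_2)=(h\triangleright m_1)\cdot(\sigma(h,m_1)\triangleright m_2)$; (iv) $\sigma(h,m_1\cdot m_2)*\gamma(m_1,m_2)=\gamma(h\triangleright m_1,\sigma(h,m_1)\triangleright m_2)*\sigma(\sigma(h,m_1),m_2)$;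 (v) $\sigma(h_1*h_2,m)=\sigma(h_1,h_2\triangleright m)*\sigma(h_2,m)$; (vi) $m_1\cdot(m_2\cdot m_3)=(m_1\cdot m_2)\cdot(\gamma(m_1,m_2)\triangleright m_3)$; (vii) $\gamma(m_1,m_2\cdot m_3)*\gamma(m_2,m_3)=\gamma(m_1\cdot m_2,\gamma(m_1,m_2)\triangleright m_3)*\sigma(\gamma(m_1,m_2),m_3)$; (viii) for each $m\in M$ there is $m^r\in M$ with $m\cdot m^r=o$. Then (known) $M\bowtie_\gamma H:=M\times H$ is a Lie group with identity $(o,1)$ and product $$(m_1,h_1)(m_2,h_2)=\big(m_1\cdot(h_1\triangleright m_2),\ \gamma(m_1,h_1\triangleright m_2)*\sigma(h_1,m_2)*h_2\big),$$ called the cocycle double cross product; $\gamma$ is its twisted cocycle. $n$th order tangent group. $T^nG$ is the set of classes $[p]$ of curves $p(t)\in G$, two curves being equivalent if they have the same derivatives up to order $n$ at $t=0$; it is a Lie group with $[p][q]:=[pq]$. With the left logarithmic derivative $\delta^\ell p:=p^{-1}p'$, the left trivialization $[p]\mapsto(p(0),(\delta^\ell p)(0),(\delta^\ell p)'(0),\ldots,(\delta^\ell p)^{(n-1)}(0))$ identifies $T^nG$ with $G\times\mathfrak g^{\times n}$, with product $(x,\xi_1,\ldots,\xi_n)(y,\zeta_1,\ldots,\zeta_n)=(xy,\rho_1,\ldots,\rho_n)$, where $$\rho_k=\zeta_k+\sum_{i_1+\cdots+i_\ell=k}(-1)^{\ell-1}N_{(i_1,\ldots,i_\ell)}\,\mathrm{ad}_{\zeta_{i_{\ell-1}}}\cdots\mathrm{ad}_{\zeta_{i_1}}\mathrm{Ad}_{y^{-1}}\xi_{i_\ell},$$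 the sum being over $\ell\geq1$ and positive integers $i_1,\ldots,i_\ell$, and $N_{(i_1,\ldots,i_\ell)}=\prod_{j=2}^{\ell}\binom{i_1+\cdots+i_j-1}{i_j-1}$. $n$th order iterated tangent group. $T^{(n)}G=T(T(\cdots T(G)))$ ($n$ times). Let $I_n^*$ be the set of nonempty subsets of $\{1,\ldots,n\}$. Iterating the left trivialization $TG\cong G\ltimes\mathfrak g$ identifies $T^{(n)}G$ with $\{(x,(X_\alpha)_{\alpha\in I_n^*})\mid x\in G,\ X_\alpha\in\mathfrak g\}$, with product $(x,(X_\alpha))(y,(Y_\alpha))=(xy,(Z_\alpha))$, where $$Z_\alpha=Y_\alpha+\sum_{\lambda}(-1)^{\ell-1}\mathrm{ad}_{Y_{\lambda_{\ell-1}}}\cdots\mathrm{ad}_{Y_{\lambda_1}}\mathrm{Ad}_{y^{-1}}X_{\lambda_\ell},$$ the sum being over all set partitions $\lambda$ of $\alpha$ into nonempty blocks, written $\alpha=\lambda_\ell\cup\cdots\cup\lambda_1$ with the blocks ordered anti-lexicographically, i.e. $\max\lambda_\ell>\cdots>\max\lambda_1$. *)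

theory Defs
  imports "HOL-Analysis.Analysis" "HOL-Algebra.Group"
begin

section \<open>Smooth functions on open subsets of Euclidean spaces\<close>

text \<open>
  Dimensions such as $2^n - 1 - n$ are terms, so $\mathbb{R}^d$ is the library's
  \<^term>\<open>Euclidean_space d\<close>: sequences of type \<^typ>\<open>nat \<Rightarrow> real\<close> vanishing from index
  \<^term>\<open>d\<close> on.  In \<open>C_k d k U f\<close> the functions \<open>g i\<close> are the partial derivatives of \<open>f\<close>
  on the open set \<open>U\<close>; so it says that all partial derivatives of order at most \<open>k\<close> exist
  and are continuous on \<open>U\<close>.
\<close>

primrec C_k :: "nat \<Rightarrow> nat \<Rightarrow> (nat \<Rightarrow> real) set \<Rightarrow> ((nat \<Rightarrow> real) \<Rightarrow> real) \<Rightarrow> bool" where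
  "C_k d 0 U f \<longleftrightarrow> continuous_on U f"
| "C_k d (Suc k) U f \<longleftrightarrow> continuous_on U f \<and>
     (\<exists>g. \<forall>i<d. (\<forall>x\<in>U. ((\<lambda>t. f (x(i := t))) has_real_derivative g i x) (at (x i))) \<and>
                C_k d k U (g i))"

definition smooth_euclidean ::
    "nat \<Rightarrow> nat \<Rightarrow> (nat \<Rightarrow> real) set \<Rightarrow> ((nat \<Rightarrow> real) \<Rightarrow> nat \<Rightarrow> real) \<Rightarrow> bool" where
  "smooth_euclidean d e U f \<longleftrightarrow> (\<forall>j<e. \<forall>k. C_k d k U (\<lambda>x. f x j))"

section \<open>Smooth manifolds\<close>

text \<open>
  A smooth structure is a dimension together with an atlas (not necessarily maximal).  A chart
  is a pair of its domain and its coordinate map; the points and the topology are determined by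
  the charts.
\<close>

record 'a manifold =
  mdim :: nat
  charts :: "('a set \<times> ('a \<Rightarrow> nat \<Rightarrow> real)) set"

definition points :: "'a manifold \<Rightarrow> 'a set" where
  "points X = (\<Union>(U, \<phi>)\<in>charts X. U)"

definition manifold_topology :: "'a manifold \<Rightarrow> 'a topology" where
  "manifold_topology X = topology (\<lambda>W. W \<subseteq> points X \<and>
     (\<forall>(U, \<phi>)\<in>charts X. openin (Euclidean_space (mdim X)) (\<phi> ` (W \<inter> U))))"

definition smooth_manifold :: "'a manifold \<Rightarrow> bool" where
  "smooth_manifold X \<longleftrightarrow>
     (\<forall>(U, \<phi>)\<in>charts X. inj_on \<phi> U \<and> openin (Euclidean_space (mdim X)) (\<phi> ` U)) \<and>
     (\<forall>(U, \<phi>)\<in>charts X. \<forall>(V, \<psi>)\<in>charts X.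
        openin (Euclidean_space (mdim X)) (\<phi> ` (U \<inter> V)) \<and>
        smooth_euclidean (mdim X) (mdim X) (\<phi> ` (U \<inter> V)) (\<lambda>x. \<psi> (inv_into U \<phi> x))) \<and>
     Hausdorff_space (manifold_topology X) \<and> second_countable (manifold_topology X)"

text \<open>Openness of the domains of the chart expressions amounts to continuity of \<open>f\<close>.\<close>

definition smooth_map :: "'a manifold \<Rightarrow> 'b manifold \<Rightarrow> ('a \<Rightarrow> 'b) \<Rightarrow> bool" where
  "smooth_map X Y f \<longleftrightarrow> f ` points X \<subseteq> points Y \<and>
     (\<forall>(U, \<phi>)\<in>charts X. \<forall>(V, \<psi>)\<in>charts Y.
        openin (Euclidean_space (mdim X)) (\<phi> ` (U \<inter> f -` V)) \<and>
        smooth_euclidean (mdim X) (mdim Y) (\<phi> ` (U \<inter> f -` V)) (\<lambda>x. \<psi> (f (inv_into U \<phi> x))))"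

definition product_manifold :: "'a manifold \<Rightarrow> 'b manifold \<Rightarrow> ('a \<times> 'b) manifold" where
  "product_manifold X Y =
     \<lparr>mdim = mdim X + mdim Y,
      charts = {(U \<times> V, \<lambda>(x, y) i. if i < mdim X then \<phi> x i else \<psi> y (i - mdim X)) | U \<phi> V \<psi>.
                  (U, \<phi>) \<in> charts X \<and> (V, \<psi>) \<in> charts Y}\<rparr>"

section \<open>Lie groups\<close>

record 'a lie = "'a monoid" +
  mfd :: "'a manifold"

definition lie_group :: "'a lie \<Rightarrow> bool" where
  "lie_group G \<longleftrightarrow> group G \<and> smooth_manifold (mfd G) \<and> carrier G = points (mfd G) \<and>
     smooth_map (product_manifold (mfd G) (mfd G)) (mfd G) (\<lambda>(x, y). x \<otimes>\<^bsub>G\<^esub> y) \<and>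
     smooth_map (mfd G) (mfd G) (\<lambda>x. inv\<^bsub>G\<^esub> x)"

definition lie_group_isomorphic :: "'a lie \<Rightarrow> 'b lie \<Rightarrow> bool" where
  "lie_group_isomorphic G H \<longleftrightarrow> lie_group G \<and> lie_group H \<and>
     (\<exists>f \<in> iso G H. smooth_map (mfd G) (mfd H) f \<and>
                     smooth_map (mfd H) (mfd G) (inv_into (carrier G) f))"

section \<open>Jets of curves and higher order tangent groups\<close>

text \<open>
  Only the germ at \<open>0\<close> matters: a curve is a map defined and smooth near \<open>0\<close>, whose values
  away from \<open>0\<close> are irrelevant.
\<close>

definition curve :: "'a manifold \<Rightarrow> (real \<Rightarrow> 'a) \<Rightarrow> bool" where
  "curve X p \<longleftrightarrow> (\<exists>(U, \<phi>)\<in>charts X. \<exists>e>0. \<forall>t\<in>{-e<..<e}. p t \<in> U \<and>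
     (\<forall>i < mdim X. \<forall>k. (deriv ^^ k) (\<lambda>s. \<phi> (p s) i) differentiable (at t)))"

definition same_derivs :: "'a manifold \<Rightarrow> nat \<Rightarrow> (real \<Rightarrow> 'a) \<Rightarrow> (real \<Rightarrow> 'a) \<Rightarrow> bool" where
  "same_derivs X n p q \<longleftrightarrow> p 0 = q 0 \<and>
     (\<forall>(U, \<phi>)\<in>charts X. p 0 \<in> U \<longrightarrow> (\<forall>k\<le>n. \<forall>i < mdim X.
        (deriv ^^ k) (\<lambda>t. \<phi> (p t) i) 0 = (deriv ^^ k) (\<lambda>t. \<phi> (q t) i) 0))"

definition jet :: "'a manifold \<Rightarrow> nat \<Rightarrow> (real \<Rightarrow> 'a) \<Rightarrow> (real \<Rightarrow> 'a) set" where
  "jet X n p = {q. curve X q \<and> same_derivs X n p q}"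

definition jets :: "'a manifold \<Rightarrow> nat \<Rightarrow> (real \<Rightarrow> 'a) set set" where
  "jets X n = {jet X n p | p. curve X p}"

definition representative :: "(real \<Rightarrow> 'a) set \<Rightarrow> real \<Rightarrow> 'a" where
  "representative c = (SOME p. p \<in> c)"

text \<open>
  A chart of \<open>X\<close> induces a chart of the \<open>n\<close>-jets over its domain: coordinate number
  \<open>k * mdim X + i\<close> is the \<open>k\<close>-th derivative at \<open>0\<close> of the \<open>i\<close>-th coordinate of the curve.
\<close>

definition jet_manifold :: "'a manifold \<Rightarrow> nat \<Rightarrow> (real \<Rightarrow> 'a) set manifold" where
  "jet_manifold X n =
     \<lparr>mdim = (n + 1) * mdim X,
      charts = {({c \<in> jets X n. representative c 0 \<in> U},
                 \<lambda>c j. if j < (n + 1) * mdim X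
                       then (deriv ^^ (j div mdim X))
                              (\<lambda>t. \<phi> (representative c t) (j mod mdim X)) 0
                       else 0) | U \<phi>. (U, \<phi>) \<in> charts X}\<rparr>"

text \<open>
  The group $T^n G$, with product $[p][q] = [pq]$; in the union all the jets occurring are equal.
\<close>

definition tangent_group :: "nat \<Rightarrow> 'a lie \<Rightarrow> (real \<Rightarrow> 'a) set lie" where
  "tangent_group n G =
     \<lparr>carrier = jets (mfd G) n,
      mult = (\<lambda>a b. \<Union>p\<in>a. \<Union>q\<in>b. jet (mfd G) n (\<lambda>t. p t \<otimes>\<^bsub>G\<^esub> q t)),
      one = jet (mfd G) n (\<lambda>t. \<one>\<^bsub>G\<^esub>),
      mfd = jet_manifold (mfd G) n\<rparr>"

section \<open>Iterated tangent groups\<close>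

definition transport_lie :: "('a \<Rightarrow> 'b) \<Rightarrow> 'a lie \<Rightarrow> 'b lie" where
  "transport_lie f G =
     \<lparr>carrier = f ` carrier G,
      mult = (\<lambda>x y. f (inv_into (carrier G) f x \<otimes>\<^bsub>G\<^esub> inv_into (carrier G) f y)),
      one = f \<one>\<^bsub>G\<^esub>,
      mfd = \<lparr>mdim = mdim (mfd G),
             charts = {(f ` U, \<lambda>x. \<phi> (inv_into (carrier G) f x)) | U \<phi>. (U, \<phi>) \<in> charts (mfd G)}\<rparr>\<rparr>"

text \<open>
  Each application of \<^term>\<open>tangent_group 1\<close> changes the type of the elements.  To iterate it
  a number of times given by a term, the elements of the iterates are put into one type: an
  equivalence class of curves is renamed, injectively, to a chosen representative tagged by
  \<open>Velocity\<close>, and the Lie group structure is transported along this renaming.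
\<close>

datatype 'a iterated_vector = Point 'a | Velocity "real \<Rightarrow> 'a iterated_vector"

primrec iterated_tangent_group :: "nat \<Rightarrow> 'a lie \<Rightarrow> 'a iterated_vector lie" where
  "iterated_tangent_group 0 G = transport_lie Point G"
| "iterated_tangent_group (Suc n) G =
     transport_lie (\<lambda>c. Velocity (representative c)) (tangent_group 1 (iterated_tangent_group n G))"

section \<open>Powers of the Lie algebra as manifolds\<close>

definition lie_algebra :: "'a lie \<Rightarrow> (real \<Rightarrow> 'a) set set" where
  "lie_algebra G = {jet (mfd G) 1 p | p. curve (mfd G) p \<and> p 0 = \<one>\<^bsub>G\<^esub>}"

text \<open>
  The \<open>m\<close>-tuples of elements of the tangent space at the identity.  Each chart \<open>\<phi>\<close> of the group
  around the identity gives a global (linear) chart, by applying the differential of \<open>\<phi>\<close> to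
  the entries and concatenating.
\<close>

definition lie_algebra_power :: "'a lie \<Rightarrow> nat \<Rightarrow> (nat \<Rightarrow> (real \<Rightarrow> 'a) set) manifold" where
  "lie_algebra_power G m = (let d = mdim (mfd G) in
     \<lparr>mdim = m * d,
      charts = {(\<Pi>\<^sub>E l\<in>{..<m}. lie_algebra G,
                 \<lambda>X j. if j < m * d
                       then deriv (\<lambda>t. \<phi> (representative (X (j div d)) t) (j mod d)) 0
                       else 0) | U \<phi>. (U, \<phi>) \<in> charts (mfd G) \<and> \<one>\<^bsub>G\<^esub> \<in> U}\<rparr>)"

section \<open>Cocycle double cross products\<close>

text \<open>
  Here \<open>act h m\<close> is $h \triangleright m$ and \<open>\<Phi> m m'\<close> is $m \cdot m'$.
\<close>

definition cocycle_matched_pair ::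
    "'m manifold \<Rightarrow> 'm \<Rightarrow> 'h lie \<Rightarrow> ('h \<Rightarrow> 'm \<Rightarrow> 'm) \<Rightarrow> ('h \<Rightarrow> 'm \<Rightarrow> 'h) \<Rightarrow>
     ('m \<Rightarrow> 'm \<Rightarrow> 'm) \<Rightarrow> ('m \<Rightarrow> 'm \<Rightarrow> 'h) \<Rightarrow> bool" where
  "cocycle_matched_pair M z H act \<sigma> \<Phi> \<gamma> \<longleftrightarrow>
     smooth_manifold M \<and> z \<in> points M \<and> lie_group H \<and>
     smooth_map (product_manifold (mfd H) M) M (\<lambda>(h, m). act h m) \<and>
     (\<forall>m\<in>points M. act \<one>\<^bsub>H\<^esub> m = m) \<and>
     (\<forall>h1\<in>carrier H. \<forall>h2\<in>carrier H. \<forall>m\<in>points M. act (h1 \<otimes>\<^bsub>H\<^esub> h2) m = act h1 (act h2 m)) \<and>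
     (\<forall>h\<in>carrier H. act h z = z) \<and>
     smooth_map (product_manifold (mfd H) M) (mfd H) (\<lambda>(h, m). \<sigma> h m) \<and>
     smooth_map (product_manifold M M) M (\<lambda>(m1, m2). \<Phi> m1 m2) \<and>
     smooth_map (product_manifold M M) (mfd H) (\<lambda>(m1, m2). \<gamma> m1 m2) \<and>
     (\<forall>h\<in>carrier H. \<sigma> h z = h) \<and>
     (\<forall>m\<in>points M. \<sigma> \<one>\<^bsub>H\<^esub> m = \<one>\<^bsub>H\<^esub>) \<and>
     \<gamma> z z = \<one>\<^bsub>H\<^esub> \<and>
     (\<forall>m\<in>points M. \<Phi> z m = m \<and> \<Phi> m z = m) \<and>
     (\<forall>m\<in>points M. \<gamma> m z = \<one>\<^bsub>H\<^esub> \<and> \<gamma> z m = \<one>\<^bsub>H\<^esub>) \<and>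
     (\<forall>h\<in>carrier H. \<forall>m1\<in>points M. \<forall>m2\<in>points M.
        act h (\<Phi> m1 m2) = \<Phi> (act h m1) (act (\<sigma> h m1) m2)) \<and>
     (\<forall>h\<in>carrier H. \<forall>m1\<in>points M. \<forall>m2\<in>points M.
        \<sigma> h (\<Phi> m1 m2) \<otimes>\<^bsub>H\<^esub> \<gamma> m1 m2 =
        \<gamma> (act h m1) (act (\<sigma> h m1) m2) \<otimes>\<^bsub>H\<^esub> \<sigma> (\<sigma> h m1) m2) \<and>
     (\<forall>h1\<in>carrier H. \<forall>h2\<in>carrier H. \<forall>m\<in>points M.
        \<sigma> (h1 \<otimes>\<^bsub>H\<^esub> h2) m = \<sigma> h1 (act h2 m) \<otimes>\<^bsub>H\<^esub> \<sigma> h2 m) \<and>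
     (\<forall>m1\<in>points M. \<forall>m2\<in>points M. \<forall>m3\<in>points M.
        \<Phi> m1 (\<Phi> m2 m3) = \<Phi> (\<Phi> m1 m2) (act (\<gamma> m1 m2) m3)) \<and>
     (\<forall>m1\<in>points M. \<forall>m2\<in>points M. \<forall>m3\<in>points M.
        \<gamma> m1 (\<Phi> m2 m3) \<otimes>\<^bsub>H\<^esub> \<gamma> m2 m3 =
        \<gamma> (\<Phi> m1 m2) (act (\<gamma> m1 m2) m3) \<otimes>\<^bsub>H\<^esub> \<sigma> (\<gamma> m1 m2) m3) \<and>
     (\<forall>m\<in>points M. \<exists>mr\<in>points M. \<Phi> m mr = z)"

definition cocycle_double_cross_product ::
    "'m manifold \<Rightarrow> 'm \<Rightarrow> 'h lie \<Rightarrow> ('h \<Rightarrow> 'm \<Rightarrow> 'm) \<Rightarrow> ('h \<Rightarrow> 'm \<Rightarrow> 'h) \<Rightarrow>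
     ('m \<Rightarrow> 'm \<Rightarrow> 'm) \<Rightarrow> ('m \<Rightarrow> 'm \<Rightarrow> 'h) \<Rightarrow> ('m \<times> 'h) lie" where
  "cocycle_double_cross_product M z H act \<sigma> \<Phi> \<gamma> =
     \<lparr>carrier = points M \<times> carrier H,
      mult = (\<lambda>(m1, h1) (m2, h2).
                (\<Phi> m1 (act h1 m2), \<gamma> m1 (act h1 m2) \<otimes>\<^bsub>H\<^esub> \<sigma> h1 m2 \<otimes>\<^bsub>H\<^esub> h2)),
      one = (z, \<one>\<^bsub>H\<^esub>),
      mfd = product_manifold M (mfd H)\<rparr>"

end

theory Submission
  imports Defs
begin

text \<open>
  Suppose that a Lie group \<open>K\<close> contains a Lie group \<open>H\<close> and that every element of \<open>K\<close> is uniquely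
  a product \<open>s(m) h\<close>, where \<open>s\<close> is a smooth map from a manifold \<open>M\<close> and the decomposition is smooth.
  Rewriting \<open>h s(m)\<close> and \<open>s(m) s(m')\<close> in this form defines a cocycle matched pair, whose axioms express
  associativity, and \<open>K\<close> is the cocycle double cross product.  So \<open>T\<^sup>n G\<close> has to be embedded in
  \<open>T\<^sup>(\<^sup>n\<^sup>) G\<close> with a complement diffeomorphic to a power of the Lie algebra.  Complements compose and
  are preserved by the tangent functor, so by induction it suffices to embed \<open>T\<^sup>n\<^sup>+\<^sup>1 G\<close> in
  \<open>T (T\<^sup>n G)\<close>, sending the jet of \<open>p\<close> to the velocity of \<open>u \<mapsto> [p(t + u)]\<close>, with a complement of
  dimension \<open>n dim G\<close>; indeed \<open>2 (2\<^sup>n - 1 - n) + n = 2\<^sup>n\<^sup>+\<^sup>1 - 1 - (n + 1)\<close>.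
\<close>

section \<open>Calculus on open subsets of Euclidean spaces\<close>

text \<open>All computations take place in the charts that a chart of \<open>G\<close> induces on
  jets. There an \<open>(n + 1)\<close>-jet, seen in \<open>T (T\<^sup>n G)\<close>, has its
  derivatives of orders 0 to \<open>n\<close> as base point and those of orders 1 to
  \<open>n + 1\<close> as velocity. Only the top derivative is new in the velocity; the
  \<open>n\<close> other blocks of \<open>dim G\<close> numbers are free and parametrize the
  complement. The obstacle is that this description depends on the chart, whereas the complement has
  to be global and smooth. The group removes it: multiplication by a suitable embedded jet moves
  every tangent vector to the fibre over the identity, where one chart suffices and the product is
  addition of vectors. The embedded jets needed for this come from a smooth section of
  \<open>T\<^sup>n\<^sup>+\<^sup>1 G\<close> over \<open>T\<^sup>n G\<close>, itself obtained by
  translation to the identity. Complements are modelled on Euclidean spaces, whose dimensions add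
  under composition. A power of the Lie algebra, having global linear charts, takes their place only
  at the end, together with the normalization that makes the section pass through the
  identity.\<close>

abbreviation Eucl :: "nat \<Rightarrow> (nat \<Rightarrow> real) set" where
  "Eucl d \<equiv> topspace (Euclidean_space d)"

abbreviation eopen :: "nat \<Rightarrow> (nat \<Rightarrow> real) set \<Rightarrow> bool" where
  "eopen d \<equiv> openin (Euclidean_space d)"

lemma mem_Eucl: "x \<in> Eucl d \<longleftrightarrow> (\<forall>i\<ge>d. x i = 0)"
  by (simp add: topspace_Euclidean_space)

lemma eopen_iff_open: "eopen d U \<longleftrightarrow> (\<exists>T. open T \<and> U = T \<inter> Eucl d)"
  unfolding Euclidean_space_def openin_subtopology euclidean_product_topology
  by simp

lemma eopen_Int_open: "eopen d U \<Longrightarrow> open T \<Longrightarrow> eopen d (U \<inter> T)"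
  unfolding eopen_iff_open by (metis Int_assoc Int_commute open_Int)

lemma eopen_Eucl [simp]: "eopen d (Eucl d)"
  by simp

lemma eopen_subset: "eopen d U \<Longrightarrow> U \<subseteq> Eucl d"
  by (rule openin_subset)

text \<open>A neighbourhood in the product topology may use a different radius for each coordinate.
  Coordinates from \<open>d\<close> on vanish throughout \<open>Eucl d\<close>, so only finitely
  many radii matter and their minimum can be taken.\<close>

lemma eopen_box:
  assumes "eopen d U" "x \<in> U"
  obtains e where "e > 0" "\<And>y. y \<in> Eucl d \<Longrightarrow> (\<And>i. i < d \<Longrightarrow> \<bar>y i - x i\<bar> < e) \<Longrightarrow> y \<in> U"
proof -
  obtain T where T: "open T" "U = T \<inter> Eucl d" using assms(1) eopen_iff_open by blast
  have "openin (product_topology (\<lambda>i. euclidean) UNIV) T"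
    using T(1) by (simp add: euclidean_product_topology)
  moreover have "x \<in> T" using T assms by auto
  ultimately obtain X where X: "x \<in> (\<Pi>\<^sub>E i\<in>UNIV. X i)" "\<And>i. open (X i :: real set)"
      "(\<Pi>\<^sub>E i\<in>UNIV. X i) \<subseteq> T"
    using product_topology_open_contains_basis[of "\<lambda>i. euclidean" UNIV T x] by auto
  have "\<exists>e>0. ball (x i) e \<subseteq> X i" for i
    using X(1) X(2)[of i] open_contains_ball by (auto simp: PiE_def Pi_def)
  then obtain ee where ee: "\<And>i. ee i > 0" "\<And>i. ball (x i) (ee i) \<subseteq> X i" by metis
  \<comment> \<open>The \<open>1\<close> keeps the set nonempty when \<open>d = 0\<close>.\<close>
  define e where "e = Min (insert 1 (ee ` {..<d}))"
  have e0: "e > 0" unfolding e_def by (subst Min_gr_iff) (auto simp: ee)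
  have le: "e \<le> ee i" if "i < d" for i unfolding e_def using that by (intro Min_le) auto
  show thesis
  proof (rule that[OF e0])
    fix y assume y: "y \<in> Eucl d" "\<And>i. i < d \<Longrightarrow> \<bar>y i - x i\<bar> < e"
    have "y i \<in> X i" for i
    proof (cases "i < d")
      case True
      then have "y i \<in> ball (x i) (ee i)" using y(2)[OF True] le[OF True] by (simp add: dist_real_def)
      then show ?thesis using ee(2) by blast
    next
      case False
      then have "y i = x i" using y(1) assms(1,2) eopen_subset[OF assms(1)] by (auto simp: mem_Eucl)
      then show ?thesis using X(1) by auto
    qed
    then show "y \<in> U" using X(3) T(2) y(1) by auto
  qed
qed

lemma eopen_subopen:
  assumes "\<And>x. x \<in> U \<Longrightarrow> \<exists>W. eopen d W \<and> x \<in> W \<and> W \<subseteq> U"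
  shows "eopen d U"
  using assms by (subst openin_subopen) blast

lemma coordinate_upd_mem:
  assumes "x \<in> Eucl d" "i < d" shows "x(i := t) \<in> Eucl d"
  using assms by (auto simp: mem_Eucl)

text \<open>The derivatives in \<open>C_k\<close> are taken along coordinate lines of the whole
  sequence space. This is why they depend only on the values of the function on the open set
  \<open>U\<close>.\<close>

lemma eventually_upd_mem:
  assumes "eopen d U" "x \<in> U" "i < d"
  shows "eventually (\<lambda>t. x(i := t) \<in> U) (nhds (x i))"
proof -
  obtain e where e: "e > 0" "\<And>y. y \<in> Eucl d \<Longrightarrow> (\<And>i. i < d \<Longrightarrow> \<bar>y i - x i\<bar> < e) \<Longrightarrow> y \<in> U"
    using eopen_box[OF assms(1,2)] by blast
  have "eventually (\<lambda>t. t \<in> ball (x i) e) (nhds (x i))"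
    using e(1) by (intro eventually_nhds_in_open) auto
  then show ?thesis
  proof eventually_elim
    case (elim t)
    then show ?case
      using e assms coordinate_upd_mem[of x d i t] eopen_subset[OF assms(1)]
      by (intro e(2)) (auto simp: dist_real_def)
  qed
qed

lemma continuous_on_coordE:
  fixes f :: "(nat \<Rightarrow> real) \<Rightarrow> real"
  assumes "eopen d U" "continuous_on U f" "x \<in> U" "e > 0"
  obtains \<delta> where "\<delta> > 0" "\<And>y. y \<in> Eucl d \<Longrightarrow> (\<And>i. i < d \<Longrightarrow> \<bar>y i - x i\<bar> < \<delta>) \<Longrightarrow> y \<in> U \<and> \<bar>f y - f x\<bar> < e"
proof -
  have "\<exists>A. open A \<and> x \<in> A \<and> (\<forall>y\<in>U. y \<in> A \<longrightarrow> f y \<in> ball (f x) e)"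
    using assms(2)[unfolded continuous_on_topological, rule_format, of x "ball (f x) e"] assms(3,4) by auto
  then obtain A where A: "open A" "x \<in> A" "\<forall>y\<in>U. y \<in> A \<longrightarrow> f y \<in> ball (f x) e" by blast
  have "eopen d (U \<inter> A)" using eopen_Int_open assms(1) A by blast
  then obtain \<delta> where "\<delta> > 0" "\<And>y. y \<in> Eucl d \<Longrightarrow> (\<And>i. i < d \<Longrightarrow> \<bar>y i - x i\<bar> < \<delta>) \<Longrightarrow> y \<in> U \<inter> A"
    using eopen_box[of d "U \<inter> A" x] A assms(3) by blast
  then show thesis using A(3) by (intro that[of \<delta>]) (auto simp: dist_real_def abs_minus_commute)
qed

text \<open>\<open>C_k\<close> only asserts that some derivative functions exist. A fixed choice
  through \<open>deriv\<close>, independent of the set, allows them to be compared and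
  iterated.\<close>

definition pd :: "nat \<Rightarrow> ((nat \<Rightarrow> real) \<Rightarrow> real) \<Rightarrow> (nat \<Rightarrow> real) \<Rightarrow> real" where
  "pd i f x = deriv (\<lambda>t. f (x(i := t))) (x i)"

definition smooth_on :: "nat \<Rightarrow> (nat \<Rightarrow> real) set \<Rightarrow> ((nat \<Rightarrow> real) \<Rightarrow> real) \<Rightarrow> bool" where
  "smooth_on d U f \<longleftrightarrow> (\<forall>k. C_k d k U f)"

section \<open>Rules for functions of class \<open>C^k\<close>\<close>

lemma smooth_euclidean_iff: "smooth_euclidean d e U f \<longleftrightarrow> (\<forall>j<e. smooth_on d U (\<lambda>x. f x j))"
  by (simp add: smooth_euclidean_def smooth_on_def)

lemma C_k_continuous: "C_k d k U f \<Longrightarrow> continuous_on U f"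
  by (cases k) auto

lemma C_k_SucE:
  assumes "C_k d (Suc k) U f"
  obtains h where "continuous_on U f" "\<And>i x. i < d \<Longrightarrow> x \<in> U \<Longrightarrow>
      ((\<lambda>t. f (x(i := t))) has_real_derivative h i x) (at (x i))" "\<And>i. i < d \<Longrightarrow> C_k d k U (h i)"
  using assms unfolding C_k.simps(2) by metis

lemma C_k_SucI:
  assumes "continuous_on U f" "\<And>i x. i < d \<Longrightarrow> x \<in> U \<Longrightarrow>
      ((\<lambda>t. f (x(i := t))) has_real_derivative h i x) (at (x i))" "\<And>i. i < d \<Longrightarrow> C_k d k U (h i)"
  shows "C_k d (Suc k) U f"
  using assms unfolding C_k.simps(2) by (intro conjI exI[of _ h] allI impI ballI)

lemma C_k_cong:
  assumes "eopen d U" "\<And>x. x \<in> U \<Longrightarrow> f x = g x" "C_k d k U f"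
  shows "C_k d k U g"
proof (cases k)
  case 0
  then show ?thesis using assms continuous_on_cong[of U U f g] by auto
next
  case (Suc l)
  then obtain h where h: "continuous_on U f" "\<And>i x. i < d \<Longrightarrow> x \<in> U \<Longrightarrow>
      ((\<lambda>t. f (x(i := t))) has_real_derivative h i x) (at (x i))" "\<And>i. i < d \<Longrightarrow> C_k d l U (h i)"
    using assms(3) C_k_SucE by metis
  have "((\<lambda>t. g (x(i := t))) has_real_derivative h i x) (at (x i))" if "i < d" "x \<in> U" for i x
  proof (rule DERIV_cong_ev[THEN iffD1, OF refl _ refl h(2)[OF that]])
    show "\<forall>\<^sub>F t in nhds (x i). f (x(i := t)) = g (x(i := t))"
      using eventually_upd_mem[OF assms(1) that(2,1)] by eventually_elim (rule assms(2))
  qed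
  moreover have "continuous_on U g" using assms(2) h(1) continuous_on_cong[of U U f g] by auto
  ultimately show ?thesis using Suc h(3) by auto
qed

lemma C_k_subset: "C_k d k U f \<Longrightarrow> W \<subseteq> U \<Longrightarrow> C_k d k W f"
proof (induction k arbitrary: f)
  case 0
  then show ?case using continuous_on_subset by auto
next
  case (Suc k)
  from Suc.prems(1) obtain h where h: "continuous_on U f" "\<And>i x. i < d \<Longrightarrow> x \<in> U \<Longrightarrow>
      ((\<lambda>t. f (x(i := t))) has_real_derivative h i x) (at (x i))" "\<And>i. i < d \<Longrightarrow> C_k d k U (h i)"
    using C_k_SucE by metis
  then show ?case using Suc continuous_on_subset[of U f W] by (auto intro!: exI[of _ h])
qed

text \<open>Derivatives are unique, so any witness agrees with \<open>pd\<close> on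
  \<open>U\<close>, and openness of \<open>U\<close> transfers its differentiability.\<close>

lemma C_k_Suc_pd:
  assumes "eopen d U"
  shows "C_k d (Suc k) U f \<longleftrightarrow> continuous_on U f \<and>
     (\<forall>i<d. (\<forall>x\<in>U. ((\<lambda>t. f (x(i := t))) has_real_derivative pd i f x) (at (x i))) \<and> C_k d k U (pd i f))"
    (is "?l \<longleftrightarrow> ?r")
proof
  assume l: ?l
  obtain h where h: "continuous_on U f" "\<And>i x. i < d \<Longrightarrow> x \<in> U \<Longrightarrow>
      ((\<lambda>t. f (x(i := t))) has_real_derivative h i x) (at (x i))" "\<And>i. i < d \<Longrightarrow> C_k d k U (h i)"
    using C_k_SucE[OF l] by metis
  have eq: "h i x = pd i f x" if "i < d" "x \<in> U" for i x
    unfolding pd_def using DERIV_imp_deriv[OF h(2)[OF that]] by simp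
  then have "C_k d k U (pd i f)" if "i < d" for i
    using C_k_cong[OF assms(1) _ h(3)[OF that], of "pd i f"] that by auto
  then show ?r using h eq by simp
next
  assume ?r
  then show ?l by (auto intro!: exI[of _ "\<lambda>i. pd i f"])
qed

lemma C_k_pd:
  assumes "eopen d U" "C_k d (Suc k) U f" "i < d"
  shows "C_k d k U (pd i f)"
    and "x \<in> U \<Longrightarrow> ((\<lambda>t. f (x(i := t))) has_real_derivative pd i f x) (at (x i))"
  using assms(2,3) unfolding C_k_Suc_pd[OF assms(1)] by auto

lemma C_k_mono: "C_k d (Suc k) U f \<Longrightarrow> C_k d k U f"
proof (induction k arbitrary: f)
  case (Suc k)
  from Suc.prems obtain h where h: "continuous_on U f" "\<And>i x. i < d \<Longrightarrow> x \<in> U \<Longrightarrow>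
      ((\<lambda>t. f (x(i := t))) has_real_derivative h i x) (at (x i))" "\<And>i. i < d \<Longrightarrow> C_k d (Suc k) U (h i)"
    using C_k_SucE by blast
  have "C_k d k U (h i)" if "i < d" for i
    using Suc.IH h(3)[OF that] by blast
  with h(1,2) show ?case unfolding C_k.simps(2) by (intro conjI exI[of _ h] allI impI ballI)
qed simp

lemma C_k_le: "C_k d k U f \<Longrightarrow> l \<le> k \<Longrightarrow> C_k d l U f"
  proof (induction k)
  case (Suc k)
  then show ?case by (metis C_k_mono le_Suc_eq)
qed simp

lemma C_k_const [simp]: "C_k d k U (\<lambda>x. c)"
  by (induction k arbitrary: c) (auto intro!: exI[of _ "\<lambda>i x. 0"])

lemma continuous_on_coordinate: "continuous_on U (\<lambda>x::nat \<Rightarrow> real. x a)"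
  by (rule continuous_on_subset[OF continuous_on_product_coordinates subset_UNIV])

lemma C_k_coordinate [simp]: "C_k d k U (\<lambda>x. x a)"
proof (cases k)
  case 0
  then show ?thesis by (simp add: continuous_on_coordinate)
next
  case (Suc l)
  have "((\<lambda>t. (x(i := t)) a) has_real_derivative (if i = a then 1 else 0)) (at (x i))" for x :: "nat \<Rightarrow> real" and i
    by (cases "i = a") auto
  then show ?thesis using Suc continuous_on_coordinate
    by (auto intro!: exI[of _ "\<lambda>i x. if i = a then 1 else 0"])
qed

lemma C_k_add: "C_k d k U f \<Longrightarrow> C_k d k U g \<Longrightarrow> C_k d k U (\<lambda>x. f x + g x)"
proof (induction k arbitrary: f g)
  case 0
  then show ?case by (auto intro: continuous_intros)
next
  case (Suc k)
  obtain h where h: "continuous_on U f" "\<And>i x. i < d \<Longrightarrow> x \<in> U \<Longrightarrow>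
      ((\<lambda>t. f (x(i := t))) has_real_derivative h i x) (at (x i))" "\<And>i. i < d \<Longrightarrow> C_k d k U (h i)"
    using C_k_SucE[OF Suc.prems(1)] by metis
  obtain l where l: "continuous_on U g" "\<And>i x. i < d \<Longrightarrow> x \<in> U \<Longrightarrow>
      ((\<lambda>t. g (x(i := t))) has_real_derivative l i x) (at (x i))" "\<And>i. i < d \<Longrightarrow> C_k d k U (l i)"
    using C_k_SucE[OF Suc.prems(2)] by metis
  show ?case using h l Suc.IH
    by (auto intro!: exI[of _ "\<lambda>i x. h i x + l i x"] continuous_intros DERIV_add)
qed

text \<open>The Leibniz rule multiplies a derivative of one factor by the other factor itself, so
  the induction uses both factors at the lower order as well.\<close>

lemma C_k_mult: "C_k d k U f \<Longrightarrow> C_k d k U g \<Longrightarrow> C_k d k U (\<lambda>x. f x * g x)"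
proof (induction k arbitrary: f g)
  case 0
  then show ?case by (auto intro: continuous_intros)
next
  case (Suc k)
  obtain h where h: "continuous_on U f" "\<And>i x. i < d \<Longrightarrow> x \<in> U \<Longrightarrow>
      ((\<lambda>t. f (x(i := t))) has_real_derivative h i x) (at (x i))" "\<And>i. i < d \<Longrightarrow> C_k d k U (h i)"
    using C_k_SucE[OF Suc.prems(1)] by metis
  obtain l where l: "continuous_on U g" "\<And>i x. i < d \<Longrightarrow> x \<in> U \<Longrightarrow>
      ((\<lambda>t. g (x(i := t))) has_real_derivative l i x) (at (x i))" "\<And>i. i < d \<Longrightarrow> C_k d k U (l i)"
    using C_k_SucE[OF Suc.prems(2)] by metis
  have *: "((\<lambda>t. f (x(i := t)) * g (x(i := t))) has_real_derivative h i x * g x + l i x * f x) (at (x i))"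
    if "i < d" "x \<in> U" for i x
    using DERIV_mult[OF h(2)[OF that] l(2)[OF that]] by simp
  show ?case using h l Suc.IH * C_k_mono[OF Suc.prems(1)] C_k_mono[OF Suc.prems(2)]
    by (auto intro!: exI[of _ "\<lambda>i x. h i x * g x + l i x * f x"] continuous_intros C_k_add)
qed

lemma C_k_sum: "(\<And>a. a \<in> A \<Longrightarrow> C_k d k U (f a)) \<Longrightarrow> C_k d k U (\<lambda>x. \<Sum>a\<in>A. f a x)"
proof (induction A rule: infinite_finite_induct)
  case (insert a A)
  then show ?case by (simp add: C_k_add)
qed auto

text \<open>Derivative functions chosen on the pieces need not fit together; they are all replaced
  by \<open>pd\<close>, which does not know the piece.\<close>

lemma C_k_local:
  assumes "eopen d U" "\<And>x. x \<in> U \<Longrightarrow> \<exists>W. eopen d W \<and> x \<in> W \<and> W \<subseteq> U \<and> C_k d k W f"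
  shows "C_k d k U f"
  using assms(2)
proof (induction k arbitrary: f)
  have cont: "continuous_on U f" if loc: "\<And>x. x \<in> U \<Longrightarrow> \<exists>W. eopen d W \<and> x \<in> W \<and> W \<subseteq> U \<and> continuous_on W f"
    for f :: "(nat \<Rightarrow> real) \<Rightarrow> real"
    unfolding continuous_on_topological
  proof (intro ballI allI impI)
    fix x B assume x: "x \<in> U" "open B" "f x \<in> B"
    obtain W where W: "eopen d W" "x \<in> W" "W \<subseteq> U" "continuous_on W f" using loc[OF x(1)] by (elim exE conjE)
    obtain T where T: "open T" "W = T \<inter> Eucl d" using W eopen_iff_open by blast
    obtain A where "open A" "x \<in> A" "\<forall>y\<in>W. y \<in> A \<longrightarrow> f y \<in> B"
      using W x unfolding continuous_on_topological by blast
    then show "\<exists>A. open A \<and> x \<in> A \<and> (\<forall>y\<in>U. y \<in> A \<longrightarrow> f y \<in> B)"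
      using T W eopen_subset[OF assms(1)] by (intro exI[of _ "A \<inter> T"]) auto
  qed
  {
    case 0
    show ?case unfolding C_k.simps(1) by (rule cont) (use 0 in \<open>simp only: C_k.simps(1)\<close>)
  next
    case (Suc k)
    have "continuous_on U f"
    proof (rule cont)
      fix x assume x: "x \<in> U"
      obtain W where W: "eopen d W" "x \<in> W" "W \<subseteq> U" "C_k d (Suc k) W f"
        using Suc.prems[OF x] by (elim exE conjE)
      then show "\<exists>W. eopen d W \<and> x \<in> W \<and> W \<subseteq> U \<and> continuous_on W f"
        using C_k_continuous[OF W(4)] by (intro exI[of _ W] conjI)
    qed
    moreover have "((\<lambda>t. f (x(i := t))) has_real_derivative pd i f x) (at (x i))" if i: "i < d" and x: "x \<in> U" for i x
    proof -
      obtain W where W: "eopen d W" "x \<in> W" "C_k d (Suc k) W f"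
        using Suc.prems[OF x] by (elim exE conjE)
      show ?thesis using C_k_pd(2)[OF W(1,3) i W(2)] .
    qed
    moreover have "C_k d k U (pd i f)" if "i < d" for i
    proof (rule Suc.IH)
      fix x assume x: "x \<in> U"
      obtain W where W: "eopen d W" "x \<in> W" "W \<subseteq> U" "C_k d (Suc k) W f"
        using Suc.prems[OF x] by (elim exE conjE)
      then show "\<exists>W. eopen d W \<and> x \<in> W \<and> W \<subseteq> U \<and> C_k d k W (pd i f)"
        using C_k_pd(1)[OF W(1,4) that] by (intro exI[of _ W] conjI)
    qed
    ultimately show ?case unfolding C_k_Suc_pd[OF assms(1)] by auto
  }
qed

lemma smooth_on_cong: "eopen d U \<Longrightarrow> smooth_on d U f \<Longrightarrow> (\<And>x. x \<in> U \<Longrightarrow> f x = g x) \<Longrightarrow> smooth_on d U g"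
  unfolding smooth_on_def using C_k_cong by blast

lemma smooth_on_subset: "smooth_on d U f \<Longrightarrow> W \<subseteq> U \<Longrightarrow> smooth_on d W f"
  unfolding smooth_on_def using C_k_subset by blast

lemma smooth_on_continuous: "smooth_on d U f \<Longrightarrow> continuous_on U f"
  unfolding smooth_on_def using C_k_continuous by blast

lemma smooth_on_const [simp]: "smooth_on d U (\<lambda>x. c)"
  and smooth_on_coordinate [simp]: "smooth_on d U (\<lambda>x. x a)"
  by (auto simp: smooth_on_def)

lemma smooth_on_mult: "smooth_on d U f \<Longrightarrow> smooth_on d U g \<Longrightarrow> smooth_on d U (\<lambda>x. f x * g x)"
  by (auto simp: smooth_on_def C_k_mult)

lemma smooth_on_sum: "(\<And>a. a \<in> A \<Longrightarrow> smooth_on d U (f a)) \<Longrightarrow> smooth_on d U (\<lambda>x. \<Sum>a\<in>A. f a x)"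
  by (auto simp: smooth_on_def intro!: C_k_sum)

lemma smooth_on_local:
  assumes "eopen d U" "\<And>x. x \<in> U \<Longrightarrow> \<exists>W. eopen d W \<and> x \<in> W \<and> W \<subseteq> U \<and> smooth_on d W f"
  shows "smooth_on d U f"
  unfolding smooth_on_def
  by (meson C_k_local assms smooth_on_def)

lemma smooth_on_pd:
  assumes "eopen d U" "smooth_on d U f" "i < d"
  shows "smooth_on d U (pd i f)"
    and "x \<in> U \<Longrightarrow> ((\<lambda>t. f (x(i := t))) has_real_derivative pd i f x) (at (x i))"
proof -
  have f: "C_k d (Suc k) U f" for k using assms(2) unfolding smooth_on_def by blast
  show "smooth_on d U (pd i f)" unfolding smooth_on_def using C_k_pd(1)[OF assms(1) f assms(3)] by blast
  show "x \<in> U \<Longrightarrow> ((\<lambda>t. f (x(i := t))) has_real_derivative pd i f x) (at (x i))"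
    by (rule C_k_pd(2)[OF assms(1) f assms(3)])
qed

text \<open>The endpoints come in no particular order and may coincide, as happens for a coordinate
  of a curve near a given time.\<close>

lemma mean_value_between:
  assumes "\<And>s. min a b \<le> s \<Longrightarrow> s \<le> max a b \<Longrightarrow> (f has_real_derivative f' s) (at s)"
  obtains s where "min a b \<le> s" "s \<le> max a b" "f b - f a = (b - a) * f' s"
proof -
  consider "a < b" | "b < a" | "a = b" by linarith
  then show thesis
  proof cases
    case 1
    then obtain z where "a < z" "z < b" "f b - f a = (b - a) * f' z"
      using MVT2[of a b f f'] assms by (auto simp: min_def max_def)
    then show thesis using 1 by (intro that[of z]) auto
  next
    case 2
    then obtain z where "b < z" "z < a" "f a - f b = (a - b) * f' z"
      using MVT2[of b a f f'] assms by (auto simp: min_def max_def)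
    then show thesis using 2 by (intro that[of z]) (auto simp: algebra_simps)
  next
    case 3
    then show thesis by (intro that[of a]) auto
  qed
qed

text \<open>The coordinates are moved from \<open>c t0\<close> to \<open>c t\<close> one at a time.\<close>

lemma chain_rule_curve:
  assumes U: "eopen d U" and f: "C_k d (Suc 0) U f" and c0: "c t0 \<in> U"
    and cU: "eventually (\<lambda>t. c t \<in> Eucl d) (nhds t0)"
    and c': "\<And>j. j < d \<Longrightarrow> ((\<lambda>t. c t j) has_real_derivative c' j) (at t0)"
  shows "((\<lambda>t. f (c t)) has_real_derivative (\<Sum>j<d. pd j f (c t0) * c' j)) (at t0)"
proof -
  define z where "z m t = (\<lambda>j. if j < m then c t j else c t0 j)" for m t
  have cont: "isCont (\<lambda>t. c t j) t0" if "j < d" for j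
    using c'[OF that] DERIV_isCont by blast
  have small: "eventually (\<lambda>t. \<forall>j<d. \<bar>c t j - c t0 j\<bar> < e) (nhds t0)" if "e > 0" for e
  proof -
    have "eventually (\<lambda>t. \<bar>c t j - c t0 j\<bar> < e) (nhds t0)" if "j < d" for j
    proof -
      have "((\<lambda>t. c t j) \<longlongrightarrow> c t0 j) (nhds t0)"
        using cont[OF that] by (simp add: continuous_at tendsto_nhds_iff)
      then show ?thesis using \<open>e > 0\<close> by (auto dest!: tendstoD simp: dist_real_def)
    qed
    then have "eventually (\<lambda>t. \<forall>j\<in>{..<d}. \<bar>c t j - c t0 j\<bar> < e) (nhds t0)"
      by (intro eventually_ball_finite) auto
    then show ?thesis by (simp add: Ball_def)
  qed
  have c0E: "c t0 \<in> Eucl d" using c0 eopen_subset[OF U] by auto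
  have "((\<lambda>t. f (z m t)) has_real_derivative (\<Sum>j<m. pd j f (c t0) * c' j)) (at t0)" if "m \<le> d" for m
    using that
  proof (induction m)
    case 0
    then show ?case by (simp add: z_def)
  next
    case (Suc m)
    then have m: "m < d" by simp
    define g where "g = pd m f"
    define h where "h t = f (z (Suc m) t) - f (z m t)" for t
    \<comment> \<open>The difference quotient of \<open>f\<close> in the \<open>m\<close>-th
      coordinate. Where the denominator vanishes it gets the expected limit: the coordinate may
      return to its initial value arbitrarily close to \<open>t0\<close>, and the factorization of
      \<open>h t\<close> in \<open>key\<close> has to hold there too.\<close>
    define q where "q t = (if c t m = c t0 m then g (c t0) else h t / (c t m - c t0 m))" for t
    have gc: "continuous_on U g" using C_k_pd(1)[OF U f m] unfolding g_def by simp
    have fd: "((\<lambda>t. f (x(m := t))) has_real_derivative g x) (at (x m))" if "x \<in> U" for x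
      using C_k_pd(2)[OF U f m that] unfolding g_def by simp
    \<comment> \<open>By the mean value theorem \<open>q t\<close> is a value of the
      \<open>m\<close>-th partial derivative in a small box around \<open>c t0\<close>; continuity
      of that derivative then controls it.\<close>
    have key: "eventually (\<lambda>t. h t = q t * (c t m - c t0 m) \<and> \<bar>q t - g (c t0)\<bar> < e) (nhds t0)" if e: "e > 0" for e
    proof -
      obtain \<delta> where \<delta>: "\<delta> > 0" "\<And>y. y \<in> Eucl d \<Longrightarrow> (\<And>i. i < d \<Longrightarrow> \<bar>y i - c t0 i\<bar> < \<delta>) \<Longrightarrow> y \<in> U \<and> \<bar>g y - g (c t0)\<bar> < e"
        using continuous_on_coordE[OF U gc c0 e] by metis
      show ?thesis using small[OF \<delta>(1)] cU
      proof eventually_elim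
        case (elim t)
        define y where "y s = (z m t)(m := s)" for s
        have in_box: "y s \<in> U \<and> \<bar>g (y s) - g (c t0)\<bar> < e" if "min (c t0 m) (c t m) \<le> s" "s \<le> max (c t0 m) (c t m)" for s
        proof (rule \<delta>(2))
          show "y s \<in> Eucl d" using elim(2) c0E m by (auto simp: mem_Eucl y_def z_def)
          fix i assume i: "i < d"
          have "\<bar>s - c t0 m\<bar> < \<delta>" using that elim(1) m by (auto simp: min_def max_def split: if_splits)
          then show "\<bar>y s i - c t0 i\<bar> < \<delta>" using elim(1) i \<delta>(1) by (auto simp: y_def z_def)
        qed
        have "((\<lambda>s. f (y s)) has_real_derivative g (y s)) (at s)"
          if "min (c t0 m) (c t m) \<le> s" "s \<le> max (c t0 m) (c t m)" for s
          using fd[of "y s"] in_box[OF that] by (simp add: y_def)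
        then obtain s where s: "min (c t0 m) (c t m) \<le> s" "s \<le> max (c t0 m) (c t m)"
            "f (y (c t m)) - f (y (c t0 m)) = (c t m - c t0 m) * g (y s)"
          using mean_value_between[of "c t0 m" "c t m" "\<lambda>s. f (y s)" "\<lambda>s. g (y s)"] by blast
        have "y (c t m) = z (Suc m) t" "y (c t0 m) = z m t" by (auto simp: y_def z_def fun_eq_iff)
        then have "h t = (c t m - c t0 m) * g (y s)" using s(3) by (simp add: h_def)
        then show ?case using in_box[OF s(1,2)] e by (auto simp: q_def)
      qed
    qed
    have "(q \<longlongrightarrow> g (c t0)) (at t0)"
    proof (rule tendstoI)
      fix e :: real assume "e > 0"
      from key[OF this] show "\<forall>\<^sub>F t in at t0. dist (q t) (g (c t0)) < e"
        by (auto simp: dist_real_def eventually_at_filter elim: eventually_mono)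
    qed
    then have "((\<lambda>t. q t * ((c t m - c t0 m) / (t - t0))) \<longlongrightarrow> g (c t0) * c' m) (at t0)"
      using c'[OF m] by (intro tendsto_mult) (auto simp: has_field_derivative_iff)
    moreover have "eventually (\<lambda>t. q t * ((c t m - c t0 m) / (t - t0)) = (h t - h t0) / (t - t0)) (at t0)"
    proof -
      have "h t0 = 0" by (simp add: h_def z_def)
      then have "eventually (\<lambda>t. q t * ((c t m - c t0 m) / (t - t0)) = (h t - h t0) / (t - t0)) (nhds t0)"
        using key[of 1] by (auto elim!: eventually_mono)
      then show ?thesis by (auto simp: eventually_at_filter elim: eventually_mono)
    qed
    ultimately have "((\<lambda>t. (h t - h t0) / (t - t0)) \<longlongrightarrow> g (c t0) * c' m) (at t0)"
      using tendsto_cong by fast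
    then have "(h has_real_derivative g (c t0) * c' m) (at t0)"
      by (simp add: has_field_derivative_iff)
    with Suc.IH m have "((\<lambda>t. f (z m t) + h t) has_real_derivative (\<Sum>j<m. pd j f (c t0) * c' j) + g (c t0) * c' m) (at t0)"
      by (intro DERIV_add) auto
    then show ?case by (simp add: h_def g_def)
  qed
  from this[of d] have A: "((\<lambda>t. f (z d t)) has_real_derivative (\<Sum>j<d. pd j f (c t0) * c' j)) (at t0)" by simp
  \<comment> \<open>After \<open>d\<close> moves the whole point has been moved, since both
    \<open>c t\<close> and \<open>c t0\<close> vanish from index \<open>d\<close> on.\<close>
  have B: "eventually (\<lambda>t. f (z d t) = f (c t)) (nhds t0)"
    using cU
  proof eventually_elim
    case (elim t)
    then have "z d t = c t" using c0E by (auto simp: z_def fun_eq_iff mem_Eucl)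
    then show ?case by simp
  qed
  show ?thesis by (rule DERIV_cong_ev[THEN iffD1, OF refl B refl A])
qed

lemma continuous_on_coordinates:
  assumes "\<And>j. j < e \<Longrightarrow> continuous_on V (\<lambda>x. g x j)" "g ` V \<subseteq> Eucl e"
  shows "continuous_on V (g :: (nat \<Rightarrow> real) \<Rightarrow> nat \<Rightarrow> real)"
proof (rule continuous_on_coordinatewise_then_product)
  fix j show "continuous_on V (\<lambda>x. g x j)"
  proof (cases "j < e")
    case False
    then have "continuous_on V (\<lambda>x. g x j) \<longleftrightarrow> continuous_on V (\<lambda>x. 0 :: real)"
      using assms(2) by (intro continuous_on_cong) (auto simp: mem_Eucl)
    then show ?thesis by simp
  qed (use assms in auto)
qed

text \<open>By induction on \<open>k\<close> for all \<open>f\<close> at once: the partial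
  derivatives of the composition are sums of products of functions \<open>pd j f (g x)\<close>, to
  which the induction hypothesis applies, and partial derivatives of the coordinates of
  \<open>g\<close>.\<close>

lemma C_k_compose:
  assumes V: "eopen d V" and U: "eopen e U" and gU: "g ` V \<subseteq> U"
  shows "C_k e k U f \<Longrightarrow> (\<And>j. j < e \<Longrightarrow> C_k d k V (\<lambda>x. g x j)) \<Longrightarrow> C_k d k V (\<lambda>x. f (g x))"
proof (induction k arbitrary: f)
  have cont: "continuous_on V (\<lambda>x. f (g x))" if "continuous_on U f" "\<And>j. j < e \<Longrightarrow> continuous_on V (\<lambda>x. g x j)"
    for f :: "(nat \<Rightarrow> real) \<Rightarrow> real"
  proof -
    have "continuous_on V g" using continuous_on_coordinates that(2) gU eopen_subset[OF U] by blast
    then show ?thesis using that(1) gU by (intro continuous_on_compose2[of U f V g]) auto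
  qed
  {
    case 0
    then show ?case using cont by auto
  next
    case (Suc k)
    have gk: "C_k d k V (\<lambda>x. g x j)" if "j < e" for j using C_k_mono[OF Suc.prems(2)[OF that]] .
    have fk: "C_k e k U (pd j f)" if "j < e" for j using C_k_pd(1)[OF U Suc.prems(1) that] .
    define D where "D i x = (\<Sum>j<e. pd j f (g x) * pd i (\<lambda>x. g x j) x)" for i x
    have D1: "C_k d k V (D i)" if "i < d" for i
      unfolding D_def
    proof (rule C_k_sum)
      fix j assume "j \<in> {..<e}"
      then have j: "j < e" by simp
      have "C_k d k V (pd i (\<lambda>x. g x j))"
        using C_k_pd(1)[OF V Suc.prems(2)[OF j] that] .
      then show "C_k d k V (\<lambda>x. pd j f (g x) * pd i (\<lambda>x. g x j) x)"
        using Suc.IH[OF fk[OF j] gk] by (rule C_k_mult[rotated])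
    qed
    have D2: "((\<lambda>t. f (g (x(i := t)))) has_real_derivative D i x) (at (x i))" if "i < d" "x \<in> V" for i x
    proof -
      have "((\<lambda>t. f (g (x(i := t)))) has_real_derivative
          (\<Sum>j<e. pd j f (g (x(i := x i))) * pd i (\<lambda>x. g x j) x)) (at (x i))"
      proof (rule chain_rule_curve[OF U])
        show "C_k e (Suc 0) U f"
          by (rule C_k_le[OF Suc.prems(1)]) simp
        show "g (x(i := x i)) \<in> U" using that gU by auto
        show "\<forall>\<^sub>F t in nhds (x i). g (x(i := t)) \<in> Eucl e"
          using eventually_upd_mem[OF V that(2,1)]
          by eventually_elim (use gU eopen_subset[OF U] in auto)
        fix j assume "j < e"
        then show "((\<lambda>t. g (x(i := t)) j) has_real_derivative pd i (\<lambda>x. g x j) x) (at (x i))"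
          by (rule C_k_pd(2)[OF V Suc.prems(2) that])
      qed
      then show ?thesis by (simp add: D_def)
    qed
    have "continuous_on V (\<lambda>x. f (g x))"
      by (rule cont[OF C_k_continuous[OF Suc.prems(1)] C_k_continuous[OF Suc.prems(2)]])
    then show ?case using D2 D1 by (rule C_k_SucI)
  }
qed

lemma smooth_on_compose:
  assumes "eopen d V" "eopen e U" "g ` V \<subseteq> U" "smooth_on e U f" "smooth_euclidean d e V g"
  shows "smooth_on d V (\<lambda>x. f (g x))"
  unfolding smooth_on_def
proof
  fix k
  show "C_k d k V (\<lambda>x. f (g x))"
    using assms(4,5) C_k_compose[OF assms(1-3), of k f] by (simp add: smooth_euclidean_def smooth_on_def)
qed

lemma smooth_euclidean_compose:
  assumes "eopen d V" "eopen e U" "g ` V \<subseteq> U" "smooth_euclidean e e' U f" "smooth_euclidean d e V g"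
  shows "smooth_euclidean d e' V (\<lambda>x. f (g x))"
  unfolding smooth_euclidean_iff
proof (intro allI impI)
  fix j assume "j < e'"
  then have "smooth_on e U (\<lambda>x. f x j)" using assms(4) by (simp add: smooth_euclidean_iff)
  from smooth_on_compose[OF assms(1-3) this assms(5)] show "smooth_on d V (\<lambda>x. f (g x) j)" .
qed

lemma smooth_euclidean_subset: "smooth_euclidean d e U f \<Longrightarrow> W \<subseteq> U \<Longrightarrow> smooth_euclidean d e W f"
  unfolding smooth_euclidean_iff by (auto intro: smooth_on_subset)

lemma smooth_euclidean_cong:
  "eopen d U \<Longrightarrow> smooth_euclidean d e U f \<Longrightarrow> (\<And>x. x \<in> U \<Longrightarrow> f x = g x) \<Longrightarrow> smooth_euclidean d e U g"
  unfolding smooth_euclidean_iff by (metis (no_types, lifting) smooth_on_cong)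

lemma eopen_preimage:
  assumes "eopen d A" "smooth_euclidean d e A g" "g ` A \<subseteq> Eucl e" "eopen e O'"
  shows "eopen d {x \<in> A. g x \<in> O'}"
proof -
  obtain T where T: "open T" "O' = T \<inter> Eucl e" using assms(4) eopen_iff_open by blast
  have "continuous_on A g"
    using assms(2,3) smooth_on_continuous unfolding smooth_euclidean_iff by (intro continuous_on_coordinates) auto
  then have "openin (top_of_set A) (A \<inter> g -` T)" using T by (intro continuous_openin_preimage_gen) auto
  then obtain S where "open S" "A \<inter> g -` T = A \<inter> S" by (auto simp: openin_open)
  moreover have "{x \<in> A. g x \<in> O'} = A \<inter> g -` T" using T assms(3) by auto
  ultimately show ?thesis using eopen_Int_open[OF assms(1)] by metis
qed

section \<open>Derivatives along curves\<close>

text \<open>The differentiability condition of \<open>curve\<close>, for a single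
  coordinate.\<close>

definition smooth_real :: "real set \<Rightarrow> (real \<Rightarrow> real) \<Rightarrow> bool" where
  "smooth_real I f \<longleftrightarrow> (\<forall>k. \<forall>t\<in>I. (deriv ^^ k) f differentiable (at t))"

lemma smooth_real_subset: "smooth_real I f \<Longrightarrow> J \<subseteq> I \<Longrightarrow> smooth_real J f"
  by (auto simp: smooth_real_def)

lemma higher_deriv_deriv: "(deriv ^^ k) (deriv f) = (deriv ^^ Suc k) f"
  by (simp add: funpow_swap1)

lemma smooth_real_deriv: "smooth_real I f \<Longrightarrow> smooth_real I (deriv f)"
  unfolding smooth_real_def higher_deriv_deriv by blast

lemma smooth_real_higher_deriv: "smooth_real I f \<Longrightarrow> smooth_real I ((deriv ^^ k) f)"
  by (induction k) (auto intro: smooth_real_deriv)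

lemma smooth_real_has_derivative:
  assumes "smooth_real I f" "t \<in> I"
  shows "(f has_real_derivative deriv f t) (at t)"
proof -
  have "(deriv ^^ 0) f differentiable (at t)" using assms unfolding smooth_real_def by blast
  then show ?thesis by (simp add: DERIV_deriv_iff_real_differentiable)
qed

lemma eopen_line: "open I \<Longrightarrow> eopen 1 {x \<in> Eucl 1. x 0 \<in> I}"
proof -
  assume "open I"
  then have "open ((\<lambda>x::nat \<Rightarrow> real. x 0) -` I)"
    by (intro open_vimage continuous_on_product_coordinates)
  then have "eopen 1 (Eucl 1 \<inter> (\<lambda>x. x 0) -` I)" by (intro eopen_Int_open) auto
  moreover have "Eucl 1 \<inter> (\<lambda>x. x 0) -` I = {x \<in> Eucl 1. x 0 \<in> I}" by auto
  ultimately show ?thesis by simp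
qed

text \<open>Makes the calculus of several variables available for curves: an open set of times
  becomes an open subset of \<open>Eucl 1\<close>.\<close>

lemma smooth_real_iff:
  assumes "open I"
  shows "smooth_real I f \<longleftrightarrow> smooth_on 1 {x \<in> Eucl 1. x 0 \<in> I} (\<lambda>x. f (x 0))"
proof
  let ?L = "{x \<in> Eucl 1. x 0 \<in> I}"
  have "C_k 1 k ?L (\<lambda>x. f (x 0))" if "smooth_real I f" for k
    using that
  proof (induction k arbitrary: f)
    have cont: "continuous_on ?L (\<lambda>x. f (x 0))" if "smooth_real I f" for f
    proof (rule continuous_on_compose2[of I f])
      show "continuous_on I f"
        by (rule DERIV_continuous_on[OF has_field_derivative_at_within[OF smooth_real_has_derivative[OF that]]])
      show "continuous_on ?L (\<lambda>x. x 0)" by (rule continuous_on_coordinate)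
    qed auto
    {
      case 0
      then show ?case using cont by simp
    next
      case (Suc k)
      show ?case
      proof (rule C_k_SucI[where h = "\<lambda>i x. deriv f (x 0)"])
        show "C_k 1 k ?L (\<lambda>x. deriv f (x 0))" by (rule Suc.IH[OF smooth_real_deriv[OF Suc.prems]])
        fix i :: nat and x assume "i < 1" "x \<in> ?L"
        then show "((\<lambda>t. f ((x(i := t)) 0)) has_real_derivative deriv f (x 0)) (at (x i))"
          using smooth_real_has_derivative[OF Suc.prems] by auto
      qed (rule cont[OF Suc.prems])
    }
  qed
  then show "smooth_real I f \<Longrightarrow> smooth_on 1 ?L (\<lambda>x. f (x 0))" by (simp add: smooth_on_def)
  have "(deriv ^^ k) f differentiable (at t)" if "smooth_on 1 ?L (\<lambda>x. f (x 0))" "t \<in> I" for k t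
    using that
  proof (induction k arbitrary: f)
    case 0
    define x :: "nat \<Rightarrow> real" where "x = (\<lambda>i. if i = 0 then t else 0)"
    have "x \<in> ?L" using 0 by (auto simp: x_def mem_Eucl)
    from smooth_on_pd(2)[OF eopen_line[OF assms] 0(1) zero_less_one this]
    have "(f has_real_derivative pd 0 (\<lambda>x. f (x 0)) x) (at t)" by (simp add: x_def)
    then show ?case using real_differentiable_def by auto
  next
    case (Suc k)
    have "pd 0 (\<lambda>x. f (x 0)) = (\<lambda>x. deriv f (x 0))" by (simp add: pd_def fun_eq_iff)
    then have "smooth_on 1 ?L (\<lambda>x. deriv f (x 0))"
      using smooth_on_pd(1)[OF eopen_line[OF assms] Suc.prems(1) zero_less_one] by simp
    from Suc.IH[OF this Suc.prems(2)] show ?case unfolding higher_deriv_deriv .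
  qed
  then show "smooth_on 1 ?L (\<lambda>x. f (x 0)) \<Longrightarrow> smooth_real I f" by (simp add: smooth_real_def)
qed

lemma smooth_real_compose:
  assumes I: "open I" and O': "eopen d O'" "smooth_on d O' F"
    and p: "\<And>t. t \<in> I \<Longrightarrow> p t \<in> O'" "\<And>j. j < d \<Longrightarrow> smooth_real I (\<lambda>t. p t j)"
  shows "smooth_real I (\<lambda>t. F (p t))"
  unfolding smooth_real_iff[OF I]
proof (rule smooth_on_compose[OF eopen_line[OF I] O'(1) _ O'(2), where g = "\<lambda>x. p (x 0)"])
  show "smooth_euclidean 1 d {x \<in> Eucl 1. x 0 \<in> I} (\<lambda>x. p (x 0))"
    unfolding smooth_euclidean_iff using p(2) smooth_real_iff[OF I] by auto
qed (use p in auto)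

lemma smooth_real_const [simp]: "smooth_real I (\<lambda>t. c)"
proof -
  have "smooth_real UNIV (\<lambda>t::real. c)" unfolding smooth_real_iff[OF open_UNIV] by simp
  then show ?thesis using smooth_real_subset by blast
qed

lemma smooth_real_cong:
  assumes "open I" "smooth_real I f" "\<And>t. t \<in> I \<Longrightarrow> f t = g t"
  shows "smooth_real I g"
  using assms(2) smooth_on_cong[OF eopen_line[OF assms(1)], of "\<lambda>x. f (x 0)" "\<lambda>x. g (x 0)"] assms(3)
  unfolding smooth_real_iff[OF assms(1)] by simp

text \<open>Agreement at \<open>x\<close> alone would not survive differentiation. The induction is
  over agreement near \<open>x\<close>, which holds near all nearby points as well.\<close>

lemma higher_deriv_cong:
  assumes "eventually (\<lambda>t. f t = g t) (nhds x)"
  shows "(deriv ^^ k) f x = (deriv ^^ k) (g :: real \<Rightarrow> real) x"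
proof -
  have "eventually (\<lambda>t. (deriv ^^ k) f t = (deriv ^^ k) g t) (nhds x)"
  proof (induction k)
    case (Suc k)
    then have "eventually (\<lambda>t. eventually (\<lambda>t. (deriv ^^ k) f t = (deriv ^^ k) g t) (nhds t)) (nhds x)"
      by (simp add: eventually_eventually)
    then show ?case by eventually_elim (auto intro!: deriv_cong_ev)
  qed (use assms in simp)
  then show ?thesis by (rule eventually_nhds_x_imp_x)
qed

lemma higher_deriv_const: "(deriv ^^ k) (\<lambda>t::real. c) = (\<lambda>t. if k = 0 then c else (0::real))"
proof (induction k)
  case (Suc k)
  then show ?case by (cases k) simp_all
qed simp

lemma higher_deriv_shift: "(deriv ^^ k) (\<lambda>t. f (t + u)) = (\<lambda>t. (deriv ^^ k) f (t + u))"
  for f :: "real \<Rightarrow> real"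
proof (induction k)
  case (Suc k)
  have "deriv (\<lambda>t. g (t + u)) = (\<lambda>t. deriv g (t + u))" for g :: "real \<Rightarrow> real"
    by (simp add: fun_eq_iff deriv_def DERIV_shift)
  then show ?case using Suc by simp
qed simp

lemma deriv_compose:
  assumes "eopen d O'" "smooth_on d O' F" "p t \<in> O'" "eventually (\<lambda>t. p t \<in> Eucl d) (nhds t)"
    "\<And>j. j < d \<Longrightarrow> ((\<lambda>s. p s j) has_real_derivative p' j) (at t)"
  shows "deriv (\<lambda>s. F (p s)) t = (\<Sum>j<d. pd j F (p t) * p' j)"
proof -
  have "C_k d (Suc 0) O' F" using assms(2) unfolding smooth_on_def by (rule spec)
  from chain_rule_curve[OF assms(1) this assms(3-5)] show ?thesis by (rule DERIV_imp_deriv)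
qed

text \<open>Read as a map on an open subset of \<open>Eucl 1\<close>, the curve is continuous, so
  the preimage of \<open>O'\<close> is a neighbourhood of 0.\<close>

lemma curve_stays_in_open:
  assumes e: "e > 0" and O': "eopen d O'" "p 0 \<in> O'"
    and p: "\<And>t. \<bar>t\<bar> < e \<Longrightarrow> p t \<in> Eucl d" "\<And>j. j < d \<Longrightarrow> smooth_real {-e<..<e} (\<lambda>t. p t j)"
  obtains e' where "e' > 0" "e' \<le> e" "\<And>t. \<bar>t\<bar> < e' \<Longrightarrow> p t \<in> O'"
proof -
  let ?L = "{x \<in> Eucl 1. x 0 \<in> {-e<..<e}}"
  have A: "eopen 1 {x \<in> ?L. p (x 0) \<in> O'}"
  proof (rule eopen_preimage[OF _ _ _ O'(1)])
    show "eopen 1 ?L" by (rule eopen_line) simp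
    show "smooth_euclidean 1 d ?L (\<lambda>x. p (x 0))"
      unfolding smooth_euclidean_iff using p(2) smooth_real_iff[of "{-e<..<e}"] by auto
    show "(\<lambda>x. p (x 0)) ` ?L \<subseteq> Eucl d"
    proof (rule image_subsetI)
      fix x :: "nat \<Rightarrow> real" assume "x \<in> ?L"
      then have "\<bar>x 0\<bar> < e" by auto
      then show "p (x 0) \<in> Eucl d" by (rule p(1))
    qed
  qed
  have B: "(\<lambda>i. 0) \<in> {x \<in> ?L. p (x 0) \<in> O'}" using e O' by (auto simp: mem_Eucl)
  show thesis
  proof (rule eopen_box[OF A B])
    fix r assume r: "r > 0" "\<And>y. y \<in> Eucl 1 \<Longrightarrow> (\<And>i. i < 1 \<Longrightarrow> \<bar>y i - 0\<bar> < r) \<Longrightarrow> y \<in> {x \<in> ?L. p (x 0) \<in> O'}"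
    show thesis
    proof (rule that[of "min e r"])
      fix t assume t: "\<bar>t\<bar> < min e r"
      have "(\<lambda>i. if i = 0 then t else 0) \<in> {x \<in> ?L. p (x 0) \<in> O'}"
        using t by (intro r(2)) (auto simp: mem_Eucl)
      then show "p t \<in> O'" by simp
    qed (use e r in auto)
  qed
qed

section \<open>Coordinates of jets and total derivatives\<close>

definition trunc :: "nat \<Rightarrow> (nat \<Rightarrow> real) \<Rightarrow> nat \<Rightarrow> real" where
  "trunc d x = (\<lambda>i. if i < d then x i else 0)"

lemma trunc_mem [simp]: "trunc d x \<in> Eucl d"
  by (auto simp: trunc_def mem_Eucl)

lemma trunc_id [simp]: "x \<in> Eucl d \<Longrightarrow> trunc d x = x"
  by (auto simp: trunc_def mem_Eucl fun_eq_iff)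

lemma smooth_euclidean_trunc: "smooth_euclidean N d U (trunc d)"
  by (auto simp: smooth_euclidean_iff trunc_def)

lemma eopen_trunc: "eopen d O' \<Longrightarrow> eopen N {x \<in> Eucl N. trunc d x \<in> O'}"
  by (rule eopen_preimage[OF eopen_Eucl smooth_euclidean_trunc]) auto

text \<open>
  \<open>prol d k F\<close> is the \<open>k\<close>-th total derivative of \<open>F\<close>: the variable number \<open>j * d + i\<close> stands for
  the \<open>j\<close>-th derivative of the \<open>i\<close>-th coordinate along a curve.
\<close>

primrec prol :: "nat \<Rightarrow> nat \<Rightarrow> ((nat \<Rightarrow> real) \<Rightarrow> real) \<Rightarrow> (nat \<Rightarrow> real) \<Rightarrow> real" where
  "prol d 0 F = (\<lambda>x. F (trunc d x))"
| "prol d (Suc k) F = (\<lambda>x. \<Sum>a<Suc k * d. pd a (prol d k F) x * x (a + d))"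

text \<open>The number \<open>N\<close> of variables may exceed what \<open>prol d k F\<close>
  involves, because in the chart of the \<open>n\<close>-jets all orders \<open>k \<le> n\<close>
  are functions on the same space. Only the base point, given by the first \<open>d\<close>
  variables, is confined to the domain of \<open>F\<close>.\<close>

lemma smooth_on_prol:
  assumes "eopen d O'" "smooth_on d O' F"
  shows "Suc k * d \<le> N \<Longrightarrow> smooth_on N {x \<in> Eucl N. trunc d x \<in> O'} (prol d k F)"
proof (induction k)
  case 0
  show ?case unfolding prol.simps
    by (rule smooth_on_compose[OF eopen_trunc[OF assms(1)] assms(1) _ assms(2) smooth_euclidean_trunc]) auto
next
  case (Suc k)
  then have IH: "smooth_on N {x \<in> Eucl N. trunc d x \<in> O'} (prol d k F)" by simp
  show ?case unfolding prol.simps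
  proof (intro smooth_on_sum smooth_on_mult smooth_on_coordinate)
    fix a assume "a \<in> {..<Suc k * d}"
    then have "a < N" using Suc.prems by simp
    then show "smooth_on N {x \<in> Eucl N. trunc d x \<in> O'} (pd a (prol d k F))"
      by (rule smooth_on_pd(1)[OF eopen_trunc[OF assms(1)] IH])
  qed
qed

lemma prol_eqI: "(\<And>i. i < Suc k * d \<Longrightarrow> x i = y i) \<Longrightarrow> prol d k F x = prol d k F y"
proof (induction k arbitrary: x y)
  case 0
  then show ?case by (auto simp: trunc_def intro!: arg_cong[of _ _ F])
next
  case (Suc k)
  have "pd a (prol d k F) x * x (a + d) = pd a (prol d k F) y * y (a + d)" if "a < Suc k * d" for a
  proof -
    have "prol d k F (x(a := t)) = prol d k F (y(a := t))" for t
      using Suc.prems by (intro Suc.IH) auto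
    then show ?thesis using Suc.prems[of a] Suc.prems[of "a + d"] that unfolding pd_def by simp
  qed
  then show ?case by simp
qed

text \<open>Removes from the chain rule those variables whose time derivatives are no longer
  coordinates of the jet.\<close>

lemma pd_prol_eq_0:
  assumes "Suc k * d \<le> a" shows "pd a (prol d k F) x = 0"
proof -
  have "prol d k F (x(a := t)) = prol d k F x" for t
    using assms by (intro prol_eqI) auto
  then show ?thesis by (simp add: pd_def)
qed

text \<open>At \<open>t = 0\<close> this is the coordinate map of \<open>jet_manifold\<close>. The
  free \<open>t\<close> makes it a curve that can be differentiated in turn.\<close>

definition jet_coords :: "nat \<Rightarrow> nat \<Rightarrow> (real \<Rightarrow> nat \<Rightarrow> real) \<Rightarrow> real \<Rightarrow> nat \<Rightarrow> real" where
  "jet_coords n d p t = (\<lambda>a. if a < (n + 1) * d then (deriv ^^ (a div d)) (\<lambda>s. p s (a mod d)) t else 0)"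

lemma jet_coords_mem: "jet_coords n d p t \<in> Eucl ((n + 1) * d)"
  by (auto simp: jet_coords_def mem_Eucl)

lemmas jet_coords_mem_simp [simp] = jet_coords_mem[simplified]

lemma trunc_jet_coords: "p t \<in> Eucl d \<Longrightarrow> trunc d (jet_coords n d p t) = p t"
  by (auto simp: trunc_def jet_coords_def fun_eq_iff mem_Eucl)

lemma jet_coords_eq_iff:
  "jet_coords n d p t = jet_coords n d q t \<longleftrightarrow>
    (\<forall>k\<le>n. \<forall>i<d. (deriv ^^ k) (\<lambda>s. p s i) t = (deriv ^^ k) (\<lambda>s. q s i) t)" (is "?l \<longleftrightarrow> ?r")
proof
  assume l: ?l
  show ?r
  proof (intro allI impI)
    fix k i assume "k \<le> n" "i < d"
    then have "k * d + i < (n + 1) * d"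
      using mult_le_mono1[of k n d] unfolding add_mult_distrib by linarith
    then show "(deriv ^^ k) (\<lambda>s. p s i) t = (deriv ^^ k) (\<lambda>s. q s i) t"
      using fun_cong[OF l, of "k * d + i"] \<open>i < d\<close> by (simp add: jet_coords_def)
  qed
next
  assume r: ?r
  show ?l
  proof
    fix a
    have "a div d \<le> n" "a mod d < d" if "a < (n + 1) * d"
    proof -
      have "d > 0" using that by (cases d) auto
      then show "a mod d < d" by simp
      show "a div d \<le> n" using that less_mult_imp_div_less[of a "n + 1" d] by simp
    qed
    then show "jet_coords n d p t a = jet_coords n d q t a" using r by (auto simp: jet_coords_def)
  qed
qed

lemma jet_coords_cong:
  assumes "eventually (\<lambda>s. p s = q s) (nhds t)"
  shows "jet_coords n d p t = jet_coords n d q t"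
  unfolding jet_coords_def
  by (intro ext if_cong refl higher_deriv_cong eventually_mono[OF assms]) simp

text \<open>The chain rule applied to \<open>prol d k F\<close> along the jet of the curve
  multiplies the partial derivative in variable \<open>a\<close> by the time derivative of that
  variable, which is variable \<open>a + d\<close>. This is the recursion of \<open>prol\<close>, so
  no explicit formula for higher derivatives of a composition is needed.\<close>

lemma higher_deriv_prol:
  assumes O': "eopen d O'" "smooth_on d O' F" and I: "open I"
    and p: "\<And>t. t \<in> I \<Longrightarrow> p t \<in> O'" "\<And>j. j < d \<Longrightarrow> smooth_real I (\<lambda>t. p t j)"
  shows "k \<le> n \<Longrightarrow> t \<in> I \<Longrightarrow> (deriv ^^ k) (\<lambda>s. F (p s)) t = prol d k F (jet_coords n d p t)"
proof (induction k arbitrary: t)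
  case 0
  then show ?case using p(1) eopen_subset[OF O'(1)] trunc_jet_coords by (metis funpow_0 prol.simps(1) subsetD)
next
  case (Suc k)
  let ?N = "(n + 1) * d" and ?P = "jet_coords n d p"
  \<comment> \<open>The time derivative of coordinate \<open>a\<close> of the jet. For the entries
    of order \<open>n\<close> it is not itself a coordinate, but \<open>prol d k F\<close> with
    \<open>k < n\<close> does not involve these entries.\<close>
  define P' where "P' a = (if a < ?N then (deriv ^^ Suc (a div d)) (\<lambda>s. p s (a mod d)) t else 0)" for a
  have tr: "trunc d (?P s) = p s" if "s \<in> I" for s
    using p(1)[OF that] eopen_subset[OF O'(1)] by (intro trunc_jet_coords) auto
  have evI: "eventually (\<lambda>s. s \<in> I) (nhds t)" using I Suc.prems eventually_nhds_in_open by blast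
  have kN: "Suc (Suc k) * d \<le> ?N" using Suc.prems(1) by (intro mult_le_mono1) simp
  have "(deriv ^^ Suc k) (\<lambda>s. F (p s)) t = deriv (\<lambda>s. prol d k F (?P s)) t"
    unfolding funpow.simps comp_def
    using evI by (intro deriv_cong_ev) (auto elim!: eventually_mono intro!: Suc.IH simp: Suc_leD[OF Suc.prems(1)])
  also have "\<dots> = (\<Sum>a<?N. pd a (prol d k F) (?P t) * P' a)"
  proof (rule deriv_compose[OF eopen_trunc[OF O'(1)] smooth_on_prol[OF O']])
    show "Suc k * d \<le> ?N" by (rule order_trans[OF mult_le_mono1 kN]) simp
    show "?P t \<in> {x \<in> Eucl ?N. trunc d x \<in> O'}"
      using tr[OF Suc.prems(2)] p(1)[OF Suc.prems(2)] jet_coords_mem by (intro CollectI conjI) simp_all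
    fix a assume a: "a < ?N"
    then have "a mod d < d" by (cases "d = 0") auto
    from smooth_real_has_derivative[OF smooth_real_higher_deriv[OF p(2)[OF this]] Suc.prems(2), of "a div d"]
    show "((\<lambda>s. ?P s a) has_real_derivative P' a) (at t)"
      using a by (simp add: jet_coords_def P'_def)
  qed simp
  also have "\<dots> = (\<Sum>a<Suc k * d. pd a (prol d k F) (?P t) * P' a)"
  proof (rule sum.mono_neutral_right)
    show "{..<Suc k * d} \<subseteq> {..<?N}"
      unfolding lessThan_subset_iff by (rule order_trans[OF mult_le_mono1 kN]) simp
  qed (auto simp: pd_prol_eq_0 simp del: mult_Suc)
  also have "\<dots> = (\<Sum>a<Suc k * d. pd a (prol d k F) (?P t) * ?P t (a + d))"
  proof (rule sum.cong[OF refl])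
    fix a assume a: "a \<in> {..<Suc k * d}"
    then have "a + d < ?N" "d > 0" using kN by (auto intro: Nat.gr0I)
    then have "P' a = ?P t (a + d)" by (simp add: P'_def jet_coords_def)
    then show "pd a (prol d k F) (?P t) * P' a = pd a (prol d k F) (?P t) * ?P t (a + d)" by simp
  qed
  finally show ?case by simp
qed

text \<open>The action of a smooth map on jets: all entries of the new jet are total derivatives
  evaluated at the old one, hence determined by it.\<close>

lemma jet_coords_prol:
  assumes "eopen d O'" "smooth_euclidean d e O' F" "open I" "t \<in> I"
    "\<And>t. t \<in> I \<Longrightarrow> p t \<in> O'" "\<And>j. j < d \<Longrightarrow> smooth_real I (\<lambda>t. p t j)"
  shows "jet_coords n e (\<lambda>s. F (p s)) t =
    (\<lambda>a. if a < (n + 1) * e then prol d (a div e) (\<lambda>x. F x (a mod e)) (jet_coords n d p t) else 0)"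
proof
  fix a
  have "a div e \<le> n" "a mod e < e" if "a < (n + 1) * e"
  proof -
    have "e > 0" using that by (cases e) auto
    then show "a mod e < e" by simp
    show "a div e \<le> n" using that less_mult_imp_div_less[of a "n + 1" e] by simp
  qed
  then show "jet_coords n e (\<lambda>s. F (p s)) t a =
    (if a < (n + 1) * e then prol d (a div e) (\<lambda>x. F x (a mod e)) (jet_coords n d p t) else 0)"
    using assms(2) higher_deriv_prol[OF assms(1) _ assms(3,5,6) _ assms(4), of "\<lambda>x. F x (a mod e)" "a div e" n]
    unfolding jet_coords_def[of n e] smooth_euclidean_iff by simp
qed

text \<open>With factorials in the denominators differentiation merely shifts the coefficients, so
  that \<open>c k\<close> becomes the \<open>k\<close>-th derivative at 0.\<close>

lemma deriv_exp_poly: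
  "deriv (\<lambda>t. \<Sum>j<m. c j * t ^ j / fact j) = (\<lambda>t. \<Sum>j<m - 1. c (Suc j) * t ^ j / fact j)"
  "(\<lambda>t. \<Sum>j<m. c j * t ^ j / fact j) differentiable (at s)"
  for c :: "nat \<Rightarrow> real"
proof -
  have *: "((\<lambda>t. \<Sum>j<m. c j * t ^ j / fact j) has_real_derivative (\<Sum>j<m - 1. c (Suc j) * t ^ j / fact j)) (at t)" for t
  proof (cases m)
    case (Suc l)
    have "((\<lambda>t. c 0 + (\<Sum>j<l. c (Suc j) * t ^ Suc j / fact (Suc j))) has_real_derivative
        0 + (\<Sum>j<l. c (Suc j) * t ^ j / fact j)) (at t)"
    proof (intro DERIV_add DERIV_sum DERIV_const)
      fix j
      have "((\<lambda>t. c (Suc j) * t ^ Suc j / fact (Suc j)) has_real_derivative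
          c (Suc j) * (real (Suc j) * t ^ j) / fact (Suc j)) (at t)"
        by (intro DERIV_cdivide DERIV_cmult) (use DERIV_pow[of "Suc j" t] in simp)
      moreover have "c (Suc j) * (real (Suc j) * t ^ j) / fact (Suc j) = c (Suc j) * t ^ j / fact j"
        by (simp add: field_simps del: of_nat_Suc)
      ultimately show "((\<lambda>t. c (Suc j) * t ^ Suc j / fact (Suc j)) has_real_derivative c (Suc j) * t ^ j / fact j) (at t)"
        by metis
    qed
    then show ?thesis using Suc by (simp add: sum.lessThan_Suc_shift del: sum.lessThan_Suc)
  qed simp
  show "deriv (\<lambda>t. \<Sum>j<m. c j * t ^ j / fact j) = (\<lambda>t. \<Sum>j<m - 1. c (Suc j) * t ^ j / fact j)"
    using * DERIV_imp_deriv by blast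
  show "(\<lambda>t. \<Sum>j<m. c j * t ^ j / fact j) differentiable (at s)"
    using * real_differentiable_def by blast
qed

lemma higher_deriv_exp_poly:
  "(deriv ^^ k) (\<lambda>t. \<Sum>j<m. c j * t ^ j / fact j) = (\<lambda>t. \<Sum>j<m - k. c (j + k) * t ^ j / fact j)"
  for c :: "nat \<Rightarrow> real"
proof (induction k)
  case (Suc k)
  then show ?case using deriv_exp_poly(1)[of "\<lambda>j. c (j + k)" "m - k"] by simp
qed simp

text \<open>The Taylor polynomial with these coefficients. It is the reason why the charts of the
  jets take all values in the derivative coordinates.\<close>

lemma exists_curve_jet_coords:
  assumes "x \<in> Eucl ((n + 1) * d)"
  obtains p where "\<And>t. p t \<in> Eucl d" "\<And>j. smooth_real UNIV (\<lambda>t. p t j)" "jet_coords n d p 0 = x"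
proof
  define p where "p t = (\<lambda>i. if i < d then \<Sum>k<n + 1. x (k * d + i) * t ^ k / fact k else 0)" for t :: real
  show "p t \<in> Eucl d" for t by (auto simp: p_def mem_Eucl)
  show "smooth_real UNIV (\<lambda>t. p t j)" for j
  proof (cases "j < d")
    case True
    have "smooth_real UNIV (\<lambda>t. \<Sum>k<n + 1. x (k * d + j) * t ^ k / fact k)"
      unfolding smooth_real_def higher_deriv_exp_poly by (intro ballI allI deriv_exp_poly(2))
    then show ?thesis using True by (simp add: p_def)
  qed (simp add: p_def)
  show "jet_coords n d p 0 = x"
  proof
    fix a
    show "jet_coords n d p 0 a = x a"
    proof (cases "a < (n + 1) * d")
      case True
      then have "d > 0" by (cases d) auto
      then have "a mod d < d" by simp
      moreover have "a div d < n + 1" using True less_mult_imp_div_less[of a "n + 1" d] by simp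
      \<comment> \<open>Only the constant term survives at 0, by \<open>0 ^ 0 = 1\<close>.\<close>
      moreover have "(\<Sum>j<m. c j * 0 ^ j / fact j) = c 0" if "m > 0" for m and c :: "nat \<Rightarrow> real"
        using that by (cases m) (auto simp: sum.lessThan_Suc_shift simp del: sum.lessThan_Suc)
      ultimately show ?thesis using True
        unfolding jet_coords_def p_def by (simp add: higher_deriv_exp_poly del: sum.lessThan_Suc)
    next
      case False
      then show ?thesis using assms by (auto simp: jet_coords_def mem_Eucl)
    qed
  qed
qed

section \<open>Manifolds and smooth maps\<close>

text \<open>\<open>smooth_manifold\<close> without Hausdorffness and second countability, which are
  established separately for each construction.\<close>

definition atlas :: "'a manifold \<Rightarrow> bool" where
  "atlas X \<longleftrightarrow>
     (\<forall>(U, \<phi>)\<in>charts X. inj_on \<phi> U \<and> eopen (mdim X) (\<phi> ` U)) \<and>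
     (\<forall>(U, \<phi>)\<in>charts X. \<forall>(V, \<psi>)\<in>charts X. eopen (mdim X) (\<phi> ` (U \<inter> V)) \<and>
        smooth_euclidean (mdim X) (mdim X) (\<phi> ` (U \<inter> V)) (\<lambda>x. \<psi> (inv_into U \<phi> x)))"

lemma atlas_inj: "atlas X \<Longrightarrow> (U, \<phi>) \<in> charts X \<Longrightarrow> inj_on \<phi> U"
  by (auto simp: atlas_def)

lemma atlas_open: "atlas X \<Longrightarrow> (U, \<phi>) \<in> charts X \<Longrightarrow> eopen (mdim X) (\<phi> ` U)"
  by (auto simp: atlas_def)

lemma atlas_mem: "atlas X \<Longrightarrow> (U, \<phi>) \<in> charts X \<Longrightarrow> x \<in> U \<Longrightarrow> \<phi> x \<in> Eucl (mdim X)"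
  using atlas_open eopen_subset by blast

lemma atlas_inv: "atlas X \<Longrightarrow> (U, \<phi>) \<in> charts X \<Longrightarrow> x \<in> U \<Longrightarrow> inv_into U \<phi> (\<phi> x) = x"
  by (simp add: atlas_inj inv_into_f_f)

lemma in_points: "(U, \<phi>) \<in> charts X \<Longrightarrow> x \<in> U \<Longrightarrow> x \<in> points X"
  by (auto simp: points_def)

lemma points_cover:
  assumes "x \<in> points X" obtains U \<phi> where "(U, \<phi>) \<in> charts X" "x \<in> U"
  using assms by (auto simp: points_def)

lemma smooth_manifold_atlas: "smooth_manifold X \<Longrightarrow> atlas X"
  by (simp add: smooth_manifold_def atlas_def)

text \<open>A transition map matters only through its values on the overlap, so an explicit
  \<open>F\<close> can take the place of an expression with \<open>inv_into\<close>.\<close>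

lemma atlasI:
  assumes inj: "\<And>U \<phi>. (U, \<phi>) \<in> charts X \<Longrightarrow> inj_on \<phi> U"
    and op: "\<And>U \<phi> V \<psi>. (U, \<phi>) \<in> charts X \<Longrightarrow> (V, \<psi>) \<in> charts X \<Longrightarrow> eopen (mdim X) (\<phi> ` (U \<inter> V))"
    and smooth: "\<And>U \<phi> V \<psi>. (U, \<phi>) \<in> charts X \<Longrightarrow> (V, \<psi>) \<in> charts X \<Longrightarrow>
      \<exists>F. smooth_euclidean (mdim X) (mdim X) (\<phi> ` (U \<inter> V)) F \<and> (\<forall>x\<in>U \<inter> V. F (\<phi> x) = \<psi> x)"
  shows "atlas X"
proof -
  have "smooth_euclidean (mdim X) (mdim X) (\<phi> ` (U \<inter> V)) (\<lambda>x. \<psi> (inv_into U \<phi> x))"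
    if UV: "(U, \<phi>) \<in> charts X" "(V, \<psi>) \<in> charts X" for U \<phi> V \<psi>
  proof -
    obtain F where F: "smooth_euclidean (mdim X) (mdim X) (\<phi> ` (U \<inter> V)) F" "\<And>x. x \<in> U \<inter> V \<Longrightarrow> F (\<phi> x) = \<psi> x"
      using smooth[OF UV] by blast
    show ?thesis
      by (rule smooth_euclidean_cong[OF op[OF UV] F(1)]) (use F(2) inj[OF UV(1)] in auto)
  qed
  moreover have "eopen (mdim X) (\<phi> ` U)" if "(U, \<phi>) \<in> charts X" for U \<phi>
    using op[OF that that] by simp
  ultimately show ?thesis unfolding atlas_def using inj op by blast
qed

text \<open>A test at one point in one pair of charts of choice, on a neighbourhood of choice, and
  with an explicit expression in coordinates.\<close>

definition smooth_near :: "'a manifold \<Rightarrow> 'b manifold \<Rightarrow> ('a \<Rightarrow> 'b) \<Rightarrow> 'a \<Rightarrow> bool" where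
  "smooth_near X Y f x \<longleftrightarrow> (\<exists>U \<phi> V \<psi> W F. (U, \<phi>) \<in> charts X \<and> (V, \<psi>) \<in> charts Y \<and>
      x \<in> W \<and> W \<subseteq> U \<and> f ` W \<subseteq> V \<and> eopen (mdim X) (\<phi> ` W) \<and>
      smooth_euclidean (mdim X) (mdim Y) (\<phi> ` W) F \<and> (\<forall>y\<in>W. F (\<phi> y) = \<psi> (f y)))"

lemma smooth_nearI:
  assumes "(U, \<phi>) \<in> charts X" "(V, \<psi>) \<in> charts Y" "x \<in> W" "W \<subseteq> U" "f ` W \<subseteq> V" "eopen (mdim X) (\<phi> ` W)"
    "smooth_euclidean (mdim X) (mdim Y) (\<phi> ` W) F" "\<forall>y\<in>W. F (\<phi> y) = \<psi> (f y)"
  shows "smooth_near X Y f x"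
  using assms unfolding smooth_near_def by (intro exI conjI)

text \<open>\<open>smooth_map\<close> quantifies over all pairs of charts. Near each point the
  expression in an arbitrary pair is the one in the witnessing pair composed with two changes of
  charts; openness and smoothness are local, so these pieces suffice.\<close>

lemma smooth_mapI:
  assumes X: "atlas X" and Y: "atlas Y"
    and loc: "\<And>x. x \<in> points X \<Longrightarrow> smooth_near X Y f x"
  shows "smooth_map X Y f"
proof -
  have "f ` points X \<subseteq> points Y"
  proof (rule image_subsetI)
    fix x assume "x \<in> points X"
    from loc[OF this] show "f x \<in> points Y" unfolding smooth_near_def using in_points by fastforce
  qed
  moreover have "eopen (mdim X) (\<phi>' ` (U' \<inter> f -` V')) \<and>
      smooth_euclidean (mdim X) (mdim Y) (\<phi>' ` (U' \<inter> f -` V')) (\<lambda>x. \<psi>' (f (inv_into U' \<phi>' x)))"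
    if c: "(U', \<phi>') \<in> charts X" "(V', \<psi>') \<in> charts Y" for U' \<phi>' V' \<psi>'
  proof -
    define S where "S = \<phi>' ` (U' \<inter> f -` V')"
    define h where "h = (\<lambda>x. \<psi>' (f (inv_into U' \<phi>' x)))"
    have key: "\<exists>A. eopen (mdim X) A \<and> y0 \<in> A \<and> A \<subseteq> S \<and> smooth_euclidean (mdim X) (mdim Y) A h"
      if y0: "y0 \<in> S" for y0
    proof -
      obtain x0 where x0: "x0 \<in> U'" "f x0 \<in> V'" "y0 = \<phi>' x0" using y0 by (auto simp: S_def)
      obtain U \<phi> V \<psi> W F where l: "(U, \<phi>) \<in> charts X" "(V, \<psi>) \<in> charts Y"
        "x0 \<in> W" "W \<subseteq> U" "f ` W \<subseteq> V" "eopen (mdim X) (\<phi> ` W)"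
        "smooth_euclidean (mdim X) (mdim Y) (\<phi> ` W) F" "\<forall>y\<in>W. F (\<phi> y) = \<psi> (f y)"
        using loc[OF in_points[OF c(1) x0(1)]] unfolding smooth_near_def by (elim exE conjE)
      \<comment> \<open>\<open>T\<close> changes the arbitrary chart of \<open>X\<close> into the
        witnessing one and \<open>R\<close> the witnessing chart of \<open>Y\<close> into the
        arbitrary one, so that \<open>h\<close> is \<open>T\<close> followed by \<open>F\<close> and
        \<open>R\<close>.\<close>
      define T where "T = (\<lambda>x. \<phi> (inv_into U' \<phi>' x))"
      define R where "R = (\<lambda>x. \<psi>' (inv_into V \<psi> x))"
      define A where "A = \<phi>' ` (U' \<inter> U)"
      define B where "B = \<psi> ` (V \<inter> V')"
      \<comment> \<open>The composition makes sense only after two restrictions: to points of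
        \<open>W\<close>, and then to those whose image lies in both charts of \<open>Y\<close>.
        Each is an open preimage.\<close>
      define A1 where "A1 = {y \<in> A. T y \<in> \<phi> ` W}"
      define A2 where "A2 = {y \<in> A1. F (T y) \<in> B}"
      have A: "eopen (mdim X) A" "smooth_euclidean (mdim X) (mdim X) A T"
        using X c(1) l(1) unfolding atlas_def A_def T_def by fast+
      have B: "eopen (mdim Y) B" "smooth_euclidean (mdim Y) (mdim Y) B R"
        using Y c(2) l(2) unfolding atlas_def B_def R_def by fast+
      have T: "T (\<phi>' x) = \<phi> x" if "x \<in> U'" for x
        using atlas_inv[OF X c(1) that] by (simp add: T_def)
      have R: "R (\<psi> y) = \<psi>' y" if "y \<in> V" for y
        using atlas_inv[OF Y l(2) that] by (simp add: R_def)
      have TA: "T ` A \<subseteq> Eucl (mdim X)"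
        using T atlas_mem[OF X l(1)] by (auto simp: A_def)
      have A1: "eopen (mdim X) A1"
        unfolding A1_def by (rule eopen_preimage[OF A TA l(6)])
      have FT: "smooth_euclidean (mdim X) (mdim Y) A1 (\<lambda>y. F (T y))"
        by (rule smooth_euclidean_compose[OF A1 l(6) _ l(7) smooth_euclidean_subset[OF A(2)]])
          (auto simp: A1_def)
      have A1D: "\<exists>x\<in>U' \<inter> W. y = \<phi>' x" if y: "y \<in> A1" for y
      proof -
        obtain x where x: "x \<in> U'" "x \<in> U" "y = \<phi>' x" "T y \<in> \<phi> ` W" using y by (auto simp: A1_def A_def)
        then have "\<phi> x \<in> \<phi> ` W" using T by simp
        then have "x \<in> W" using inj_on_image_mem_iff[OF atlas_inj[OF X l(1)] x(2) l(4)] by simp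
        then show ?thesis using x by blast
      qed
      have FTE: "(\<lambda>y. F (T y)) ` A1 \<subseteq> Eucl (mdim Y)"
      proof (rule image_subsetI)
        fix y assume "y \<in> A1"
        then obtain x where "x \<in> U'" "x \<in> W" "y = \<phi>' x" using A1D by blast
        then show "F (T y) \<in> Eucl (mdim Y)" using T l(5,8) atlas_mem[OF Y l(2), of "f x"] by auto
      qed
      have A2: "eopen (mdim X) A2"
        unfolding A2_def by (rule eopen_preimage[OF A1 FT FTE B(1)])
      have A2D: "\<exists>x\<in>U' \<inter> W \<inter> f -` V'. y = \<phi>' x" if y: "y \<in> A2" for y
      proof -
        obtain x where x: "x \<in> U'" "x \<in> W" "y = \<phi>' x" "F (T y) \<in> B" using A1D y by (auto simp: A2_def)
        have "f x \<in> V" using l(5) x by auto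
        moreover have "\<psi> (f x) \<in> \<psi> ` (V \<inter> V')" using x T l(8) by (simp add: B_def)
        ultimately have "f x \<in> V'"
          using inj_on_image_mem_iff[OF atlas_inj[OF Y l(2)], of "f x" "V \<inter> V'"] by simp
        then show ?thesis using x by blast
      qed
      have "smooth_euclidean (mdim X) (mdim Y) A2 (\<lambda>y. R (F (T y)))"
        by (rule smooth_euclidean_compose[OF A2 B(1) _ B(2) smooth_euclidean_subset[OF FT]])
          (auto simp: A2_def)
      moreover have "R (F (T y)) = h y" if y: "y \<in> A2" for y
      proof -
        obtain x where x: "x \<in> U'" "x \<in> W" "f x \<in> V'" "y = \<phi>' x" using A2D[OF y] by auto
        then show ?thesis using T l(5,8) R[of "f x"] atlas_inv[OF X c(1)] by (auto simp: h_def)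
      qed
      ultimately have "smooth_euclidean (mdim X) (mdim Y) A2 h"
        by (rule smooth_euclidean_cong[OF A2])
      moreover have "A2 \<subseteq> S" using A2D unfolding S_def by blast
      moreover have "y0 \<in> A2"
      proof -
        have "y0 \<in> A" using x0 l(3,4) by (auto simp: A_def)
        moreover have "T y0 = \<phi> x0" using T x0 by simp
        moreover have "F (\<phi> x0) = \<psi> (f x0)" using l(3,8) by blast
        moreover have "f x0 \<in> V" using l(3,5) by auto
        ultimately show ?thesis using l(3) x0(2) by (auto simp: A2_def A1_def B_def)
      qed
      ultimately show ?thesis using A2 by blast
    qed
    have S: "eopen (mdim X) S" by (rule eopen_subopen) (use key in blast)
    moreover have "smooth_euclidean (mdim X) (mdim Y) S h"
      unfolding smooth_euclidean_iff
    proof (intro allI impI smooth_on_local[OF S])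
      fix j x assume j: "j < mdim Y" and x: "x \<in> S"
      from key[OF x] show "\<exists>W. eopen (mdim X) W \<and> x \<in> W \<and> W \<subseteq> S \<and> smooth_on (mdim X) W (\<lambda>x. h x j)"
        using j unfolding smooth_euclidean_iff by (elim exE conjE, intro exI conjI) auto
    qed
    ultimately show ?thesis by (simp add: S_def h_def)
  qed
  ultimately show ?thesis unfolding smooth_map_def by blast
qed

lemma smooth_map_points: "smooth_map X Y f \<Longrightarrow> x \<in> points X \<Longrightarrow> f x \<in> points Y"
  by (auto simp: smooth_map_def)

lemma smooth_mapE:
  assumes "smooth_map X Y f" "atlas X" "(U, \<phi>) \<in> charts X" "(V, \<psi>) \<in> charts Y"
  obtains F where "eopen (mdim X) (\<phi> ` (U \<inter> f -` V))"
    "smooth_euclidean (mdim X) (mdim Y) (\<phi> ` (U \<inter> f -` V)) F"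
    "\<And>x. x \<in> U \<Longrightarrow> f x \<in> V \<Longrightarrow> F (\<phi> x) = \<psi> (f x)"
proof (rule that)
  show "eopen (mdim X) (\<phi> ` (U \<inter> f -` V))"
    "smooth_euclidean (mdim X) (mdim Y) (\<phi> ` (U \<inter> f -` V)) (\<lambda>x. \<psi> (f (inv_into U \<phi> x)))"
    using assms(1,3,4) unfolding smooth_map_def by fast+
qed (use atlas_inv[OF assms(2,3)] in simp)

lemma smooth_map_id: "atlas X \<Longrightarrow> smooth_map X X (\<lambda>x. x)"
  unfolding smooth_map_def atlas_def vimage_ident by auto

lemma atlas_changeE:
  assumes "atlas X" "(U, \<phi>) \<in> charts X" "(V, \<psi>) \<in> charts X"
  obtains F where "eopen (mdim X) (\<phi> ` (U \<inter> V))" "smooth_euclidean (mdim X) (mdim X) (\<phi> ` (U \<inter> V)) F"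
    "\<And>x. x \<in> U \<Longrightarrow> x \<in> V \<Longrightarrow> F (\<phi> x) = \<psi> x"
  by (rule smooth_mapE[OF smooth_map_id[OF assms(1)] assms]) (simp add: vimage_ident that)

lemma smooth_map_cong:
  assumes "smooth_map X Y f" "atlas X" "atlas Y" "\<And>x. x \<in> points X \<Longrightarrow> f x = g x"
  shows "smooth_map X Y g"
proof (rule smooth_mapI[OF assms(2,3)])
  fix x assume x: "x \<in> points X"
  obtain U \<phi> where U: "(U, \<phi>) \<in> charts X" "x \<in> U" using points_cover[OF x] .
  obtain V \<psi> where V: "(V, \<psi>) \<in> charts Y" "f x \<in> V" using points_cover[OF smooth_map_points[OF assms(1) x]] .
  obtain F where F: "eopen (mdim X) (\<phi> ` (U \<inter> f -` V))"
    "smooth_euclidean (mdim X) (mdim Y) (\<phi> ` (U \<inter> f -` V)) F"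
    "\<And>x. x \<in> U \<Longrightarrow> f x \<in> V \<Longrightarrow> F (\<phi> x) = \<psi> (f x)"
    using smooth_mapE[OF assms(1,2) U(1) V(1)] by blast
  have g: "g y = f y" if "y \<in> U" for y using assms(4)[OF in_points[OF U(1) that]] by simp
  show "smooth_near X Y g x"
    by (rule smooth_nearI[of U \<phi> _ V \<psi> _ _ "U \<inter> f -` V" _ F]) (use U V F g in auto)
qed

lemma smooth_map_comp:
  assumes f: "smooth_map X Y f" and g: "smooth_map Y Z g" and at: "atlas X" "atlas Y" "atlas Z"
  shows "smooth_map X Z (\<lambda>x. g (f x))"
proof (rule smooth_mapI[OF at(1,3)])
  fix x assume x: "x \<in> points X"
  obtain U \<phi> where U: "(U, \<phi>) \<in> charts X" "x \<in> U" using points_cover[OF x] .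
  note fx = smooth_map_points[OF f x]
  obtain V \<psi> where V: "(V, \<psi>) \<in> charts Y" "f x \<in> V" using points_cover[OF fx] .
  obtain W \<xi> where W: "(W, \<xi>) \<in> charts Z" "g (f x) \<in> W" using points_cover[OF smooth_map_points[OF g fx]] .
  obtain F where F: "eopen (mdim X) (\<phi> ` (U \<inter> f -` V))"
    "smooth_euclidean (mdim X) (mdim Y) (\<phi> ` (U \<inter> f -` V)) F"
    "\<And>x. x \<in> U \<Longrightarrow> f x \<in> V \<Longrightarrow> F (\<phi> x) = \<psi> (f x)"
    using smooth_mapE[OF f at(1) U(1) V(1)] by blast
  obtain G where G: "eopen (mdim Y) (\<psi> ` (V \<inter> g -` W))"
    "smooth_euclidean (mdim Y) (mdim Z) (\<psi> ` (V \<inter> g -` W)) G"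
    "\<And>x. x \<in> V \<Longrightarrow> g x \<in> W \<Longrightarrow> G (\<psi> x) = \<xi> (g x)"
    using smooth_mapE[OF g at(2) V(1) W(1)] by blast
  \<comment> \<open>The points at which both local expressions apply; in coordinates an open
    preimage under \<open>F\<close>.\<close>
  define S where "S = {y \<in> U \<inter> f -` V. g (f y) \<in> W}"
  have S: "\<phi> ` S = {y \<in> \<phi> ` (U \<inter> f -` V). F y \<in> \<psi> ` (V \<inter> g -` W)}"
  proof -
    have "F (\<phi> y) \<in> \<psi> ` (V \<inter> g -` W) \<longleftrightarrow> g (f y) \<in> W" if "y \<in> U" "f y \<in> V" for y
      using inj_on_image_mem_iff[OF atlas_inj[OF at(2) V(1)], of "f y" "V \<inter> g -` W"] F(3) that by simp
    then show ?thesis by (auto simp: S_def)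
  qed
  have oS: "eopen (mdim X) (\<phi> ` S)"
    unfolding S by (rule eopen_preimage[OF F(1,2) _ G(1)]) (use F(3) atlas_mem[OF at(2) V(1)] in auto)
  have "smooth_euclidean (mdim X) (mdim Z) (\<phi> ` S) (\<lambda>y. G (F y))"
    by (rule smooth_euclidean_compose[OF oS G(1) _ G(2) smooth_euclidean_subset[OF F(2)]]) (use S in auto)
  then show "smooth_near X Z (\<lambda>x. g (f x)) x"
    by (intro smooth_nearI[of U \<phi> _ W \<xi> _ _ S _ "\<lambda>y. G (F y)"])
      (use U V W F(3) G(3) oS in \<open>auto simp: S_def\<close>)
qed

subsection \<open>Products\<close>

text \<open>The way \<open>product_manifold\<close> joins coordinates, named so that
  \<open>trunc\<close> and \<open>shift\<close> can undo it.\<close>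

definition append_at :: "nat \<Rightarrow> (nat \<Rightarrow> real) \<Rightarrow> (nat \<Rightarrow> real) \<Rightarrow> nat \<Rightarrow> real" where
  "append_at a u v = (\<lambda>i. if i < a then u i else v (i - a))"

definition shift :: "nat \<Rightarrow> (nat \<Rightarrow> real) \<Rightarrow> nat \<Rightarrow> real" where
  "shift a x = (\<lambda>i. x (i + a))"

lemma trunc_append [simp]: "u \<in> Eucl a \<Longrightarrow> trunc a (append_at a u v) = u"
  by (auto simp: trunc_def append_at_def fun_eq_iff mem_Eucl)

lemma shift_append [simp]: "shift a (append_at a u v) = v"
  by (auto simp: shift_def append_at_def)

lemma append_trunc_shift [simp]: "append_at a (trunc a x) (shift a x) = x"
  by (auto simp: shift_def append_at_def trunc_def fun_eq_iff)

lemma append_at_mem [simp]: "v \<in> Eucl b \<Longrightarrow> append_at a u v \<in> Eucl (a + b)"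
  by (auto simp: append_at_def mem_Eucl)

lemma shift_mem [simp]: "x \<in> Eucl (a + b) \<Longrightarrow> shift a x \<in> Eucl b"
  by (auto simp: shift_def mem_Eucl)

lemma smooth_euclidean_shift [simp]: "smooth_euclidean N e U (shift a)"
  by (simp add: smooth_euclidean_iff shift_def)

lemma append_image:
  assumes "A \<subseteq> Eucl a"  "B \<subseteq> Eucl b"
  shows "{append_at a u v | u v. u \<in> A \<and> v \<in> B} = {z \<in> Eucl (a + b). trunc a z \<in> A \<and> shift a z \<in> B}"
    (is "?L = ?R")
proof
  show "?L \<subseteq> ?R" using assms by (auto simp: subset_iff)
  show "?R \<subseteq> ?L"
  proof
    fix z assume "z \<in> ?R"
    then show "z \<in> ?L" by (intro CollectI exI[of _ "trunc a z"] exI[of _ "shift a z"]) auto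
  qed
qed

lemma eopen_append:
  assumes "eopen a A" "eopen b B"
  shows "eopen (a + b) {z \<in> Eucl (a + b). trunc a z \<in> A \<and> shift a z \<in> B}"
proof -
  have "eopen (a + b) {z \<in> Eucl (a + b). trunc a z \<in> A}" by (rule eopen_trunc[OF assms(1)])
  moreover have "eopen (a + b) {z \<in> Eucl (a + b). shift a z \<in> B}"
    by (rule eopen_preimage[OF eopen_Eucl smooth_euclidean_shift _ assms(2)]) auto
  ultimately have "eopen (a + b) ({z \<in> Eucl (a + b). trunc a z \<in> A} \<inter> {z \<in> Eucl (a + b). shift a z \<in> B})"
    by (rule openin_Int)
  moreover have "{z \<in> Eucl (a + b). trunc a z \<in> A} \<inter> {z \<in> Eucl (a + b). shift a z \<in> B}
      = {z \<in> Eucl (a + b). trunc a z \<in> A \<and> shift a z \<in> B}" by auto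
  ultimately show ?thesis by simp
qed

lemma smooth_euclidean_append:
  assumes "smooth_euclidean N a U f" "smooth_euclidean N b U g"
  shows "smooth_euclidean N (a + b) U (\<lambda>x. append_at a (f x) (g x))"
  unfolding smooth_euclidean_iff
proof (intro allI impI)
  fix j assume "j < a + b"
  then show "smooth_on N U (\<lambda>x. append_at a (f x) (g x) j)"
    using assms by (cases "j < a") (auto simp: smooth_euclidean_iff append_at_def)
qed

lemma mdim_product [simp]: "mdim (product_manifold X Y) = mdim X + mdim Y"
  by (simp add: product_manifold_def)

lemma charts_product:
  "charts (product_manifold X Y) =
    {(U \<times> V, \<lambda>(x, y). append_at (mdim X) (\<phi> x) (\<psi> y)) | U \<phi> V \<psi>. (U, \<phi>) \<in> charts X \<and> (V, \<psi>) \<in> charts Y}"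
  by (simp add: product_manifold_def append_at_def)

lemma charts_productI:
  "(U, \<phi>) \<in> charts X \<Longrightarrow> (V, \<psi>) \<in> charts Y \<Longrightarrow>
    (U \<times> V, \<lambda>(x, y). append_at (mdim X) (\<phi> x) (\<psi> y)) \<in> charts (product_manifold X Y)"
  unfolding charts_product by blast

lemma points_product [simp]: "points (product_manifold X Y) = points X \<times> points Y"
proof
  show "points (product_manifold X Y) \<subseteq> points X \<times> points Y"
    unfolding points_def charts_product by auto
  show "points X \<times> points Y \<subseteq> points (product_manifold X Y)"
  proof
    fix z assume "z \<in> points X \<times> points Y"
    then obtain U \<phi> V \<psi> where "(U, \<phi>) \<in> charts X" "fst z \<in> U" "(V, \<psi>) \<in> charts Y" "snd z \<in> V"
      by (metis mem_Times_iff points_cover)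
    then show "z \<in> points (product_manifold X Y)"
      using in_points[OF charts_productI, of U \<phi> X V \<psi> Y z] by (simp add: mem_Times_iff)
  qed
qed

lemma product_chart_image:
  assumes "\<phi> ` A \<subseteq> Eucl a" "\<psi> ` B \<subseteq> Eucl b"
  shows "(\<lambda>(x, y). append_at a (\<phi> x) (\<psi> y)) ` (A \<times> B) =
    {z \<in> Eucl (a + b). trunc a z \<in> \<phi> ` A \<and> shift a z \<in> \<psi> ` B}"
  unfolding append_image[OF assms, symmetric] by auto

lemma atlas_product:
  assumes X: "atlas X" and Y: "atlas Y"
  shows "atlas (product_manifold X Y)"
proof (rule atlasI)
  let ?a = "mdim X" and ?b = "mdim Y"
  fix U \<phi> assume "(U, \<phi>) \<in> charts (product_manifold X Y)"
  then obtain U1 \<phi>1 U2 \<phi>2 where U: "(U1, \<phi>1) \<in> charts X" "(U2, \<phi>2) \<in> charts Y" "U = U1 \<times> U2"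
    and \<phi>: "\<phi> = (\<lambda>(x, y). append_at ?a (\<phi>1 x) (\<phi>2 y))" unfolding charts_product by blast
  note m1 = atlas_mem[OF X U(1)] and m2 = atlas_mem[OF Y U(2)]
  show "inj_on \<phi> U"
  proof (rule inj_onI, clarsimp simp: U \<phi>)
    fix x y x' y' assume *: "x \<in> U1" "y \<in> U2" "x' \<in> U1" "y' \<in> U2"
      "append_at ?a (\<phi>1 x) (\<phi>2 y) = append_at ?a (\<phi>1 x') (\<phi>2 y')"
    have "\<phi>1 x = \<phi>1 x'" using arg_cong[OF *(5), of "trunc ?a"] m1 *(1-4) by simp
    moreover have "\<phi>2 y = \<phi>2 y'" using arg_cong[OF *(5), of "shift ?a"] by (simp only: shift_append)
    ultimately show "x = x' \<and> y = y'"
      using inj_onD[OF atlas_inj[OF X U(1)]] inj_onD[OF atlas_inj[OF Y U(2)]] * by blast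
  qed
  fix V \<psi> assume "(V, \<psi>) \<in> charts (product_manifold X Y)"
  then obtain V1 \<psi>1 V2 \<psi>2 where V: "(V1, \<psi>1) \<in> charts X" "(V2, \<psi>2) \<in> charts Y" "V = V1 \<times> V2"
    and \<psi>: "\<psi> = (\<lambda>(x, y). append_at ?a (\<psi>1 x) (\<psi>2 y))" unfolding charts_product by blast
  obtain F1 where F1: "eopen ?a (\<phi>1 ` (U1 \<inter> V1))" "smooth_euclidean ?a ?a (\<phi>1 ` (U1 \<inter> V1)) F1"
    "\<And>x. x \<in> U1 \<Longrightarrow> x \<in> V1 \<Longrightarrow> F1 (\<phi>1 x) = \<psi>1 x" using atlas_changeE[OF X U(1) V(1)] by blast
  obtain F2 where F2: "eopen ?b (\<phi>2 ` (U2 \<inter> V2))" "smooth_euclidean ?b ?b (\<phi>2 ` (U2 \<inter> V2)) F2"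
    "\<And>x. x \<in> U2 \<Longrightarrow> x \<in> V2 \<Longrightarrow> F2 (\<phi>2 x) = \<psi>2 x" using atlas_changeE[OF Y U(2) V(2)] by blast
  have im: "\<phi> ` (U \<inter> V) = {z \<in> Eucl (?a + ?b). trunc ?a z \<in> \<phi>1 ` (U1 \<inter> V1) \<and> shift ?a z \<in> \<phi>2 ` (U2 \<inter> V2)}"
    unfolding U(3) V(3) \<phi> Times_Int_Times using m1 m2 by (intro product_chart_image) auto
  have op: "eopen (?a + ?b) (\<phi> ` (U \<inter> V))" unfolding im by (rule eopen_append[OF F1(1) F2(1)])
  then show "eopen (mdim (product_manifold X Y)) (\<phi> ` (U \<inter> V))" by simp
  have "smooth_euclidean (?a + ?b) (?a + ?b) (\<phi> ` (U \<inter> V)) (\<lambda>z. append_at ?a (F1 (trunc ?a z)) (F2 (shift ?a z)))"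
  proof (rule smooth_euclidean_append)
    show "smooth_euclidean (?a + ?b) ?a (\<phi> ` (U \<inter> V)) (\<lambda>x. F1 (trunc ?a x))"
      by (rule smooth_euclidean_compose[OF op F1(1) _ F1(2) smooth_euclidean_trunc]) (auto simp: im)
    show "smooth_euclidean (?a + ?b) ?b (\<phi> ` (U \<inter> V)) (\<lambda>x. F2 (shift ?a x))"
      by (rule smooth_euclidean_compose[OF op F2(1) _ F2(2) smooth_euclidean_shift]) (auto simp: im)
  qed
  moreover have "append_at ?a (F1 (trunc ?a (\<phi> z))) (F2 (shift ?a (\<phi> z))) = \<psi> z" if "z \<in> U \<inter> V" for z
    using that m1 F1(3) F2(3) by (auto simp: U(3) V(3) \<phi> \<psi>)
  ultimately show "\<exists>F. smooth_euclidean (mdim (product_manifold X Y)) (mdim (product_manifold X Y)) (\<phi> ` (U \<inter> V)) F \<and>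
      (\<forall>x\<in>U \<inter> V. F (\<phi> x) = \<psi> x)" by auto
qed

lemma smooth_map_Pair:
  assumes f: "smooth_map X Y f" and g: "smooth_map X Z g" and at: "atlas X" "atlas Y" "atlas Z"
  shows "smooth_map X (product_manifold Y Z) (\<lambda>x. (f x, g x))"
proof (rule smooth_mapI[OF at(1) atlas_product[OF at(2,3)]])
  fix x assume x: "x \<in> points X"
  obtain U \<phi> where U: "(U, \<phi>) \<in> charts X" "x \<in> U" using points_cover[OF x] .
  obtain V \<psi> where V: "(V, \<psi>) \<in> charts Y" "f x \<in> V" using points_cover[OF smooth_map_points[OF f x]] .
  obtain W \<xi> where W: "(W, \<xi>) \<in> charts Z" "g x \<in> W" using points_cover[OF smooth_map_points[OF g x]] .
  obtain F where F: "eopen (mdim X) (\<phi> ` (U \<inter> f -` V))"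
    "smooth_euclidean (mdim X) (mdim Y) (\<phi> ` (U \<inter> f -` V)) F"
    "\<And>x. x \<in> U \<Longrightarrow> f x \<in> V \<Longrightarrow> F (\<phi> x) = \<psi> (f x)"
    using smooth_mapE[OF f at(1) U(1) V(1)] by blast
  obtain G where G: "eopen (mdim X) (\<phi> ` (U \<inter> g -` W))"
    "smooth_euclidean (mdim X) (mdim Z) (\<phi> ` (U \<inter> g -` W)) G"
    "\<And>x. x \<in> U \<Longrightarrow> g x \<in> W \<Longrightarrow> G (\<phi> x) = \<xi> (g x)"
    using smooth_mapE[OF g at(1) U(1) W(1)] by blast
  define S where "S = (U \<inter> f -` V) \<inter> (U \<inter> g -` W)"
  have S: "\<phi> ` S = \<phi> ` (U \<inter> f -` V) \<inter> \<phi> ` (U \<inter> g -` W)"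
    unfolding S_def by (rule inj_on_image_Int[OF atlas_inj[OF at(1) U(1)]]) auto
  have oS: "eopen (mdim X) (\<phi> ` S)" unfolding S using F(1) G(1) by (rule openin_Int)
  have "smooth_euclidean (mdim X) (mdim Y + mdim Z) (\<phi> ` S) (\<lambda>y. append_at (mdim Y) (F y) (G y))"
    by (rule smooth_euclidean_append; rule smooth_euclidean_subset[OF F(2)] smooth_euclidean_subset[OF G(2)])
      (auto simp: S)
  then show "smooth_near X (product_manifold Y Z) (\<lambda>x. (f x, g x)) x"
    by (intro smooth_nearI[of U \<phi> _ "V \<times> W" "\<lambda>(x, y). append_at (mdim Y) (\<psi> x) (\<xi> y)" _ _ S _ "\<lambda>y. append_at (mdim Y) (F y) (G y)"])
      (use U V W F(3) G(3) oS charts_productI[OF V(1) W(1)] in \<open>auto simp: S_def\<close>)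
qed

lemma smooth_map_fst:
  assumes X: "atlas X" and Y: "atlas Y"
  shows "smooth_map (product_manifold X Y) X fst"
proof (rule smooth_mapI[OF atlas_product[OF assms] X])
  fix z assume "z \<in> points (product_manifold X Y)"
  then obtain U \<phi> V \<psi> where U: "(U, \<phi>) \<in> charts X" "fst z \<in> U" and V: "(V, \<psi>) \<in> charts Y" "snd z \<in> V"
    by (metis mem_Times_iff points_cover points_product)
  note c = charts_productI[OF U(1) V(1)]
  show "smooth_near (product_manifold X Y) X fst z"
    by (rule smooth_nearI[OF c U(1) _ order_refl _ atlas_open[OF atlas_product[OF assms] c] smooth_euclidean_trunc])
      (use U V atlas_mem[OF X U(1)] in \<open>auto simp: mem_Times_iff\<close>)
qed

lemma smooth_map_snd:
  assumes X: "atlas X" and Y: "atlas Y"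
  shows "smooth_map (product_manifold X Y) Y snd"
proof (rule smooth_mapI[OF atlas_product[OF assms] Y])
  fix z assume "z \<in> points (product_manifold X Y)"
  then obtain U \<phi> V \<psi> where U: "(U, \<phi>) \<in> charts X" "fst z \<in> U" and V: "(V, \<psi>) \<in> charts Y" "snd z \<in> V"
    by (metis mem_Times_iff points_cover points_product)
  note c = charts_productI[OF U(1) V(1)]
  show "smooth_near (product_manifold X Y) Y snd z"
    by (rule smooth_nearI[OF c V(1) _ order_refl _ atlas_open[OF atlas_product[OF assms] c] smooth_euclidean_shift[where a = "mdim X"]])
      (use U V in \<open>auto simp: mem_Times_iff\<close>)
qed

lemma smooth_map_const:
  assumes "atlas X" "atlas Y" "c \<in> points Y"
  shows "smooth_map X Y (\<lambda>x. c)"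
proof (rule smooth_mapI[OF assms(1,2)])
  fix x assume "x \<in> points X"
  then obtain U \<phi> where U: "(U, \<phi>) \<in> charts X" "x \<in> U" using points_cover by metis
  obtain V \<psi> where V: "(V, \<psi>) \<in> charts Y" "c \<in> V" using points_cover[OF assms(3)] .
  show "smooth_near X Y (\<lambda>x. c) x"
    by (rule smooth_nearI[of U \<phi> _ V \<psi> _ _ U _ "\<lambda>x. \<psi> c"])
      (use U V atlas_open[OF assms(1) U(1)] in \<open>auto simp: smooth_euclidean_iff\<close>)
qed

subsection \<open>Euclidean spaces as manifolds and global charts\<close>

text \<open>The model for all complements. Its single chart is the identity, so maps into and out of
  it are written directly in coordinates.\<close>

definition eucl :: "nat \<Rightarrow> (nat \<Rightarrow> real) manifold" where
  "eucl N = \<lparr>mdim = N, charts = {(Eucl N, \<lambda>x. x)}\<rparr>"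

lemma eucl_simps [simp]: "mdim (eucl N) = N" "charts (eucl N) = {(Eucl N, \<lambda>x. x)}" "points (eucl N) = Eucl N"
  by (auto simp: eucl_def points_def)

lemma atlas_eucl [simp]: "atlas (eucl N)"
  by (rule atlasI) (auto simp: smooth_euclidean_iff intro!: exI[of _ "\<lambda>x. x"])

lemma smooth_map_eucl:
  assumes "f ` Eucl a \<subseteq> Eucl b" "smooth_euclidean a b (Eucl a) f"
  shows "smooth_map (eucl a) (eucl b) f"
proof (rule smooth_mapI[OF atlas_eucl atlas_eucl])
  fix x assume "x \<in> points (eucl a)"
  then show "smooth_near (eucl a) (eucl b) f x"
    using assms by (intro smooth_nearI[of "Eucl a" "\<lambda>x. x" _ "Eucl b" "\<lambda>x. x" _ _ "Eucl a" _ f]) auto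
qed

lemma smooth_map_append: "smooth_map (product_manifold (eucl a) (eucl b)) (eucl (a + b)) (\<lambda>(x, y). append_at a x y)"
proof (rule smooth_mapI[OF atlas_product])
  fix z assume z: "z \<in> points (product_manifold (eucl a) (eucl b))"
  let ?c = "\<lambda>(x, y). append_at a x y"
  have c: "(Eucl a \<times> Eucl b, ?c) \<in> charts (product_manifold (eucl a) (eucl b))"
    using charts_productI[of "Eucl a" "\<lambda>x. x" "eucl a" "Eucl b" "\<lambda>x. x" "eucl b"] by simp
  have op: "eopen (a + b) (?c ` (Eucl a \<times> Eucl b))"
    using atlas_open[OF atlas_product[OF atlas_eucl atlas_eucl] c] by simp
  show "smooth_near (product_manifold (eucl a) (eucl b)) (eucl (a + b)) ?c z"
    by (rule smooth_nearI[of "Eucl a \<times> Eucl b" ?c _ "Eucl (a + b)" "\<lambda>x. x" _ _ "Eucl a \<times> Eucl b" _ "\<lambda>x. x"])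
      (use c op z in \<open>auto simp: smooth_euclidean_iff\<close>)
qed auto

lemma smooth_map_chart:
  assumes f: "smooth_map X Y f" and at: "atlas X" "atlas Y" and V: "(V, \<psi>) \<in> charts Y" "f ` points X \<subseteq> V"
  shows "smooth_map X (eucl (mdim Y)) (\<lambda>x. \<psi> (f x))"
proof (rule smooth_mapI[OF at(1) atlas_eucl])
  fix x assume x: "x \<in> points X"
  obtain U \<phi> where U: "(U, \<phi>) \<in> charts X" "x \<in> U" using points_cover[OF x] .
  obtain F where F: "eopen (mdim X) (\<phi> ` (U \<inter> f -` V))"
    "smooth_euclidean (mdim X) (mdim Y) (\<phi> ` (U \<inter> f -` V)) F"
    "\<And>x. x \<in> U \<Longrightarrow> f x \<in> V \<Longrightarrow> F (\<phi> x) = \<psi> (f x)"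
    using smooth_mapE[OF f at(1) U(1) V(1)] by blast
  show "smooth_near X (eucl (mdim Y)) (\<lambda>x. \<psi> (f x)) x"
    by (rule smooth_nearI[of U \<phi> _ "Eucl (mdim Y)" "\<lambda>x. x" _ _ "U \<inter> f -` V" _ F])
      (use U V F x atlas_mem[OF at(2) V(1)] in auto)
qed

text \<open>In the chart \<open>\<psi>\<close> the map is \<open>g\<close> itself.\<close>

lemma smooth_map_inv_chart:
  assumes g: "smooth_map X (eucl (mdim Y)) g" and at: "atlas X" "atlas Y"
    and V: "(V, \<psi>) \<in> charts Y" "g ` points X \<subseteq> \<psi> ` V"
  shows "smooth_map X Y (\<lambda>x. inv_into V \<psi> (g x))"
proof (rule smooth_mapI[OF at])
  fix x assume x: "x \<in> points X"
  obtain U \<phi> where U: "(U, \<phi>) \<in> charts X" "x \<in> U" using points_cover[OF x] .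
  have c: "(Eucl (mdim Y), \<lambda>x. x) \<in> charts (eucl (mdim Y))" by simp
  obtain F where F: "eopen (mdim X) (\<phi> ` (U \<inter> g -` Eucl (mdim Y)))"
    "smooth_euclidean (mdim X) (mdim (eucl (mdim Y))) (\<phi> ` (U \<inter> g -` Eucl (mdim Y))) F"
    "\<And>x. x \<in> U \<Longrightarrow> g x \<in> Eucl (mdim Y) \<Longrightarrow> F (\<phi> x) = g x"
    using smooth_mapE[OF g at(1) U(1) c] by blast
  have gU: "g y \<in> \<psi> ` V" if "y \<in> U" for y using in_points[OF U(1) that] V(2) by auto
  have "\<psi> ` V \<subseteq> Eucl (mdim Y)" using atlas_mem[OF at(2) V(1)] by auto
  then have eq: "U \<inter> g -` Eucl (mdim Y) = U" using gU by blast
  have Fg: "F (\<phi> y) = g y" if "y \<in> U" for y using F(3)[OF that] eq that by blast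
  show "smooth_near X Y (\<lambda>x. inv_into V \<psi> (g x)) x"
    by (rule smooth_nearI[of U \<phi> _ V \<psi> _ _ U _ F])
      (use U V F(1,2) Fg gU eq in \<open>auto simp: f_inv_into_f inv_into_into\<close>)
qed

subsection \<open>The topology of a manifold\<close>

text \<open>\<open>manifold_topology\<close> is built with the constructor \<open>topology\<close>,
  so its predicate has to be shown to satisfy the axioms. Intersections require that charts are
  injective.\<close>

lemma openin_manifold:
  assumes X: "atlas X"
  shows "openin (manifold_topology X) W \<longleftrightarrow>
    W \<subseteq> points X \<and> (\<forall>(U, \<phi>)\<in>charts X. eopen (mdim X) (\<phi> ` (W \<inter> U)))"
proof -
  define L where "L = (\<lambda>W. W \<subseteq> points X \<and> (\<forall>(U, \<phi>)\<in>charts X. eopen (mdim X) (\<phi> ` (W \<inter> U))))"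
  have "istopology L"
    unfolding istopology_def
  proof (intro conjI allI impI)
    fix S T assume S: "L S" and T: "L T"
    have "eopen (mdim X) (\<phi> ` (S \<inter> T \<inter> U))" if c: "(U, \<phi>) \<in> charts X" for U \<phi>
    proof -
      have "\<phi> ` (S \<inter> T \<inter> U) = \<phi> ` ((S \<inter> U) \<inter> (T \<inter> U))" by (rule arg_cong[of _ _ "(`) \<phi>"]) auto
      also have "\<dots> = \<phi> ` (S \<inter> U) \<inter> \<phi> ` (T \<inter> U)"
        by (rule inj_on_image_Int[OF atlas_inj[OF X c]]) auto
      finally show ?thesis using S T c unfolding L_def by (auto intro!: openin_Int)
    qed
    then show "L (S \<inter> T)" using S unfolding L_def by blast
  next
    fix K assume K: "\<forall>S\<in>K. L S"
    have "eopen (mdim X) (\<phi> ` (\<Union>K \<inter> U))" if c: "(U, \<phi>) \<in> charts X" for U \<phi>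
    proof -
      have "\<phi> ` (\<Union>K \<inter> U) = (\<Union>S\<in>K. \<phi> ` (S \<inter> U))" by auto
      then show ?thesis using K c unfolding L_def by (auto intro!: openin_Union)
    qed
    then show "L (\<Union>K)" using K unfolding L_def by blast
  qed
  then have "openin (topology L) = L" by (rule topology_inverse')
  then show ?thesis unfolding manifold_topology_def L_def[symmetric] by (simp add: L_def)
qed

lemma topspace_manifold: "atlas X \<Longrightarrow> topspace (manifold_topology X) = points X"
proof -
  assume X: "atlas X"
  have "eopen (mdim X) (\<phi> ` (points X \<inter> U))" if "(U, \<phi>) \<in> charts X" for U \<phi>
  proof -
    have "points X \<inter> U = U" using in_points[OF that] by auto
    then show ?thesis using atlas_open[OF X that] by simp
  qed
  then have "openin (manifold_topology X) (points X)" unfolding openin_manifold[OF X] by auto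
  then show ?thesis using openin_manifold[OF X] by (metis openin_subset openin_topspace subset_antisym)
qed

text \<open>The topology tests a set in every chart; by the smooth change of charts the test in one
  chart containing the set is enough.\<close>

lemma openin_in_chart:
  assumes X: "atlas X" and U: "(U, \<phi>) \<in> charts X" and W: "W \<subseteq> U" "eopen (mdim X) (\<phi> ` W)"
  shows "openin (manifold_topology X) W"
  unfolding openin_manifold[OF X]
proof (intro conjI ballI, safe)
  fix x assume "x \<in> W" then show "x \<in> points X" using W in_points[OF U] by auto
next
  fix V \<psi> assume V: "(V, \<psi>) \<in> charts X"
  obtain F where F: "eopen (mdim X) (\<psi> ` (V \<inter> U))" "smooth_euclidean (mdim X) (mdim X) (\<psi> ` (V \<inter> U)) F"
    "\<And>x. x \<in> V \<Longrightarrow> x \<in> U \<Longrightarrow> F (\<psi> x) = \<phi> x" using atlas_changeE[OF X V U] by blast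
  have "F (\<psi> x) \<in> \<phi> ` W \<longleftrightarrow> x \<in> W" if "x \<in> V" "x \<in> U" for x
    using F(3)[OF that] inj_on_image_mem_iff[OF atlas_inj[OF X U] that(2) W(1)] by simp
  then have "\<psi> ` (W \<inter> V) = {y \<in> \<psi> ` (V \<inter> U). F y \<in> \<phi> ` W}" using W(1) by auto
  moreover have "eopen (mdim X) {y \<in> \<psi> ` (V \<inter> U). F y \<in> \<phi> ` W}"
    by (rule eopen_preimage[OF F(1,2) _ W(2)]) (use F(3) atlas_mem[OF X U] in auto)
  ultimately show "eopen (mdim X) (\<psi> ` (W \<inter> V))" by simp
qed

lemma openin_smooth_vimage:
  assumes f: "smooth_map X Y f" and X: "atlas X" and Y: "atlas Y" and W: "openin (manifold_topology Y) W"
  shows "openin (manifold_topology X) {x \<in> points X. f x \<in> W}"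
proof (subst openin_subopen, intro ballI)
  fix x assume "x \<in> {x \<in> points X. f x \<in> W}"
  then have x: "x \<in> points X" "f x \<in> W" by auto
  obtain U \<phi> where U: "(U, \<phi>) \<in> charts X" "x \<in> U" using points_cover[OF x(1)] .
  obtain V \<psi> where V: "(V, \<psi>) \<in> charts Y" "f x \<in> V" using points_cover[OF smooth_map_points[OF f x(1)]] .
  obtain F where F: "eopen (mdim X) (\<phi> ` (U \<inter> f -` V))"
    "smooth_euclidean (mdim X) (mdim Y) (\<phi> ` (U \<inter> f -` V)) F"
    "\<And>x. x \<in> U \<Longrightarrow> f x \<in> V \<Longrightarrow> F (\<phi> x) = \<psi> (f x)"
    using smooth_mapE[OF f X U(1) V(1)] by blast
  define S where "S = {y \<in> U \<inter> f -` V. f y \<in> W}"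
  have "F (\<phi> y) \<in> \<psi> ` (W \<inter> V) \<longleftrightarrow> f y \<in> W" if "y \<in> U" "f y \<in> V" for y
    using F(3)[OF that] inj_on_image_mem_iff[OF atlas_inj[OF Y V(1)] that(2), of "W \<inter> V"] that by simp
  then have "\<phi> ` S = {y \<in> \<phi> ` (U \<inter> f -` V). F y \<in> \<psi> ` (W \<inter> V)}" by (auto simp: S_def)
  moreover have "eopen (mdim X) {y \<in> \<phi> ` (U \<inter> f -` V). F y \<in> \<psi> ` (W \<inter> V)}"
  proof (rule eopen_preimage[OF F(1,2)])
    show "eopen (mdim Y) (\<psi> ` (W \<inter> V))" using W V(1) unfolding openin_manifold[OF Y] by auto
  qed (use F(3) atlas_mem[OF Y V(1)] in auto)
  ultimately have "openin (manifold_topology X) S"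
    by (intro openin_in_chart[OF X U(1)]) (auto simp: S_def)
  then show "\<exists>T. openin (manifold_topology X) T \<and> x \<in> T \<and> T \<subseteq> {x \<in> points X. f x \<in> W}"
    using x U V in_points[OF U(1)] by (intro exI[of _ S]) (auto simp: S_def)
qed

text \<open>Two points of one chart differ in some coordinate, and the hyperplane at the midpoint of
  the two values separates them.\<close>

lemma separated_in_chart:
  assumes X: "atlas X" and U: "(U, \<phi>) \<in> charts X" and x: "x \<in> U" "y \<in> U" "x \<noteq> y"
  shows "\<exists>A B. openin (manifold_topology X) A \<and> openin (manifold_topology X) B \<and> x \<in> A \<and> y \<in> B \<and> disjnt A B"
proof -
  have "\<phi> x \<noteq> \<phi> y" using inj_onD[OF atlas_inj[OF X U]] x by blast
  then obtain i where i: "\<phi> x i \<noteq> \<phi> y i" by (auto simp: fun_eq_iff)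
  define c where "c = (\<phi> x i + \<phi> y i) / 2"
  have "openin (manifold_topology X) {w \<in> U. \<phi> w i < c}"
  proof (rule openin_in_chart[OF X U])
    have "open {z::nat \<Rightarrow> real. z i < c}"
      by (intro open_Collect_less continuous_on_coordinate continuous_intros)
    then have "eopen (mdim X) (\<phi> ` U \<inter> {z. z i < c})" by (rule eopen_Int_open[OF atlas_open[OF X U]])
    moreover have "\<phi> ` U \<inter> {z. z i < c} = \<phi> ` {w \<in> U. \<phi> w i < c}" by auto
    ultimately show "eopen (mdim X) (\<phi> ` {w \<in> U. \<phi> w i < c})" by simp
  qed auto
  moreover have "openin (manifold_topology X) {w \<in> U. c < \<phi> w i}"
  proof (rule openin_in_chart[OF X U])
    have "open {z::nat \<Rightarrow> real. c < z i}"
      by (intro open_Collect_less continuous_on_coordinate continuous_intros)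
    then have "eopen (mdim X) (\<phi> ` U \<inter> {z. c < z i})" by (rule eopen_Int_open[OF atlas_open[OF X U]])
    moreover have "\<phi> ` U \<inter> {z. c < z i} = \<phi> ` {w \<in> U. c < \<phi> w i}" by auto
    ultimately show "eopen (mdim X) (\<phi> ` {w \<in> U. c < \<phi> w i})" by simp
  qed auto
  moreover have "disjnt {w \<in> U. \<phi> w i < c} {w \<in> U. c < \<phi> w i}" by (auto simp: disjnt_def)
  moreover have "\<phi> x i < c \<and> c < \<phi> y i \<or> \<phi> y i < c \<and> c < \<phi> x i" using i by (auto simp: c_def)
  ultimately show ?thesis using x disjnt_sym by (smt (verit, ccfv_threshold) mem_Collect_eq)
qed

text \<open>Open preimages of separating sets. Hausdorffness of products, renamed manifolds and jets
  is inherited in this way along projections.\<close>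

lemma separated_by_map:
  assumes f: "smooth_map X Y f" and X: "atlas X" and Y: "atlas Y" "Hausdorff_space (manifold_topology Y)"
    and x: "x \<in> points X" "y \<in> points X" "f x \<noteq> f y"
  shows "\<exists>A B. openin (manifold_topology X) A \<and> openin (manifold_topology X) B \<and> x \<in> A \<and> y \<in> B \<and> disjnt A B"
proof -
  obtain A B where AB: "openin (manifold_topology Y) A" "openin (manifold_topology Y) B" "f x \<in> A" "f y \<in> B" "disjnt A B"
    using Y(2) x smooth_map_points[OF f] unfolding Hausdorff_space_def topspace_manifold[OF Y(1)] by metis
  show ?thesis
    using openin_smooth_vimage[OF f X Y(1) AB(1)] openin_smooth_vimage[OF f X Y(1) AB(2)] AB(3-5) x
    by (intro exI[of _ "{x \<in> points X. f x \<in> A}"] exI[of _ "{x \<in> points X. f x \<in> B}"]) (auto simp: disjnt_def)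
qed

text \<open>Stands in for second countability, because it passes to products, renamed manifolds and
  jets by simply transforming the charts.\<close>

definition countable_cover :: "'a manifold \<Rightarrow> bool" where
  "countable_cover X \<longleftrightarrow> (\<exists>C\<subseteq>charts X. countable C \<and> points X \<subseteq> (\<Union>(U, \<phi>)\<in>C. U))"

lemma second_countable_Euclidean: "second_countable (Euclidean_space d)"
proof -
  obtain B :: "(nat \<Rightarrow> real) set set" where B: "countable B" "topological_basis B"
    using ex_countable_basis by blast
  have "second_countable (euclidean :: (nat \<Rightarrow> real) topology)"
    unfolding second_countable_def
  proof (intro exI[of _ B] conjI ballI allI impI B(1))
    fix V assume "V \<in> B" then show "openin euclidean V" using topological_basis_open[OF B(2)] by auto
  next
    fix U and x :: "nat \<Rightarrow> real" assume "openin euclidean U \<and> x \<in> U"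
    then have "open U" "x \<in> U" by auto
    then show "\<exists>V\<in>B. x \<in> V \<and> V \<subseteq> U" using topological_basisE[OF B(2)] by metis
  qed
  then show ?thesis unfolding Euclidean_space_def euclidean_product_topology by (rule second_countable_subtopology)
qed

text \<open>A countable basis arises by pulling back a countable basis of the Euclidean space
  through each of the countably many charts.\<close>

lemma countable_cover_second_countable:
  assumes X: "atlas X" and c: "countable_cover X"
  shows "second_countable (manifold_topology X)"
proof -
  obtain C where C: "C \<subseteq> charts X" "countable C" "points X \<subseteq> (\<Union>(U, \<phi>)\<in>C. U)"
    using c unfolding countable_cover_def by blast
  obtain B where B: "countable B" "\<forall>V\<in>B. eopen (mdim X) V"
    "\<forall>U x. eopen (mdim X) U \<and> x \<in> U \<longrightarrow> (\<exists>V\<in>B. x \<in> V \<and> V \<subseteq> U)"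
    using second_countable_Euclidean[of "mdim X"] unfolding second_countable_def by (elim exE conjE)
  define D where "D = (\<lambda>((U, \<phi>), V). {x \<in> U. \<phi> x \<in> V}) ` (C \<times> B)"
  show ?thesis
    unfolding second_countable_def
  proof (intro exI[of _ D] conjI ballI allI impI)
    show "countable D" unfolding D_def using C B by auto
  next
    fix S assume "S \<in> D"
    then obtain U \<phi> V where S: "(U, \<phi>) \<in> C" "V \<in> B" "S = {x \<in> U. \<phi> x \<in> V}" unfolding D_def by auto
    have "\<phi> ` S = \<phi> ` U \<inter> V" using S(3) by auto
    then show "openin (manifold_topology X) S"
      using S C(1) B(2)[rule_format, OF S(2)] atlas_open[OF X, of U \<phi>] by (intro openin_in_chart[OF X, of U \<phi>]) (auto intro!: openin_Int)
  next
    fix W x assume "openin (manifold_topology X) W \<and> x \<in> W"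
    then have W: "openin (manifold_topology X) W" "x \<in> W" by auto
    then have "x \<in> points X" using openin_manifold[OF X] by auto
    then obtain U \<phi> where U: "(U, \<phi>) \<in> C" "x \<in> U" using C(3) by auto
    have UX: "(U, \<phi>) \<in> charts X" using U C by auto
    have "eopen (mdim X) (\<phi> ` (W \<inter> U))" using W(1) UX unfolding openin_manifold[OF X] by auto
    then obtain V where V: "V \<in> B" "\<phi> x \<in> V" "V \<subseteq> \<phi> ` (W \<inter> U)" using B(3) W(2) U(2) by blast
    have "y \<in> W" if "y \<in> U" "\<phi> y \<in> V" for y
      using inj_on_image_mem_iff[OF atlas_inj[OF X UX] that(1), of "W \<inter> U"] that V(3) by auto
    then show "\<exists>V\<in>D. x \<in> V \<and> V \<subseteq> W"
      using U V(1,2) unfolding D_def by (intro bexI[of _ "{x \<in> U. \<phi> x \<in> V}"]) (auto intro!: image_eqI[of _ _ "((U, \<phi>), V)"])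
  qed
qed

text \<open>The converse passage: a second countable space is Lindelof, so the cover by all chart
  domains has a countable subcover.\<close>

lemma smooth_manifold_countable_cover:
  assumes "smooth_manifold X" shows "countable_cover X"
proof -
  note X = smooth_manifold_atlas[OF assms]
  have "Lindelof_space (manifold_topology X)"
    using assms second_countable_imp_Lindelof_space unfolding smooth_manifold_def by blast
  moreover have "openin (manifold_topology X) U" if "U \<in> fst ` charts X" for U
    using that openin_in_chart[OF X _ order_refl atlas_open[OF X]] by auto
  moreover have "\<Union>(fst ` charts X) = topspace (manifold_topology X)"
    unfolding topspace_manifold[OF X] points_def by auto
  ultimately obtain V where V: "countable V" "V \<subseteq> fst ` charts X" "\<Union>V = topspace (manifold_topology X)"
    unfolding Lindelof_space_def by metis
  then obtain C where C: "C \<subseteq> charts X" "countable C" "V = fst ` C" using countable_subset_image by metis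
  have "points X = (\<Union>(U, \<phi>)\<in>C. U)"
    using V(3) unfolding topspace_manifold[OF X] C(3) by (simp add: split_beta)
  then show ?thesis using C(1,2) unfolding countable_cover_def by (intro exI[of _ C]) simp
qed

lemma smooth_manifoldI:
  assumes "atlas X" "countable_cover X"
    "\<And>x y. x \<in> points X \<Longrightarrow> y \<in> points X \<Longrightarrow> x \<noteq> y \<Longrightarrow>
      \<exists>A B. openin (manifold_topology X) A \<and> openin (manifold_topology X) B \<and> x \<in> A \<and> y \<in> B \<and> disjnt A B"
  shows "smooth_manifold X"
proof -
  have "Hausdorff_space (manifold_topology X)"
    unfolding Hausdorff_space_def topspace_manifold[OF assms(1)] using assms(3) by blast
  then show ?thesis
    using assms(1) countable_cover_second_countable[OF assms(1,2)] unfolding smooth_manifold_def atlas_def by blast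
qed

lemma smooth_manifold_Hausdorff: "smooth_manifold X \<Longrightarrow> Hausdorff_space (manifold_topology X)"
  by (simp add: smooth_manifold_def)

lemma smooth_manifold_product:
  assumes "smooth_manifold X" "smooth_manifold Y"
  shows "smooth_manifold (product_manifold X Y)"
proof -
  note X = smooth_manifold_atlas[OF assms(1)] and Y = smooth_manifold_atlas[OF assms(2)]
  note XY = atlas_product[OF X Y]
  show ?thesis
  proof (rule smooth_manifoldI[OF XY])
    obtain C where C: "C \<subseteq> charts X" "countable C" "points X \<subseteq> (\<Union>(U, \<phi>)\<in>C. U)"
      using smooth_manifold_countable_cover[OF assms(1)] unfolding countable_cover_def by blast
    obtain D where D: "D \<subseteq> charts Y" "countable D" "points Y \<subseteq> (\<Union>(U, \<phi>)\<in>D. U)"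
      using smooth_manifold_countable_cover[OF assms(2)] unfolding countable_cover_def by blast
    let ?E = "(\<lambda>((U, \<phi>), V, \<psi>). (U \<times> V, \<lambda>(x, y). append_at (mdim X) (\<phi> x) (\<psi> y))) ` (C \<times> D)"
    have "?E \<subseteq> charts (product_manifold X Y)" using C(1) D(1) charts_productI by fastforce
    moreover have "points (product_manifold X Y) \<subseteq> (\<Union>(U, \<phi>)\<in>?E. U)"
    proof
      fix z assume "z \<in> points (product_manifold X Y)"
      then obtain U \<phi> V \<psi> where "(U, \<phi>) \<in> C" "fst z \<in> U" "(V, \<psi>) \<in> D" "snd z \<in> V"
        using C(3) D(3) by fastforce
      then show "z \<in> (\<Union>(U, \<phi>)\<in>?E. U)" by (intro UN_I[of "(U \<times> V, \<lambda>(x, y). append_at (mdim X) (\<phi> x) (\<psi> y))"])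
          (auto simp: mem_Times_iff intro!: image_eqI[of _ _ "((U, \<phi>), V, \<psi>)"])
    qed
    ultimately show "countable_cover (product_manifold X Y)"
      unfolding countable_cover_def using C(2) D(2) by (intro exI[of _ ?E]) auto
  next
    fix p q assume p: "p \<in> points (product_manifold X Y)" "q \<in> points (product_manifold X Y)" "p \<noteq> q"
    then consider "fst p \<noteq> fst q" | "snd p \<noteq> snd q" by (auto simp: prod_eq_iff)
    then show "\<exists>A B. openin (manifold_topology (product_manifold X Y)) A \<and> openin (manifold_topology (product_manifold X Y)) B \<and>
        p \<in> A \<and> q \<in> B \<and> disjnt A B"
    proof cases
      case 1
      show ?thesis by (rule separated_by_map[OF smooth_map_fst[OF X Y] XY X smooth_manifold_Hausdorff[OF assms(1)] p(1,2) 1])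
    next
      case 2
      show ?thesis by (rule separated_by_map[OF smooth_map_snd[OF X Y] XY Y smooth_manifold_Hausdorff[OF assms(2)] p(1,2) 2])
    qed
  qed
qed

text \<open>One chart is already a countable cover, and any two points lie in it and are separated
  there. This applies to the powers of the Lie algebra.\<close>

lemma smooth_manifold_global_charts:
  assumes X: "atlas X" and ne: "charts X \<noteq> {}" and gl: "\<And>U \<phi>. (U, \<phi>) \<in> charts X \<Longrightarrow> U = P"
  shows "smooth_manifold X"
proof -
  obtain U \<phi> where U: "(U, \<phi>) \<in> charts X" using ne by auto
  have P: "points X = U"
  proof
    show "points X \<subseteq> U" using gl[OF U] gl unfolding points_def by auto
    show "U \<subseteq> points X" using in_points[OF U] by auto
  qed
  show ?thesis
  proof (rule smooth_manifoldI[OF X])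
    show "countable_cover X" unfolding countable_cover_def P using U by (intro exI[of _ "{(U, \<phi>)}"]) auto
  qed (use separated_in_chart[OF X U] P in blast)
qed

subsection \<open>Transport of structure\<close>

text \<open>The manifold part of \<open>transport_lie\<close>, with \<open>A\<close> in place of the
  carrier.\<close>

definition transport_manifold :: "'a set \<Rightarrow> ('a \<Rightarrow> 'b) \<Rightarrow> 'a manifold \<Rightarrow> 'b manifold" where
  "transport_manifold A f X = \<lparr>mdim = mdim X,
     charts = {(f ` U, \<lambda>x. \<phi> (inv_into A f x)) | U \<phi>. (U, \<phi>) \<in> charts X}\<rparr>"

context
  fixes A :: "'a set" and f :: "'a \<Rightarrow> 'b" and X :: "'a manifold"
  assumes inj: "inj_on f A" and A: "A = points X" and X: "atlas X"
begin

lemma transport_inv: "x \<in> A \<Longrightarrow> inv_into A f (f x) = x"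
  using inj by (simp add: inv_into_f_f)

lemma transport_points: "points (transport_manifold A f X) = f ` A"
  unfolding A points_def transport_manifold_def by auto

lemma transport_chartI: "(U, \<phi>) \<in> charts X \<Longrightarrow> (f ` U, \<lambda>x. \<phi> (inv_into A f x)) \<in> charts (transport_manifold A f X)"
  unfolding transport_manifold_def by auto

lemma transport_chart_inv: "(U, \<phi>) \<in> charts X \<Longrightarrow> x \<in> U \<Longrightarrow> inv_into A f (f x) = x"
  using transport_inv in_points A by metis

lemma transport_chart_image: "(U, \<phi>) \<in> charts X \<Longrightarrow> S \<subseteq> U \<Longrightarrow> (\<lambda>x. \<psi> (inv_into A f x)) ` (f ` S) = \<psi> ` S"
  using transport_chart_inv unfolding image_image by (intro image_cong) auto

lemma transport_mdim [simp]: "mdim (transport_manifold A f X) = mdim X"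
  by (simp add: transport_manifold_def)

lemma atlas_transport: "atlas (transport_manifold A f X)"
proof (rule atlasI)
  fix U' \<phi>' assume "(U', \<phi>') \<in> charts (transport_manifold A f X)"
  then obtain U \<phi> where U: "(U, \<phi>) \<in> charts X" "U' = f ` U" "\<phi>' = (\<lambda>x. \<phi> (inv_into A f x))"
    unfolding transport_manifold_def by auto
  show "inj_on \<phi>' U'"
    unfolding U(2,3) using transport_chart_inv[OF U(1)] inj_on_eq_iff[OF atlas_inj[OF X U(1)]]
    by (auto simp: inj_on_def)
  fix V' \<psi>' assume "(V', \<psi>') \<in> charts (transport_manifold A f X)"
  then obtain V \<psi> where V: "(V, \<psi>) \<in> charts X" "V' = f ` V" "\<psi>' = (\<lambda>x. \<psi> (inv_into A f x))"
    unfolding transport_manifold_def by auto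
  have "U' \<inter> V' = f ` (U \<inter> V)"
    unfolding U(2) V(2) using in_points[OF U(1)] in_points[OF V(1)]
    by (intro inj_on_image_Int[OF inj, symmetric]) (auto simp: A)
  then have im: "\<phi>' ` (U' \<inter> V') = \<phi> ` (U \<inter> V)"
    unfolding U(3) using transport_chart_image[OF U(1), of "U \<inter> V" \<phi>] by simp
  obtain F where F: "eopen (mdim X) (\<phi> ` (U \<inter> V))" "smooth_euclidean (mdim X) (mdim X) (\<phi> ` (U \<inter> V)) F"
    "\<And>x. x \<in> U \<Longrightarrow> x \<in> V \<Longrightarrow> F (\<phi> x) = \<psi> x" using atlas_changeE[OF X U(1) V(1)] by blast
  show "eopen (mdim (transport_manifold A f X)) (\<phi>' ` (U' \<inter> V'))" using F(1) im by simp
  have "F (\<phi>' x) = \<psi>' x" if "x \<in> U' \<inter> V'" for x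
    using that \<open>U' \<inter> V' = f ` (U \<inter> V)\<close> F(3) transport_chart_inv[OF U(1)] unfolding U(3) V(3) by auto
  then show "\<exists>F. smooth_euclidean (mdim (transport_manifold A f X)) (mdim (transport_manifold A f X)) (\<phi>' ` (U' \<inter> V')) F \<and>
     (\<forall>x\<in>U' \<inter> V'. F (\<phi>' x) = \<psi>' x)" using F(2) im by auto
qed

text \<open>In corresponding charts \<open>f\<close> is the identity of coordinates.\<close>

lemma smooth_map_transport: "smooth_map X (transport_manifold A f X) f"
proof (rule smooth_mapI[OF X atlas_transport])
  fix x assume "x \<in> points X"
  then obtain U \<phi> where U: "(U, \<phi>) \<in> charts X" "x \<in> U" using points_cover by metis
  show "smooth_near X (transport_manifold A f X) f x"
    by (rule smooth_nearI[of U \<phi> _ "f ` U" "\<lambda>x. \<phi> (inv_into A f x)" _ _ U _ "\<lambda>x. x"])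
      (use U transport_chartI[OF U(1)] atlas_open[OF X U(1)] transport_chart_inv[OF U(1)] in \<open>auto simp: smooth_euclidean_iff\<close>)
qed

lemma smooth_map_transport_inv: "smooth_map (transport_manifold A f X) X (inv_into A f)"
proof (rule smooth_mapI[OF atlas_transport X])
  fix y assume "y \<in> points (transport_manifold A f X)"
  then have "y \<in> f ` A" unfolding transport_points .
  then obtain x where x: "x \<in> points X" "y = f x" unfolding A by blast
  then obtain U \<phi> where U: "(U, \<phi>) \<in> charts X" "x \<in> U" using points_cover by metis
  have im: "(\<lambda>x. \<phi> (inv_into A f x)) ` (f ` U) = \<phi> ` U" by (rule transport_chart_image[OF U(1) order_refl])
  show "smooth_near (transport_manifold A f X) X (inv_into A f) y"
    by (rule smooth_nearI[of "f ` U" "\<lambda>x. \<phi> (inv_into A f x)" _ U \<phi> _ _ "f ` U" _ "\<lambda>x. x"])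
      (use U x transport_chartI[OF U(1)] atlas_open[OF X U(1)] transport_chart_inv[OF U(1)] im in \<open>auto simp: smooth_euclidean_iff\<close>)
qed

lemma smooth_manifold_transport:
  assumes "smooth_manifold X" shows "smooth_manifold (transport_manifold A f X)"
proof (rule smooth_manifoldI[OF atlas_transport])
  obtain C where C: "C \<subseteq> charts X" "countable C" "points X \<subseteq> (\<Union>(U, \<phi>)\<in>C. U)"
    using smooth_manifold_countable_cover[OF assms(1)] unfolding countable_cover_def by blast
  let ?E = "(\<lambda>(U, \<phi>). (f ` U, \<lambda>x. \<phi> (inv_into A f x))) ` C"
  have "?E \<subseteq> charts (transport_manifold A f X)" using C(1) transport_chartI by auto
  moreover have "points (transport_manifold A f X) \<subseteq> (\<Union>(U, \<phi>)\<in>?E. U)"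
  proof
    fix y assume "y \<in> points (transport_manifold A f X)"
    then have "y \<in> f ` A" unfolding transport_points .
  then obtain x where x: "x \<in> points X" "y = f x" unfolding A by blast
    then obtain U \<phi> where "(U, \<phi>) \<in> C" "x \<in> U" using C(3) by auto
    then show "y \<in> (\<Union>(U, \<phi>)\<in>?E. U)" using x by force
  qed
  ultimately show "countable_cover (transport_manifold A f X)"
    unfolding countable_cover_def using C(2) by (intro exI[of _ ?E]) auto
next
  fix x y assume xy: "x \<in> points (transport_manifold A f X)" "y \<in> points (transport_manifold A f X)" "x \<noteq> y"
  then have "inv_into A f x \<noteq> inv_into A f y" unfolding transport_points by (metis f_inv_into_f)
  then show "\<exists>U V. openin (manifold_topology (transport_manifold A f X)) U \<and> openin (manifold_topology (transport_manifold A f X)) V \<and>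
      x \<in> U \<and> y \<in> V \<and> disjnt U V"
    by (intro separated_by_map[OF smooth_map_transport_inv atlas_transport X smooth_manifold_Hausdorff[OF assms]] xy(1,2))
qed

end

section \<open>Jets\<close>

text \<open>The body of \<open>curve\<close> with chart and interval as parameters, so that the
  chart can be changed and the interval shrunk.\<close>

definition chart_curve :: "'a manifold \<Rightarrow> 'a set \<Rightarrow> ('a \<Rightarrow> nat \<Rightarrow> real) \<Rightarrow> real \<Rightarrow> (real \<Rightarrow> 'a) \<Rightarrow> bool" where
  "chart_curve X U \<phi> e p \<longleftrightarrow> e > 0 \<and> (\<forall>t\<in>{-e<..<e}. p t \<in> U) \<and>
     (\<forall>i<mdim X. smooth_real {-e<..<e} (\<lambda>s. \<phi> (p s) i))"

lemma curve_iff: "curve X p \<longleftrightarrow> (\<exists>U \<phi> e. (U, \<phi>) \<in> charts X \<and> chart_curve X U \<phi> e p)"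
proof
  assume "curve X p"
  then obtain c where c: "c \<in> charts X" "case c of (U, \<phi>) \<Rightarrow> \<exists>e>0. \<forall>t\<in>{-e<..<e}. p t \<in> U \<and>
     (\<forall>i < mdim X. \<forall>k. (deriv ^^ k) (\<lambda>s. \<phi> (p s) i) differentiable (at t))"
    unfolding curve_def by (rule bexE)
  obtain U \<phi> where U: "c = (U, \<phi>)" by (cases c)
  obtain e where *: "(U, \<phi>) \<in> charts X" "e > 0" "\<forall>t\<in>{-e<..<e}. p t \<in> U \<and>
     (\<forall>i < mdim X. \<forall>k. (deriv ^^ k) (\<lambda>s. \<phi> (p s) i) differentiable (at t))"
    using c unfolding U prod.case by (elim exE conjE)
  then have "chart_curve X U \<phi> e p" by (simp add: chart_curve_def smooth_real_def)
  then show "\<exists>U \<phi> e. (U, \<phi>) \<in> charts X \<and> chart_curve X U \<phi> e p" using *(1) by (intro exI conjI)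
next
  assume "\<exists>U \<phi> e. (U, \<phi>) \<in> charts X \<and> chart_curve X U \<phi> e p"
  then obtain U \<phi> e where *: "(U, \<phi>) \<in> charts X" "chart_curve X U \<phi> e p" by (elim exE conjE)
  show "curve X p" unfolding curve_def
    by (rule bexI[OF _ *(1)], unfold prod.case, rule exI[of _ e])
      (use *(2) in \<open>simp add: chart_curve_def smooth_real_def\<close>)
qed

lemma chart_curve_mem: "chart_curve X U \<phi> e p \<Longrightarrow> \<bar>t\<bar> < e \<Longrightarrow> p t \<in> U"
  unfolding chart_curve_def by (metis abs_less_iff greaterThanLessThan_iff minus_less_iff)

lemma chart_curve_0: "chart_curve X U \<phi> e p \<Longrightarrow> p 0 \<in> U"
  by (auto simp: chart_curve_def)

lemma chart_curve_mono: "chart_curve X U \<phi> e p \<Longrightarrow> 0 < e' \<Longrightarrow> e' \<le> e \<Longrightarrow> chart_curve X U \<phi> e' p"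
  unfolding chart_curve_def by (auto intro: smooth_real_subset)

text \<open>Continuity keeps the image in the given chart \<open>V\<close> after shrinking the
  interval; there its coordinates are those of \<open>p\<close> under the local expression
  \<open>F\<close>.\<close>

lemma chart_curve_map:
  assumes f: "smooth_map X Y f" and X: "atlas X" and Y: "atlas Y" and U: "(U, \<phi>) \<in> charts X"
    and V: "(V, \<psi>) \<in> charts Y" "f (p 0) \<in> V" and p: "chart_curve X U \<phi> e p"
  obtains e' where "chart_curve X U \<phi> e' p" "chart_curve Y V \<psi> e' (\<lambda>t. f (p t))"
proof -
  obtain F where F: "eopen (mdim X) (\<phi> ` (U \<inter> f -` V))"
    "smooth_euclidean (mdim X) (mdim Y) (\<phi> ` (U \<inter> f -` V)) F"
    "\<And>x. x \<in> U \<Longrightarrow> f x \<in> V \<Longrightarrow> F (\<phi> x) = \<psi> (f x)"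
    using smooth_mapE[OF f X U V(1)] by blast
  have e: "e > 0" and pU: "\<And>t. \<bar>t\<bar> < e \<Longrightarrow> p t \<in> U"
    using p chart_curve_mem[OF p] by (auto simp: chart_curve_def)
  have "\<phi> (p 0) \<in> \<phi> ` (U \<inter> f -` V)" using V(2) chart_curve_0[OF p] by auto
  then obtain e' where e': "e' > 0" "e' \<le> e" "\<And>t. \<bar>t\<bar> < e' \<Longrightarrow> \<phi> (p t) \<in> \<phi> ` (U \<inter> f -` V)"
  proof (rule curve_stays_in_open[OF e F(1)])
    show "\<phi> (p t) \<in> Eucl (mdim X)" if "\<bar>t\<bar> < e" for t using atlas_mem[OF X U pU[OF that]] .
    show "smooth_real {-e<..<e} (\<lambda>t. \<phi> (p t) j)" if "j < mdim X" for j
      using p that unfolding chart_curve_def by blast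
  qed blast
  have pe': "chart_curve X U \<phi> e' p" using chart_curve_mono[OF p e'(1,2)] .
  have fp: "f (p t) \<in> V" if "\<bar>t\<bar> < e'" for t
    using e'(3)[OF that] inj_on_image_mem_iff[OF atlas_inj[OF X U] chart_curve_mem[OF pe' that], of "U \<inter> f -` V"] by auto
  have "smooth_real {-e'<..<e'} (\<lambda>s. \<psi> (f (p s)) j)" if j: "j < mdim Y" for j
  proof (rule smooth_real_cong[of _ "\<lambda>t. F (\<phi> (p t)) j"])
    show "smooth_real {-e'<..<e'} (\<lambda>t. F (\<phi> (p t)) j)"
    proof (rule smooth_real_compose[OF _ F(1), of _ "\<lambda>x. F x j"])
      show "smooth_on (mdim X) (\<phi> ` (U \<inter> f -` V)) (\<lambda>x. F x j)" using F(2) j by (auto simp: smooth_euclidean_iff)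
      show "smooth_real {-e'<..<e'} (\<lambda>t. \<phi> (p t) i)" if "i < mdim X" for i
        using pe' that unfolding chart_curve_def by blast
    qed (use e'(3) in auto)
    fix t assume "t \<in> {-e'<..<e'}"
    then have "\<bar>t\<bar> < e'" by auto
    then show "F (\<phi> (p t)) j = \<psi> (f (p t)) j" using F(3) fp chart_curve_mem[OF pe'] by simp
  qed auto
  then have "chart_curve Y V \<psi> e' (\<lambda>t. f (p t))" unfolding chart_curve_def using e'(1) fp by auto
  with pe' show thesis by (rule that)
qed

text \<open>\<open>curve\<close> provides some chart only; \<open>chart_curve_map\<close> for the
  identity map moves to the desired one.\<close>

lemma curve_in_chart:
  assumes X: "atlas X" and p: "curve X p" and U: "(U, \<phi>) \<in> charts X" "p 0 \<in> U"
  obtains e where "chart_curve X U \<phi> e p"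
proof -
  obtain V \<psi> e where V: "(V, \<psi>) \<in> charts X" "chart_curve X V \<psi> e p" using p curve_iff by blast
  show thesis
    by (rule chart_curve_map[OF smooth_map_id[OF X] X X V(1) U(1) _ V(2)]) (use U(2) that in auto)
qed

lemma curve_0: "curve X p \<Longrightarrow> p 0 \<in> points X"
  unfolding curve_iff by (elim exE conjE) (rule in_points, assumption, rule chart_curve_0)

lemma curveI: "(U, \<phi>) \<in> charts X \<Longrightarrow> chart_curve X U \<phi> e p \<Longrightarrow> curve X p"
  unfolding curve_iff by (intro exI conjI)

lemma curve_map:
  assumes f: "smooth_map X Y f" and X: "atlas X" and Y: "atlas Y" and p: "curve X p"
  shows "curve Y (\<lambda>t. f (p t))"
proof -
  obtain U \<phi> e where U: "(U, \<phi>) \<in> charts X" "chart_curve X U \<phi> e p" using p curve_iff by blast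
  obtain V \<psi> where V: "(V, \<psi>) \<in> charts Y" "f (p 0) \<in> V"
    using points_cover[OF smooth_map_points[OF f curve_0[OF p]]] .
  obtain e' where "chart_curve Y V \<psi> e' (\<lambda>t. f (p t))"
    using chart_curve_map[OF f X Y U(1) V U(2)] by blast
  then show ?thesis by (rule curveI[OF V(1)])
qed

lemma eventually_nhds_0: "e > 0 \<Longrightarrow> (\<And>t. \<bar>t\<bar> < e \<Longrightarrow> P t) \<Longrightarrow> eventually P (nhds (0::real))"
  unfolding eventually_nhds by (intro exI[of _ "{-e<..<e}"]) auto

lemma curve_cong:
  assumes p: "curve X p" and eq: "eventually (\<lambda>t. p t = q t) (nhds 0)"
  shows "curve X q"
proof -
  obtain U \<phi> e where U: "(U, \<phi>) \<in> charts X" "chart_curve X U \<phi> e p" using p curve_iff by blast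
  obtain d where d: "d > 0" "\<And>t. \<bar>t\<bar> < d \<Longrightarrow> p t = q t"
    using eq unfolding eventually_nhds_metric by (auto simp: dist_real_def)
  define r where "r = min d e"
  have r: "r > 0" "r \<le> e" using d(1) U(2) by (auto simp: r_def chart_curve_def)
  have pr: "chart_curve X U \<phi> r p" using chart_curve_mono[OF U(2) r] .
  have pq: "p t = q t" if "t \<in> {-r<..<r}" for t using that by (intro d(2)) (auto simp: r_def)
  have "smooth_real {-r<..<r} (\<lambda>s. \<phi> (q s) i)" if "i < mdim X" for i
    by (rule smooth_real_cong[of _ "\<lambda>s. \<phi> (p s) i"]) (use pr that pq in \<open>auto simp: chart_curve_def\<close>)
  then have "chart_curve X U \<phi> r q" using pr pq unfolding chart_curve_def by auto
  then show ?thesis by (rule curveI[OF U(1)])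
qed

lemma eventually_in_chart:
  assumes "atlas X" "curve X p" "(U, \<phi>) \<in> charts X" "p 0 \<in> U"
  shows "eventually (\<lambda>t. p t \<in> U) (nhds 0)"
proof -
  obtain e where e: "chart_curve X U \<phi> e p" using curve_in_chart[OF assms] .
  show ?thesis
  proof (rule eventually_nhds_0)
    show "e > 0" using e by (simp add: chart_curve_def)
    show "p t \<in> U" if "\<bar>t\<bar> < e" for t using chart_curve_mem[OF e that] .
  qed
qed

lemma jet_coords_map:
  assumes f: "smooth_map X Y f" and X: "atlas X" and Y: "atlas Y" and U: "(U, \<phi>) \<in> charts X"
    and V: "(V, \<psi>) \<in> charts Y" "f (p 0) \<in> V" and p: "curve X p" "p 0 \<in> U"
    and F: "eopen (mdim X) (\<phi> ` (U \<inter> f -` V))" "smooth_euclidean (mdim X) (mdim Y) (\<phi> ` (U \<inter> f -` V)) F"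
      "\<And>x. x \<in> U \<Longrightarrow> f x \<in> V \<Longrightarrow> F (\<phi> x) = \<psi> (f x)"
  shows "jet_coords n (mdim Y) (\<lambda>t. \<psi> (f (p t))) 0 =
    (\<lambda>a. if a < (n + 1) * mdim Y then prol (mdim X) (a div mdim Y) (\<lambda>x. F x (a mod mdim Y))
      (jet_coords n (mdim X) (\<lambda>t. \<phi> (p t)) 0) else 0)"
proof -
  obtain e1 where e1: "chart_curve X U \<phi> e1 p" using curve_in_chart[OF X p(1) U p(2)] .
  obtain e where e: "chart_curve X U \<phi> e p" "chart_curve Y V \<psi> e (\<lambda>t. f (p t))"
    using chart_curve_map[OF f X Y U V e1] by blast
  have e0: "e > 0" using e(1) by (simp add: chart_curve_def)
  have "eventually (\<lambda>t. \<psi> (f (p t)) = F (\<phi> (p t))) (nhds 0)"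
    by (rule eventually_nhds_0[OF e0]) (use F(3) chart_curve_mem[OF e(1)] chart_curve_mem[OF e(2)] in simp)
  then have "jet_coords n (mdim Y) (\<lambda>t. \<psi> (f (p t))) 0 = jet_coords n (mdim Y) (\<lambda>t. F (\<phi> (p t))) 0"
    by (rule jet_coords_cong)
  also have "\<dots> = (\<lambda>a. if a < (n + 1) * mdim Y then prol (mdim X) (a div mdim Y) (\<lambda>x. F x (a mod mdim Y))
      (jet_coords n (mdim X) (\<lambda>t. \<phi> (p t)) 0) else 0)"
  proof (rule jet_coords_prol[OF F(1,2)])
    show "open {-e<..<e}" "0 \<in> {-e<..<e}" using e0 by auto
    show "\<phi> (p t) \<in> \<phi> ` (U \<inter> f -` V)" if "t \<in> {-e<..<e}" for t
      using e that unfolding chart_curve_def by auto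
    show "smooth_real {-e<..<e} (\<lambda>t. \<phi> (p t) j)" if "j < mdim X" for j
      using e that unfolding chart_curve_def by auto
  qed
  finally show ?thesis .
qed

section \<open>Equality of derivatives, in one chart and in all charts\<close>

lemma same_derivs_refl: "same_derivs X n p p"
  and same_derivs_sym: "same_derivs X n p q \<Longrightarrow> same_derivs X n q p"
  by (auto simp: same_derivs_def)

lemma same_derivs_trans:
  assumes "same_derivs X n p q" "same_derivs X n q r" shows "same_derivs X n p r"
  unfolding same_derivs_def
proof (intro conjI ballI)
  show "p 0 = r 0" using assms by (simp add: same_derivs_def)
  fix c assume "c \<in> charts X"
  then show "case c of (U, \<phi>) \<Rightarrow> p 0 \<in> U \<longrightarrow> (\<forall>k\<le>n. \<forall>i < mdim X.
        (deriv ^^ k) (\<lambda>t. \<phi> (p t) i) 0 = (deriv ^^ k) (\<lambda>t. \<phi> (r t) i) 0)"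
    using assms[unfolded same_derivs_def] by (cases c) fastforce
qed

lemma same_derivs_jet_coords:
  assumes "same_derivs X n p q" "(U, \<phi>) \<in> charts X" "p 0 \<in> U"
  shows "jet_coords n (mdim X) (\<lambda>t. \<phi> (p t)) 0 = jet_coords n (mdim X) (\<lambda>t. \<phi> (q t)) 0"
  using assms unfolding jet_coords_eq_iff same_derivs_def by fast

lemma jet_coords_same_point:
  assumes X: "atlas X" and U: "(U, \<phi>) \<in> charts X" and p: "p 0 \<in> U" "q 0 \<in> U"
    and eq: "jet_coords n (mdim X) (\<lambda>t. \<phi> (p t)) 0 = jet_coords n (mdim X) (\<lambda>t. \<phi> (q t)) 0"
  shows "p 0 = q 0"
proof -
  have "\<phi> (p 0) = \<phi> (q 0)"
    using arg_cong[OF eq, of "trunc (mdim X)"] trunc_jet_coords[of "\<lambda>t. \<phi> (p t)" 0]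
      trunc_jet_coords[of "\<lambda>t. \<phi> (q t)" 0] atlas_mem[OF X U] p by simp
  then show ?thesis using inj_onD[OF atlas_inj[OF X U]] p by blast
qed

text \<open>Equality is assumed in a single chart and obtained in every chart of \<open>Y\<close>,
  because \<open>jet_coords_map\<close> makes the derivatives of the image a function of those of
  the curve. For the identity map this says that one chart decides.\<close>

lemma same_derivs_map:
  assumes f: "smooth_map X Y f" and X: "atlas X" and Y: "atlas Y"
    and pq: "curve X p" "curve X q" and U: "(U, \<phi>) \<in> charts X" "p 0 \<in> U" "q 0 \<in> U"
    and eq: "jet_coords n (mdim X) (\<lambda>t. \<phi> (p t)) 0 = jet_coords n (mdim X) (\<lambda>t. \<phi> (q t)) 0"
  shows "same_derivs Y n (\<lambda>t. f (p t)) (\<lambda>t. f (q t))"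
proof -
  have 0: "p 0 = q 0" using jet_coords_same_point[where p = p and q = q, OF X U eq] .
  have "jet_coords n (mdim Y) (\<lambda>t. \<psi> (f (p t))) 0 = jet_coords n (mdim Y) (\<lambda>t. \<psi> (f (q t))) 0"
    if V: "(V, \<psi>) \<in> charts Y" "f (p 0) \<in> V" for V \<psi>
  proof -
    obtain F where F: "eopen (mdim X) (\<phi> ` (U \<inter> f -` V))"
      "smooth_euclidean (mdim X) (mdim Y) (\<phi> ` (U \<inter> f -` V)) F"
      "\<And>x. x \<in> U \<Longrightarrow> f x \<in> V \<Longrightarrow> F (\<phi> x) = \<psi> (f x)"
      using smooth_mapE[OF f X U(1) V(1)] by blast
    have V': "f (q 0) \<in> V" using V 0 by simp
    show ?thesis
      using jet_coords_map[where p = p, OF f X Y U(1) V pq(1) U(2) F, of n]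
        jet_coords_map[where p = q, OF f X Y U(1) V(1) V' pq(2) U(3) F, of n] eq by (simp cong: if_cong)
  qed
  then show ?thesis unfolding same_derivs_def using 0 by (auto simp: jet_coords_eq_iff)
qed

lemma same_derivs_iff:
  assumes X: "atlas X" and pq: "curve X p" "curve X q" and U: "(U, \<phi>) \<in> charts X" "p 0 \<in> U" "q 0 \<in> U"
  shows "same_derivs X n p q \<longleftrightarrow>
    jet_coords n (mdim X) (\<lambda>t. \<phi> (p t)) 0 = jet_coords n (mdim X) (\<lambda>t. \<phi> (q t)) 0"
  using same_derivs_jet_coords[where p = p and q = q, OF _ U(1,2)]
    same_derivs_map[where p = p and q = q, OF smooth_map_id[OF X] X X pq U] by blast

lemma same_derivs_cong:
  assumes "eventually (\<lambda>t. p t = q t) (nhds 0)"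
  shows "same_derivs X n p q"
proof -
  have "p 0 = q 0" using assms by (rule eventually_nhds_x_imp_x)
  moreover have "(deriv ^^ k) (\<lambda>t. \<phi> (p t) i) 0 = (deriv ^^ k) (\<lambda>t. \<phi> (q t) i) 0" for k i and \<phi> :: "'a \<Rightarrow> nat \<Rightarrow> real"
    by (rule higher_deriv_cong[OF eventually_mono[OF assms]]) simp
  ultimately show ?thesis unfolding same_derivs_def by auto
qed

lemma jet_eq_iff:
  assumes "curve X p" "curve X q"
  shows "jet X n p = jet X n q \<longleftrightarrow> same_derivs X n p q"
proof
  assume "jet X n p = jet X n q"
  then have "q \<in> jet X n p" using assms(2) same_derivs_refl by (auto simp: jet_def)
  then show "same_derivs X n p q" by (simp add: jet_def)
next
  assume "same_derivs X n p q"
  then show "jet X n p = jet X n q" unfolding jet_def using same_derivs_sym same_derivs_trans by blast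
qed

lemma jet_in_jets: "curve X p \<Longrightarrow> jet X n p \<in> jets X n"
  by (auto simp: jets_def)

lemma representative_jet:
  assumes "curve X p"
  shows "curve X (representative (jet X n p))" "same_derivs X n p (representative (jet X n p))"
    "representative (jet X n p) 0 = p 0"
proof -
  have "p \<in> jet X n p" using assms same_derivs_refl by (auto simp: jet_def)
  then have *: "representative (jet X n p) \<in> jet X n p"
    unfolding representative_def by (rule someI[where P = "\<lambda>q. q \<in> jet X n p"])
  then show "curve X (representative (jet X n p))" and s: "same_derivs X n p (representative (jet X n p))"
    by (auto simp: jet_def)
  show "representative (jet X n p) 0 = p 0" using s by (simp add: same_derivs_def)
qed

lemma jets_representative:
  assumes "c \<in> jets X n"
  shows "curve X (representative c)" "jet X n (representative c) = c"
proof -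
  obtain p where p: "curve X p" "c = jet X n p" using assms by (auto simp: jets_def)
  note r = representative_jet[OF p(1), of n]
  show "curve X (representative c)" unfolding p(2) by (rule r(1))
  show "jet X n (representative c) = c"
    unfolding p(2) by (rule jet_eq_iff[THEN iffD2, OF r(1) p(1) same_derivs_sym[OF r(2)]])
qed

text \<open>Group laws are applied to all values of a curve, but a representative is controlled only
  near 0. Making it constant outside a small interval leaves the jet unchanged.\<close>

lemma jets_cases:
  assumes "c \<in> jets X n"
  obtains p where "curve X p" "\<And>t. p t \<in> points X" "c = jet X n p"
proof -
  let ?r = "representative c"
  obtain U \<phi> e where U: "(U, \<phi>) \<in> charts X" "chart_curve X U \<phi> e ?r"
    using jets_representative(1)[OF assms] curve_iff by blast
  define p where "p t = (if \<bar>t\<bar> < e then ?r t else ?r 0)" for t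
  have "e > 0" using U(2) by (simp add: chart_curve_def)
  then have ev: "eventually (\<lambda>t. ?r t = p t) (nhds 0)" by (rule eventually_nhds_0) (simp add: p_def)
  show thesis
  proof (rule that[of p])
    show p: "curve X p" by (rule curve_cong[OF jets_representative(1)[OF assms] ev])
    show "p t \<in> points X" for t
      using in_points[OF U(1)] chart_curve_mem[OF U(2)] chart_curve_0[OF U(2)] by (auto simp: p_def)
    show "c = jet X n p"
      using jet_eq_iff[OF jets_representative(1)[OF assms] p] same_derivs_cong[OF ev]
        jets_representative(2)[OF assms] by simp
  qed
qed

subsection \<open>The manifold of jets\<close>

definition jet_domain :: "'a manifold \<Rightarrow> nat \<Rightarrow> 'a set \<Rightarrow> (real \<Rightarrow> 'a) set set" where
  "jet_domain X n U = {c \<in> jets X n. representative c 0 \<in> U}"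

definition jet_chart :: "'a manifold \<Rightarrow> nat \<Rightarrow> ('a \<Rightarrow> nat \<Rightarrow> real) \<Rightarrow> (real \<Rightarrow> 'a) set \<Rightarrow> nat \<Rightarrow> real" where
  "jet_chart X n \<phi> c = jet_coords n (mdim X) (\<lambda>t. \<phi> (representative c t)) 0"

lemma mdim_jet [simp]: "mdim (jet_manifold X n) = (n + 1) * mdim X"
  by (simp add: jet_manifold_def)

lemma charts_jet: "charts (jet_manifold X n) = {(jet_domain X n U, jet_chart X n \<phi>) | U \<phi>. (U, \<phi>) \<in> charts X}"
  by (simp add: jet_manifold_def jet_domain_def jet_chart_def[abs_def] jet_coords_def)

lemma charts_jetI: "(U, \<phi>) \<in> charts X \<Longrightarrow> (jet_domain X n U, jet_chart X n \<phi>) \<in> charts (jet_manifold X n)"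
  unfolding charts_jet by blast

lemma points_jet [simp]: "points (jet_manifold X n) = jets X n"
proof
  show "points (jet_manifold X n) \<subseteq> jets X n" by (auto simp: points_def charts_jet jet_domain_def)
  show "jets X n \<subseteq> points (jet_manifold X n)"
  proof
    fix c assume c: "c \<in> jets X n"
    obtain U \<phi> where "(U, \<phi>) \<in> charts X" "representative c 0 \<in> U"
      using points_cover[OF curve_0[OF jets_representative(1)[OF c]]] .
    then show "c \<in> points (jet_manifold X n)"
      using in_points[OF charts_jetI[of U \<phi> X n], of c] c by (simp add: jet_domain_def)
  qed
qed

lemma jet_domain_jet [simp]: "curve X p \<Longrightarrow> jet X n p \<in> jet_domain X n U \<longleftrightarrow> p 0 \<in> U"
  by (simp add: jet_domain_def jet_in_jets representative_jet)

lemma jet_domain_cases: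
  assumes "c \<in> jet_domain X n U" obtains p where "curve X p" "\<And>t. p t \<in> points X" "c = jet X n p" "p 0 \<in> U"
  using assms jets_cases[of c X n] by (metis (no_types, lifting) jet_domain_def mem_Collect_eq representative_jet(3))

lemma jet_chart_jet:
  assumes "(U, \<phi>) \<in> charts X" "curve X p" "p 0 \<in> U"
  shows "jet_chart X n \<phi> (jet X n p) = jet_coords n (mdim X) (\<lambda>t. \<phi> (p t)) 0"
  unfolding jet_chart_def using same_derivs_jet_coords[OF representative_jet(2)[OF assms(2)] assms(1,3)] by simp

lemma inj_on_jet_chart:
  assumes X: "atlas X" and U: "(U, \<phi>) \<in> charts X"
  shows "inj_on (jet_chart X n \<phi>) (jet_domain X n U)"
proof (rule inj_onI)
  fix c d assume c: "c \<in> jet_domain X n U" and d: "d \<in> jet_domain X n U"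
    and eq: "jet_chart X n \<phi> c = jet_chart X n \<phi> d"
  obtain p where p: "curve X p" "c = jet X n p" "p 0 \<in> U" using jet_domain_cases[OF c] by metis
  obtain q where q: "curve X q" "d = jet X n q" "q 0 \<in> U" using jet_domain_cases[OF d] by metis
  show "c = d" using eq unfolding p(2) q(2) jet_chart_jet[OF U p(1,3)] jet_chart_jet[OF U q(1,3)]
      jet_eq_iff[OF p(1) q(1)] same_derivs_iff[OF X p(1) q(1) U p(3) q(3)] .
qed

lemma trunc_jet_chart:
  assumes "atlas X" "(U, \<phi>) \<in> charts X" "c \<in> jet_domain X n U"
  shows "trunc (mdim X) (jet_chart X n \<phi> c) = \<phi> (representative c 0)"
  unfolding jet_chart_def
  by (rule trunc_jet_coords) (use assms(3) atlas_mem[OF assms(1,2)] in \<open>auto simp: jet_domain_def\<close>)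

text \<open>Only the base point is constrained: any prescribed derivatives are attained by a
  polynomial curve, which stays in the open image of the chart for a short time and can be pulled
  back.\<close>

lemma jet_chart_image:
  assumes X: "atlas X" and U: "(U, \<phi>) \<in> charts X" and W: "W \<subseteq> U"
  shows "jet_chart X n \<phi> ` jet_domain X n W = {x \<in> Eucl ((n + 1) * mdim X). trunc (mdim X) x \<in> \<phi> ` W}"
proof
  show "jet_chart X n \<phi> ` jet_domain X n W \<subseteq> {x \<in> Eucl ((n + 1) * mdim X). trunc (mdim X) x \<in> \<phi> ` W}"
  proof (rule image_subsetI)
    fix c assume c: "c \<in> jet_domain X n W"
    then have "c \<in> jet_domain X n U" using W by (auto simp: jet_domain_def)
    from trunc_jet_chart[OF X U this] show "jet_chart X n \<phi> c \<in> {x \<in> Eucl ((n + 1) * mdim X). trunc (mdim X) x \<in> \<phi> ` W}"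
      using c jet_coords_mem[of n "mdim X"] by (auto simp: jet_domain_def jet_chart_def)
  qed
  show "{x \<in> Eucl ((n + 1) * mdim X). trunc (mdim X) x \<in> \<phi> ` W} \<subseteq> jet_chart X n \<phi> ` jet_domain X n W"
  proof safe
    fix x w assume x: "x \<in> Eucl ((n + 1) * mdim X)" "trunc (mdim X) x = \<phi> w" and w: "w \<in> W"
    obtain q where q: "\<And>t. q t \<in> Eucl (mdim X)" "\<And>j. smooth_real UNIV (\<lambda>t. q t j)" "jet_coords n (mdim X) q 0 = x"
      using exists_curve_jet_coords[OF x(1)] by blast
    have q0: "q 0 = \<phi> w" using trunc_jet_coords[where p = q and t = 0 and n = n, OF q(1)] x(2) q(3) by simp
    have "q 0 \<in> \<phi> ` U" using q0 w W by auto
    then obtain e where e: "e > 0" "\<And>t. \<bar>t\<bar> < e \<Longrightarrow> q t \<in> \<phi> ` U"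
    proof (rule curve_stays_in_open[where p = q, OF zero_less_one atlas_open[OF X U]])
      show "q t \<in> Eucl (mdim X)" for t by (rule q(1))
      show "smooth_real {- 1<..<1} (\<lambda>t. q t j)" for j by (rule smooth_real_subset[OF q(2) subset_UNIV])
    qed blast
    \<comment> \<open>For \<open>t\<close> beyond \<open>e\<close> these values may be arbitrary,
      which does not affect the jet.\<close>
    define p where "p t = inv_into U \<phi> (q t)" for t
    have p: "p t \<in> U" "\<phi> (p t) = q t" if "\<bar>t\<bar> < e" for t
      using e(2)[OF that] by (auto simp: p_def inv_into_into f_inv_into_f)
    have "smooth_real {-e<..<e} (\<lambda>s. \<phi> (p s) i)" for i
      by (rule smooth_real_cong[OF _ smooth_real_subset[OF q(2) subset_UNIV], of _ i]) (use p(2) in auto)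
    then have "chart_curve X U \<phi> e p" unfolding chart_curve_def using e(1) p(1) by auto
    then have cp: "curve X p" by (rule curveI[OF U])
    have p0: "p 0 = w" using q0 atlas_inv[OF X U] w W by (auto simp: p_def)
    have "jet_chart X n \<phi> (jet X n p) = jet_coords n (mdim X) (\<lambda>t. \<phi> (p t)) 0"
      using p0 w W by (intro jet_chart_jet[OF U cp]) auto
    also have "\<dots> = jet_coords n (mdim X) q 0"
      by (rule jet_coords_cong, rule eventually_nhds_0[OF e(1)]) (use p(2) in auto)
    finally have "x = jet_chart X n \<phi> (jet X n p)" using q(3) by simp
    moreover have "jet X n p \<in> jet_domain X n W" using cp p0 w by simp
    ultimately show "x \<in> jet_chart X n \<phi> ` jet_domain X n W" by blast
  qed
qed

lemma smooth_euclidean_prol: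
  assumes "eopen d O'" "smooth_euclidean d e O' F"
  shows "smooth_euclidean ((n + 1) * d) ((n + 1) * e) {x \<in> Eucl ((n + 1) * d). trunc d x \<in> O'}
    (\<lambda>x a. if a < (n + 1) * e then prol d (a div e) (\<lambda>x. F x (a mod e)) x else 0)"
  unfolding smooth_euclidean_iff
proof (intro allI impI)
  fix a assume a: "a < (n + 1) * e"
  then have e: "e > 0" by (cases e) auto
  have "a div e < n + 1" using less_mult_imp_div_less[OF a] .
  then have "smooth_on ((n + 1) * d) {x \<in> Eucl ((n + 1) * d). trunc d x \<in> O'} (prol d (a div e) (\<lambda>x. F x (a mod e)))"
    using assms(2) e by (intro smooth_on_prol[OF assms(1)] mult_le_mono1) (auto simp: smooth_euclidean_iff)
  then show "smooth_on ((n + 1) * d) {x \<in> Eucl ((n + 1) * d). trunc d x \<in> O'}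
      (\<lambda>x. if a < (n + 1) * e then prol d (a div e) (\<lambda>x. F x (a mod e)) x else 0)"
    using a by simp
qed

text \<open>The transition maps are made of the total derivatives of the transition maps of
  \<open>X\<close>.\<close>

lemma atlas_jet:
  assumes X: "atlas X" shows "atlas (jet_manifold X n)"
proof (rule atlasI)
  fix U' \<phi>' assume "(U', \<phi>') \<in> charts (jet_manifold X n)"
  then obtain U \<phi> where U: "(U, \<phi>) \<in> charts X" "U' = jet_domain X n U" "\<phi>' = jet_chart X n \<phi>"
    unfolding charts_jet by blast
  show "inj_on \<phi>' U'" unfolding U(2,3) by (rule inj_on_jet_chart[OF X U(1)])
  fix V' \<psi>' assume "(V', \<psi>') \<in> charts (jet_manifold X n)"
  then obtain V \<psi> where V: "(V, \<psi>) \<in> charts X" "V' = jet_domain X n V" "\<psi>' = jet_chart X n \<psi>"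
    unfolding charts_jet by blast
  obtain F where F: "eopen (mdim X) (\<phi> ` (U \<inter> V))" "smooth_euclidean (mdim X) (mdim X) (\<phi> ` (U \<inter> V)) F"
    "\<And>x. x \<in> U \<Longrightarrow> x \<in> V \<Longrightarrow> F (\<phi> x) = \<psi> x" using atlas_changeE[OF X U(1) V(1)] by blast
  have UV: "U' \<inter> V' = jet_domain X n (U \<inter> V)" unfolding U(2) V(2) jet_domain_def by auto
  have im: "\<phi>' ` (U' \<inter> V') = {x \<in> Eucl ((n + 1) * mdim X). trunc (mdim X) x \<in> \<phi> ` (U \<inter> V)}"
    unfolding UV U(3) by (rule jet_chart_image[OF X U(1)]) auto
  show "eopen (mdim (jet_manifold X n)) (\<phi>' ` (U' \<inter> V'))"
    unfolding im mdim_jet by (rule eopen_trunc[OF F(1)])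
  let ?G = "\<lambda>x a. if a < (n + 1) * mdim X then prol (mdim X) (a div mdim X) (\<lambda>x. F x (a mod mdim X)) x else 0"
  have "?G (\<phi>' c) = \<psi>' c" if c: "c \<in> U' \<inter> V'" for c
  proof -
    obtain p where p: "curve X p" "c = jet X n p" "p 0 \<in> U" "p 0 \<in> V"
      using c jet_domain_cases[of c X n U] unfolding U(2) V(2) by (metis IntD1 IntD2 jet_domain_jet)
    show ?thesis
      unfolding U(3) V(3) p(2) jet_chart_jet[OF U(1) p(1,3)] jet_chart_jet[OF V(1) p(1,4)]
      by (rule jet_coords_map[OF smooth_map_id[OF X] X X U(1) V(1) p(4,1,3), of F, unfolded vimage_ident, symmetric])
        (use F in auto)
  qed
  moreover have "smooth_euclidean (mdim (jet_manifold X n)) (mdim (jet_manifold X n)) (\<phi>' ` (U' \<inter> V')) ?G"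
    unfolding im mdim_jet by (rule smooth_euclidean_prol[OF F(1,2)])
  ultimately show "\<exists>F. smooth_euclidean (mdim (jet_manifold X n)) (mdim (jet_manifold X n)) (\<phi>' ` (U' \<inter> V')) F \<and>
      (\<forall>x\<in>U' \<inter> V'. F (\<phi>' x) = \<psi>' x)" by blast
qed

subsection \<open>Functoriality\<close>

text \<open>The functor of \<open>n\<close>-jets on maps, evaluated at a chosen representative;
  \<open>jet_map_jet\<close> shows independence of the choice for smooth \<open>f\<close>.\<close>

definition jet_map :: "'b manifold \<Rightarrow> nat \<Rightarrow> ('a \<Rightarrow> 'b) \<Rightarrow> (real \<Rightarrow> 'a) set \<Rightarrow> (real \<Rightarrow> 'b) set" where
  "jet_map Y n f c = jet Y n (\<lambda>t. f (representative c t))"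

lemma jet_map_jet:
  assumes f: "smooth_map X Y f" and X: "atlas X" and Y: "atlas Y" and p: "curve X p"
  shows "jet_map Y n f (jet X n p) = jet Y n (\<lambda>t. f (p t))"
proof -
  obtain U \<phi> where U: "(U, \<phi>) \<in> charts X" "p 0 \<in> U" using points_cover[OF curve_0[OF p]] .
  note r = representative_jet[OF p, of n]
  have "same_derivs Y n (\<lambda>t. f (p t)) (\<lambda>t. f (representative (jet X n p) t))"
    by (rule same_derivs_map[OF f X Y p r(1) U]) (use r U same_derivs_jet_coords[OF r(2) U] in auto)
  then show ?thesis unfolding jet_map_def
    by (rule jet_eq_iff[THEN iffD2, symmetric, OF curve_map[OF f X Y p] curve_map[OF f X Y r(1)]])
qed

text \<open>The expression in the induced charts consists of the total derivatives of the expression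
  of \<open>f\<close>.\<close>

lemma smooth_map_jet_map:
  assumes f: "smooth_map X Y f" and X: "atlas X" and Y: "atlas Y"
  shows "smooth_map (jet_manifold X n) (jet_manifold Y n) (jet_map Y n f)"
proof (rule smooth_mapI[OF atlas_jet[OF X] atlas_jet[OF Y]])
  fix c assume "c \<in> points (jet_manifold X n)"
  then have c: "c \<in> jets X n" by simp
  note r0 = curve_0[OF jets_representative(1)[OF c]]
  obtain U \<phi> where U: "(U, \<phi>) \<in> charts X" "representative c 0 \<in> U" using points_cover[OF r0] .
  obtain V \<psi> where V: "(V, \<psi>) \<in> charts Y" "f (representative c 0) \<in> V"
    using points_cover[OF smooth_map_points[OF f r0]] .
  obtain F where F: "eopen (mdim X) (\<phi> ` (U \<inter> f -` V))"
    "smooth_euclidean (mdim X) (mdim Y) (\<phi> ` (U \<inter> f -` V)) F"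
    "\<And>x. x \<in> U \<Longrightarrow> f x \<in> V \<Longrightarrow> F (\<phi> x) = \<psi> (f x)"
    using smooth_mapE[OF f X U(1) V(1)] by blast
  let ?W = "jet_domain X n (U \<inter> f -` V)"
  let ?G = "\<lambda>x a. if a < (n + 1) * mdim Y then prol (mdim X) (a div mdim Y) (\<lambda>x. F x (a mod mdim Y)) x else 0"
  have im: "jet_chart X n \<phi> ` ?W = {x \<in> Eucl ((n + 1) * mdim X). trunc (mdim X) x \<in> \<phi> ` (U \<inter> f -` V)}"
    by (rule jet_chart_image[OF X U(1)]) auto
  have key: "jet_map Y n f d \<in> jet_domain Y n V \<and> ?G (jet_chart X n \<phi> d) = jet_chart Y n \<psi> (jet_map Y n f d)"
    if d: "d \<in> ?W" for d
  proof -
    obtain p where p: "curve X p" "d = jet X n p" "p 0 \<in> U" "f (p 0) \<in> V"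
      using jet_domain_cases[OF d] by (metis IntD1 IntD2 vimageE)
    note cf = curve_map[OF f X Y p(1)]
    have "?G (jet_chart X n \<phi> d) = jet_chart Y n \<psi> (jet_map Y n f d)"
      unfolding p(2) jet_map_jet[OF f X Y p(1)] jet_chart_jet[OF U(1) p(1,3)] jet_chart_jet[where p = "\<lambda>t. f (p t)", OF V(1) cf p(4)]
      by (rule jet_coords_map[OF f X Y U(1) V(1) p(4,1,3) F, symmetric]) auto
    then show ?thesis using cf p(4) unfolding p(2) jet_map_jet[OF f X Y p(1)] by simp
  qed
  show "smooth_near (jet_manifold X n) (jet_manifold Y n) (jet_map Y n f) c"
  proof (rule smooth_nearI)
    show "(jet_domain X n U, jet_chart X n \<phi>) \<in> charts (jet_manifold X n)" by (rule charts_jetI[OF U(1)])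
    show "(jet_domain Y n V, jet_chart Y n \<psi>) \<in> charts (jet_manifold Y n)" by (rule charts_jetI[OF V(1)])
    show "c \<in> ?W" using c U(2) V(2) by (simp add: jet_domain_def)
    show "?W \<subseteq> jet_domain X n U" by (auto simp: jet_domain_def)
    show "jet_map Y n f ` ?W \<subseteq> jet_domain Y n V" using key by blast
    show "eopen (mdim (jet_manifold X n)) (jet_chart X n \<phi> ` ?W)" unfolding im mdim_jet by (rule eopen_trunc[OF F(1)])
    show "smooth_euclidean (mdim (jet_manifold X n)) (mdim (jet_manifold Y n)) (jet_chart X n \<phi> ` ?W) ?G"
      unfolding im mdim_jet by (rule smooth_euclidean_prol[OF F(1,2)])
    show "\<forall>y\<in>?W. ?G (jet_chart X n \<phi> y) = jet_chart Y n \<psi> (jet_map Y n f y)" using key by blast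
  qed
qed

lemma curve_Pair:
  assumes p: "curve X p" and q: "curve Y q"
  shows "curve (product_manifold X Y) (\<lambda>t. (p t, q t))"
proof -
  obtain U \<phi> e where U: "(U, \<phi>) \<in> charts X" "chart_curve X U \<phi> e p" using p curve_iff by blast
  obtain V \<psi> r where V: "(V, \<psi>) \<in> charts Y" "chart_curve Y V \<psi> r q" using q curve_iff by blast
  define d where "d = min e r"
  have d: "d > 0" "d \<le> e" "d \<le> r" using U(2) V(2) by (auto simp: d_def chart_curve_def)
  note p' = chart_curve_mono[OF U(2) d(1,2)] and q' = chart_curve_mono[OF V(2) d(1,3)]
  have "smooth_real {-d<..<d} (\<lambda>t. append_at (mdim X) (\<phi> (p t)) (\<psi> (q t)) i)" if "i < mdim X + mdim Y" for i
    using p' q' that unfolding chart_curve_def append_at_def by (cases "i < mdim X") auto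
  then have "chart_curve (product_manifold X Y) (U \<times> V) (\<lambda>(x, y). append_at (mdim X) (\<phi> x) (\<psi> y)) d (\<lambda>t. (p t, q t))"
    using p' q' unfolding chart_curve_def by auto
  then show ?thesis by (rule curveI[OF charts_productI[OF U(1) V(1)]])
qed

lemma same_derivs_Pair:
  assumes "same_derivs X n p p'" "same_derivs Y n q q'"
  shows "same_derivs (product_manifold X Y) n (\<lambda>t. (p t, q t)) (\<lambda>t. (p' t, q' t))"
  unfolding same_derivs_def charts_product
proof (intro conjI ballI, goal_cases)
  case 1
  then show ?case using assms by (simp add: same_derivs_def)
next
  case (2 c)
  then obtain U \<phi> V \<psi> where c: "(U, \<phi>) \<in> charts X" "(V, \<psi>) \<in> charts Y"
    "c = (U \<times> V, \<lambda>(x, y). append_at (mdim X) (\<phi> x) (\<psi> y))" by blast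
  have "(deriv ^^ k) (\<lambda>t. append_at (mdim X) (\<phi> (p t)) (\<psi> (q t)) i) 0 =
      (deriv ^^ k) (\<lambda>t. append_at (mdim X) (\<phi> (p' t)) (\<psi> (q' t)) i) 0"
    if "p 0 \<in> U" "q 0 \<in> V" "k \<le> n" "i < mdim X + mdim Y" for k i
    using assms c(1,2) that unfolding same_derivs_def append_at_def by (cases "i < mdim X") fastforce+
  then show ?case using c(3) by simp
qed

text \<open>The natural identification of a pair of jets with a jet in the product manifold. It
  allows the product of jets to be obtained by applying \<open>jet_map\<close> to the multiplication
  of the group.\<close>

definition jet_pair :: "'a manifold \<Rightarrow> 'b manifold \<Rightarrow> nat \<Rightarrow> (real \<Rightarrow> 'a) set \<Rightarrow> (real \<Rightarrow> 'b) set \<Rightarrow> (real \<Rightarrow> 'a \<times> 'b) set" where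
  "jet_pair X Y n a b = jet (product_manifold X Y) n (\<lambda>t. (representative a t, representative b t))"

lemma jet_pair_jet:
  assumes p: "curve X p" and q: "curve Y q"
  shows "jet_pair X Y n (jet X n p) (jet Y n q) = jet (product_manifold X Y) n (\<lambda>t. (p t, q t))"
  unfolding jet_pair_def
  by (rule jet_eq_iff[THEN iffD2, OF curve_Pair[OF representative_jet(1)[OF p] representative_jet(1)[OF q]] curve_Pair[OF p q]
        same_derivs_sym[OF same_derivs_Pair[OF representative_jet(2)[OF p] representative_jet(2)[OF q]]]])

lemma jet_coords_index:
  assumes "k \<le> n" "i < d" shows "jet_coords n d p t (k * d + i) = (deriv ^^ k) (\<lambda>s. p s i) t"
proof -
  have "k * d + i < (n + 1) * d"
    using mult_le_mono1[OF assms(1), of d] assms(2) unfolding add_mult_distrib by linarith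
  then show ?thesis using assms(2) by (simp add: jet_coords_def)
qed

lemma smooth_on_if:
  "smooth_on d U f \<Longrightarrow> smooth_on d U g \<Longrightarrow> smooth_on d U (\<lambda>x. if c then f x else g x)"
  by (cases c) auto

text \<open>In coordinates only a permutation: on the left all derivatives of the first curve
  precede those of the second, on the right the two are interleaved by order.\<close>

lemma smooth_map_jet_pair:
  assumes X: "atlas X" and Y: "atlas Y"
  shows "smooth_map (product_manifold (jet_manifold X n) (jet_manifold Y n)) (jet_manifold (product_manifold X Y) n)
    (\<lambda>(a, b). jet_pair X Y n a b)"
proof (rule smooth_mapI[OF atlas_product[OF atlas_jet[OF X] atlas_jet[OF Y]] atlas_jet[OF atlas_product[OF X Y]]])
  let ?P = "product_manifold (jet_manifold X n) (jet_manifold Y n)"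
  let ?N = "(n + 1) * mdim X" and ?d = "mdim X + mdim Y"
  fix z assume "z \<in> points ?P"
  then have z: "fst z \<in> jets X n" "snd z \<in> jets Y n" by auto
  obtain U \<phi> where U: "(U, \<phi>) \<in> charts X" "representative (fst z) 0 \<in> U"
    using points_cover[OF curve_0[OF jets_representative(1)[OF z(1)]]] .
  obtain V \<psi> where V: "(V, \<psi>) \<in> charts Y" "representative (snd z) 0 \<in> V"
    using points_cover[OF curve_0[OF jets_representative(1)[OF z(2)]]] .
  let ?c = "\<lambda>(x, y). append_at (mdim X) (\<phi> x) (\<psi> y)"
  let ?C = "\<lambda>(x, y). append_at ?N (jet_chart X n \<phi> x) (jet_chart Y n \<psi> y)"
  let ?D = "jet_domain X n U \<times> jet_domain Y n V"
  note c = charts_productI[OF U(1) V(1)]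
  have C: "(?D, ?C) \<in> charts ?P"
    using charts_productI[OF charts_jetI[OF U(1), of n] charts_jetI[OF V(1), of n]] by simp
  \<comment> \<open>Index \<open>a\<close> of a jet in the product splits into the order
    \<open>a div ?d\<close> of the derivative and the coordinate \<open>a mod ?d\<close>; the offset
    \<open>?N\<close> skips the coordinates of the first jet.\<close>
  let ?G = "\<lambda>z a. if a < (n + 1) * ?d then (if a mod ?d < mdim X then z (a div ?d * mdim X + a mod ?d)
      else z (a div ?d * mdim Y + (a mod ?d - mdim X) + ?N)) else (0::real)"
  have key: "jet_pair X Y n a b \<in> jet_domain (product_manifold X Y) n (U \<times> V) \<and>
      ?G (?C (a, b)) = jet_chart (product_manifold X Y) n ?c (jet_pair X Y n a b)"
    if a: "a \<in> jet_domain X n U" and b: "b \<in> jet_domain Y n V" for a b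
  proof -
    obtain p where p: "curve X p" "a = jet X n p" "p 0 \<in> U" using jet_domain_cases[OF a] by metis
    obtain q where q: "curve Y q" "b = jet Y n q" "q 0 \<in> V" using jet_domain_cases[OF b] by metis
    note pq = curve_Pair[OF p(1) q(1)]
    have pq0: "(\<lambda>t. (p t, q t)) 0 \<in> U \<times> V" using p q by simp
    have "?G (append_at ?N (jet_coords n (mdim X) (\<lambda>t. \<phi> (p t)) 0) (jet_coords n (mdim Y) (\<lambda>t. \<psi> (q t)) 0)) =
        jet_coords n ?d (\<lambda>t. append_at (mdim X) (\<phi> (p t)) (\<psi> (q t))) 0"
    proof
      fix j
      show "?G (append_at ?N (jet_coords n (mdim X) (\<lambda>t. \<phi> (p t)) 0) (jet_coords n (mdim Y) (\<lambda>t. \<psi> (q t)) 0)) j =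
        jet_coords n ?d (\<lambda>t. append_at (mdim X) (\<phi> (p t)) (\<psi> (q t))) 0 j"
      proof (cases "j < (n + 1) * ?d")
        case True
        define k i where "k = j div ?d" and "i = j mod ?d"
        have "?d > 0" using True by (intro Nat.gr0I) simp
        then have i: "i < ?d" by (simp add: i_def)
        have k: "k \<le> n" using less_mult_imp_div_less[OF True] by (simp add: k_def)
        have R: "jet_coords n ?d (\<lambda>t. append_at (mdim X) (\<phi> (p t)) (\<psi> (q t))) 0 j =
            (deriv ^^ k) (\<lambda>s. append_at (mdim X) (\<phi> (p s)) (\<psi> (q s)) i) 0"
          using True by (simp add: jet_coords_def k_def i_def)
        show ?thesis
        proof (cases "i < mdim X")
          case l: True
          have "k * mdim X + i < ?N"
            using mult_le_mono1[OF k, of "mdim X"] l unfolding add_mult_distrib by linarith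
          then have "append_at ?N u v (k * mdim X + i) = u (k * mdim X + i)" for u v
            by (simp add: append_at_def)
          then show ?thesis unfolding R using True l
            jet_coords_index[OF k l, of "\<lambda>t. \<phi> (p t)" 0]
            unfolding k_def[symmetric] i_def[symmetric] by (simp add: append_at_def[of "mdim X"])
        next
          case l: False
          then have l': "i - mdim X < mdim Y" using i by simp
          have "append_at ?N u v (k * mdim Y + (i - mdim X) + ?N) = v (k * mdim Y + (i - mdim X))" for u v
            by (simp add: append_at_def)
          then show ?thesis unfolding R using True l
            jet_coords_index[OF k l', of "\<lambda>t. \<psi> (q t)" 0]
            unfolding k_def[symmetric] i_def[symmetric] by (simp add: append_at_def[of "mdim X"])
        qed
      next
        case False
        then show ?thesis by (simp add: jet_coords_def)
      qed
    qed
    then have "?G (?C (a, b)) = jet_chart (product_manifold X Y) n ?c (jet_pair X Y n a b)"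
      unfolding p(2) q(2) jet_pair_jet[OF p(1) q(1)] jet_chart_jet[OF c pq pq0] prod.case
        jet_chart_jet[OF U(1) p(1,3)] jet_chart_jet[OF V(1) q(1,3)] mdim_product .
    then show ?thesis using p q pq unfolding p(2) q(2) jet_pair_jet[OF p(1) q(1)] by simp
  qed
  show "smooth_near ?P (jet_manifold (product_manifold X Y) n) (\<lambda>(a, b). jet_pair X Y n a b) z"
  proof (rule smooth_nearI)
    show "(?D, ?C) \<in> charts ?P" by (rule C)
    show "(jet_domain (product_manifold X Y) n (U \<times> V), jet_chart (product_manifold X Y) n ?c)
      \<in> charts (jet_manifold (product_manifold X Y) n)" by (rule charts_jetI[OF c])
    show "z \<in> ?D" using z U(2) V(2) by (simp add: jet_domain_def mem_Times_iff)
    show "?D \<subseteq> ?D" ..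
    show "(\<lambda>(a, b). jet_pair X Y n a b) ` ?D \<subseteq> jet_domain (product_manifold X Y) n (U \<times> V)" using key by auto
    show "eopen (mdim ?P) (?C ` ?D)" by (rule atlas_open[OF atlas_product[OF atlas_jet[OF X] atlas_jet[OF Y]] C])
    show "smooth_euclidean (mdim ?P) (mdim (jet_manifold (product_manifold X Y) n)) (?C ` ?D) ?G"
      unfolding smooth_euclidean_iff by (auto intro!: smooth_on_if)
    show "\<forall>y\<in>?D. ?G (?C y) = jet_chart (product_manifold X Y) n ?c ((\<lambda>(a, b). jet_pair X Y n a b) y)"
    proof
      fix y assume y: "y \<in> ?D"
      obtain a b where ab: "y = (a, b)" by (cases y)
      have "a \<in> jet_domain X n U" "b \<in> jet_domain Y n V" using y ab by auto
      from conjunct2[OF key[OF this]]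
      show "?G (?C y) = jet_chart (product_manifold X Y) n ?c ((\<lambda>(a, b). jet_pair X Y n a b) y)"
        unfolding ab prod.case .
    qed
  qed
qed

section \<open>Base points, constant jets, and the jets as a smooth manifold\<close>

lemma curve_const: "atlas X \<Longrightarrow> x \<in> points X \<Longrightarrow> curve X (\<lambda>t. x)"
proof -
  assume X: "atlas X" and x: "x \<in> points X"
  obtain U \<phi> where U: "(U, \<phi>) \<in> charts X" "x \<in> U" using points_cover[OF x] .
  show ?thesis by (rule curveI[OF U(1), of 1]) (use U(2) in \<open>simp add: chart_curve_def\<close>)
qed

lemma jet_coords_const: "u \<in> Eucl d \<Longrightarrow> jet_coords n d (\<lambda>t. u) 0 = u"
proof
  fix a assume u: "u \<in> Eucl d"
  show "jet_coords n d (\<lambda>t. u) 0 a = u a"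
  proof (cases "a < d")
    case True
    then show ?thesis by (simp add: jet_coords_def higher_deriv_const)
  next
    case False
    have "a div d > 0" if "a < (n + 1) * d"
    proof -
      have "d > 0" using that by (cases d) auto
      then show ?thesis using False by (simp add: div_greater_zero_iff)
    qed
    then show ?thesis using False u by (auto simp: jet_coords_def higher_deriv_const mem_Eucl)
  qed
qed

lemma smooth_map_jet_base:
  assumes X: "atlas X"
  shows "smooth_map (jet_manifold X n) X (\<lambda>c. representative c 0)"
proof (rule smooth_mapI[OF atlas_jet[OF X] X])
  fix c assume "c \<in> points (jet_manifold X n)"
  then have c: "c \<in> jets X n" by simp
  obtain U \<phi> where U: "(U, \<phi>) \<in> charts X" "representative c 0 \<in> U"
    using points_cover[OF curve_0[OF jets_representative(1)[OF c]]] .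
  show "smooth_near (jet_manifold X n) X (\<lambda>c. representative c 0) c"
  proof (rule smooth_nearI)
    show "(jet_domain X n U, jet_chart X n \<phi>) \<in> charts (jet_manifold X n)" by (rule charts_jetI[OF U(1)])
    then show "eopen (mdim (jet_manifold X n)) (jet_chart X n \<phi> ` jet_domain X n U)"
      by (rule atlas_open[OF atlas_jet[OF X]])
    show "\<forall>y\<in>jet_domain X n U. trunc (mdim X) (jet_chart X n \<phi> y) = \<phi> (representative y 0)"
      using trunc_jet_chart[OF X U(1)] by blast
  qed (use c U in \<open>auto simp: jet_domain_def smooth_euclidean_trunc\<close>)
qed

text \<open>The zero section of the jets: in the induced chart the coordinates are the same
  sequence, since all derivatives are zero.\<close>

lemma smooth_map_jet_const:
  assumes X: "atlas X"
  shows "smooth_map X (jet_manifold X n) (\<lambda>x. jet X n (\<lambda>t. x))"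
proof (rule smooth_mapI[OF X atlas_jet[OF X]])
  fix x assume "x \<in> points X"
  then obtain U \<phi> where U: "(U, \<phi>) \<in> charts X" "x \<in> U" using points_cover by metis
  have key: "curve X (\<lambda>t. y)" "\<phi> y = jet_chart X n \<phi> (jet X n (\<lambda>t. y))" if y: "y \<in> U" for y
  proof -
    show c: "curve X (\<lambda>t. y)" by (rule curve_const[OF X in_points[OF U(1) y]])
    show "\<phi> y = jet_chart X n \<phi> (jet X n (\<lambda>t. y))"
      unfolding jet_chart_jet[where p = "\<lambda>t. y", OF U(1) c y] by (rule jet_coords_const[OF atlas_mem[OF X U(1) y], symmetric])
  qed
  show "smooth_near X (jet_manifold X n) (\<lambda>x. jet X n (\<lambda>t. x)) x"
  proof (rule smooth_nearI)
    show "(jet_domain X n U, jet_chart X n \<phi>) \<in> charts (jet_manifold X n)" by (rule charts_jetI[OF U(1)])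
    show "smooth_euclidean (mdim X) (mdim (jet_manifold X n)) (\<phi> ` U) (\<lambda>x. x)" by (simp add: smooth_euclidean_iff)
    show "\<forall>y\<in>U. \<phi> y = jet_chart X n \<phi> (jet X n (\<lambda>t. y))" using key(2) by blast
    show "(\<lambda>x. jet X n (\<lambda>t. x)) ` U \<subseteq> jet_domain X n U" using key(1) by auto
    show "eopen (mdim X) (\<phi> ` U)" by (rule atlas_open[OF X U(1)])
  qed (use U in auto)
qed

text \<open>Jets with different base points are separated by the base point map, those with the same
  base point inside a common chart. A countable cover of \<open>X\<close> induces one of the
  jets.\<close>

lemma smooth_manifold_jet:
  assumes "smooth_manifold X" shows "smooth_manifold (jet_manifold X n)"
proof -
  note X = smooth_manifold_atlas[OF assms]
  show ?thesis
  proof (rule smooth_manifoldI[OF atlas_jet[OF X]])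
    obtain C where C: "C \<subseteq> charts X" "countable C" "points X \<subseteq> (\<Union>(U, \<phi>)\<in>C. U)"
      using smooth_manifold_countable_cover[OF assms] unfolding countable_cover_def by blast
    let ?E = "(\<lambda>(U, \<phi>). (jet_domain X n U, jet_chart X n \<phi>)) ` C"
    have "?E \<subseteq> charts (jet_manifold X n)" using C(1) by (auto intro!: charts_jetI)
    moreover have "points (jet_manifold X n) \<subseteq> (\<Union>(U, \<phi>)\<in>?E. U)"
    proof
      fix c assume "c \<in> points (jet_manifold X n)"
      then have c: "c \<in> jets X n" by simp
      have "representative c 0 \<in> points X" by (rule curve_0[OF jets_representative(1)[OF c]])
      then obtain U \<phi> where "(U, \<phi>) \<in> C" "representative c 0 \<in> U" using C(3) by auto
      then show "c \<in> (\<Union>(U, \<phi>)\<in>?E. U)" using c by (force simp: jet_domain_def)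
    qed
    ultimately show "countable_cover (jet_manifold X n)"
      unfolding countable_cover_def using C(2) by (intro exI[of _ ?E]) auto
  next
    fix c d assume cd: "c \<in> points (jet_manifold X n)" "d \<in> points (jet_manifold X n)" "c \<noteq> d"
    show "\<exists>A B. openin (manifold_topology (jet_manifold X n)) A \<and> openin (manifold_topology (jet_manifold X n)) B \<and>
        c \<in> A \<and> d \<in> B \<and> disjnt A B"
    proof (cases "representative c 0 = representative d 0")
      case True
      have c: "c \<in> jets X n" using cd(1) by simp
      obtain U \<phi> where U: "(U, \<phi>) \<in> charts X" "representative c 0 \<in> U"
        using points_cover[OF curve_0[OF jets_representative(1)[OF c]]] .
      show ?thesis
        by (rule separated_in_chart[OF atlas_jet[OF X] charts_jetI[OF U(1)] _ _ cd(3)])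
          (use cd U True in \<open>auto simp: jet_domain_def\<close>)
    next
      case False
      show ?thesis
        by (rule separated_by_map[OF smooth_map_jet_base[OF X] atlas_jet[OF X] X smooth_manifold_Hausdorff[OF assms] cd(1,2) False])
    qed
  qed
qed

section \<open>Lie groups\<close>

lemma lie_group_group: "lie_group G \<Longrightarrow> group G"
  and lie_group_manifold: "lie_group G \<Longrightarrow> smooth_manifold (mfd G)"
  and lie_group_points: "lie_group G \<Longrightarrow> points (mfd G) = carrier G"
  and lie_group_mult: "lie_group G \<Longrightarrow> smooth_map (product_manifold (mfd G) (mfd G)) (mfd G) (\<lambda>(x, y). x \<otimes>\<^bsub>G\<^esub> y)"
  and lie_group_inv: "lie_group G \<Longrightarrow> smooth_map (mfd G) (mfd G) (\<lambda>x. inv\<^bsub>G\<^esub> x)"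
  by (auto simp: lie_group_def)

lemma lie_group_atlas: "lie_group G \<Longrightarrow> atlas (mfd G)"
  by (rule smooth_manifold_atlas[OF lie_group_manifold])

lemma smooth_map_mult:
  assumes "lie_group G" "atlas X" "smooth_map X (mfd G) f" "smooth_map X (mfd G) g"
  shows "smooth_map X (mfd G) (\<lambda>x. f x \<otimes>\<^bsub>G\<^esub> g x)"
proof -
  note at = lie_group_atlas[OF assms(1)]
  from smooth_map_comp[OF smooth_map_Pair[OF assms(3,4,2) at at] lie_group_mult[OF assms(1)] assms(2) atlas_product[OF at at] at]
  show ?thesis by simp
qed

lemma smooth_map_inv:
  assumes "lie_group G" "atlas X" "smooth_map X (mfd G) f"
  shows "smooth_map X (mfd G) (\<lambda>x. inv\<^bsub>G\<^esub> (f x))"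
  using smooth_map_comp[OF assms(3) lie_group_inv[OF assms(1)] assms(2)] lie_group_atlas[OF assms(1)] by blast

subsection \<open>Higher order tangent groups\<close>

lemma tangent_group_simps [simp]:
  "carrier (tangent_group n G) = jets (mfd G) n"
  "\<one>\<^bsub>tangent_group n G\<^esub> = jet (mfd G) n (\<lambda>t. \<one>\<^bsub>G\<^esub>)"
  "mfd (tangent_group n G) = jet_manifold (mfd G) n"
  by (simp_all add: tangent_group_def)

context
  fixes G :: "'g lie"
  assumes G: "lie_group G"
begin

lemma curve_mult:
  assumes "curve (mfd G) p" "curve (mfd G) q"
  shows "curve (mfd G) (\<lambda>t. p t \<otimes>\<^bsub>G\<^esub> q t)"
  using curve_map[OF lie_group_mult[OF G] atlas_product[OF lie_group_atlas[OF G] lie_group_atlas[OF G]] lie_group_atlas[OF G]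
      curve_Pair[OF assms]] by simp

lemma curve_inv: "curve (mfd G) p \<Longrightarrow> curve (mfd G) (\<lambda>t. inv\<^bsub>G\<^esub> (p t))"
  by (rule curve_map[OF lie_group_inv[OF G] lie_group_atlas[OF G] lie_group_atlas[OF G]])

lemma curve_one: "curve (mfd G) (\<lambda>t. \<one>\<^bsub>G\<^esub>)"
  by (rule curve_const[OF lie_group_atlas[OF G]])
    (simp add: lie_group_points[OF G] group.is_monoid[OF lie_group_group[OF G]] monoid.one_closed)

text \<open>Writes the product as a function of the two classes. Both well-definedness and
  smoothness of the multiplication of jets rest on this form.\<close>

lemma jet_mult_pair:
  assumes "curve (mfd G) p" "curve (mfd G) q"
  shows "jet (mfd G) n (\<lambda>t. p t \<otimes>\<^bsub>G\<^esub> q t) =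
    jet_map (mfd G) n (\<lambda>(x, y). x \<otimes>\<^bsub>G\<^esub> y) (jet_pair (mfd G) (mfd G) n (jet (mfd G) n p) (jet (mfd G) n q))"
  unfolding jet_pair_jet[OF assms]
    jet_map_jet[OF lie_group_mult[OF G] atlas_product[OF lie_group_atlas[OF G] lie_group_atlas[OF G]] lie_group_atlas[OF G] curve_Pair[OF assms]]
  by simp

text \<open>The union in \<open>tangent_group\<close> consists of copies of one jet, since by
  \<open>jet_mult_pair\<close> that jet depends on the two classes only, and it is not
  empty.\<close>

lemma tangent_mult:
  assumes p: "curve (mfd G) p" and q: "curve (mfd G) q"
  shows "jet (mfd G) n p \<otimes>\<^bsub>tangent_group n G\<^esub> jet (mfd G) n q = jet (mfd G) n (\<lambda>t. p t \<otimes>\<^bsub>G\<^esub> q t)"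
proof -
  let ?J = "jet (mfd G) n"
  have eq: "?J (\<lambda>t. p' t \<otimes>\<^bsub>G\<^esub> q' t) = ?J (\<lambda>t. p t \<otimes>\<^bsub>G\<^esub> q t)" if "p' \<in> ?J p" "q' \<in> ?J q" for p' q'
  proof -
    have c: "curve (mfd G) p'" "curve (mfd G) q'" using that by (auto simp: jet_def)
    have "same_derivs (mfd G) n p p'" "same_derivs (mfd G) n q q'" using that by (auto simp: jet_def)
    then have "?J p' = ?J p" "?J q' = ?J q"
      unfolding jet_eq_iff[OF c(1) p] jet_eq_iff[OF c(2) q] by (auto intro: same_derivs_sym)
    then show ?thesis unfolding jet_mult_pair[OF c] jet_mult_pair[OF p q] by simp
  qed
  have "p \<in> ?J p" "q \<in> ?J q" using p q same_derivs_refl by (auto simp: jet_def)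
  then have ne: "?J p \<noteq> {}" "?J q \<noteq> {}" by auto
  have "?J p \<otimes>\<^bsub>tangent_group n G\<^esub> ?J q = (\<Union>p'\<in>?J p. \<Union>q'\<in>?J q. ?J (\<lambda>t. p' t \<otimes>\<^bsub>G\<^esub> q' t))"
    by (simp add: tangent_group_def)
  also have "\<dots> = (\<Union>p'\<in>?J p. \<Union>q'\<in>?J q. ?J (\<lambda>t. p t \<otimes>\<^bsub>G\<^esub> q t))"
    by (intro SUP_cong refl eq)
  also have "\<dots> = ?J (\<lambda>t. p t \<otimes>\<^bsub>G\<^esub> q t)" unfolding UN_constant by (simp add: ne)
  finally show ?thesis .
qed

text \<open>The laws hold pointwise for curves with all their values in the group, and
  \<open>jets_cases\<close> supplies such representatives.\<close>

lemma tangent_group_group: "group (tangent_group n G)"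
proof (rule groupI)
  interpret group G by (rule lie_group_group[OF G])
  let ?T = "tangent_group n G"
  note [simp] = lie_group_points[OF G]
  show "\<one>\<^bsub>?T\<^esub> \<in> carrier ?T" using curve_one by (simp add: jet_in_jets)
  fix a assume "a \<in> carrier ?T"
  then obtain p where p: "curve (mfd G) p" "\<And>t. p t \<in> carrier G" "a = jet (mfd G) n p"
    using jets_cases[of a "mfd G" n] by auto
  show "\<one>\<^bsub>?T\<^esub> \<otimes>\<^bsub>?T\<^esub> a = a" using p(2) by (simp add: p(3) tangent_mult[OF curve_one p(1)])
  have "jet (mfd G) n (\<lambda>t. inv\<^bsub>G\<^esub> (p t)) \<otimes>\<^bsub>?T\<^esub> a = \<one>\<^bsub>?T\<^esub>"
    using p(2) by (simp add: p(3) tangent_mult[OF curve_inv[OF p(1)] p(1)])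
  then show "\<exists>b\<in>carrier ?T. b \<otimes>\<^bsub>?T\<^esub> a = \<one>\<^bsub>?T\<^esub>" using jet_in_jets[OF curve_inv[OF p(1)]] by auto
  fix b assume "b \<in> carrier ?T"
  then obtain q where q: "curve (mfd G) q" "\<And>t. q t \<in> carrier G" "b = jet (mfd G) n q"
    using jets_cases[of b "mfd G" n] by auto
  show "a \<otimes>\<^bsub>?T\<^esub> b \<in> carrier ?T" using curve_mult[OF p(1) q(1)] by (simp add: p(3) q(3) tangent_mult[OF p(1) q(1)] jet_in_jets)
  fix c assume "c \<in> carrier ?T"
  then obtain r where r: "curve (mfd G) r" "\<And>t. r t \<in> carrier G" "c = jet (mfd G) n r"
    using jets_cases[of c "mfd G" n] by auto
  show "a \<otimes>\<^bsub>?T\<^esub> b \<otimes>\<^bsub>?T\<^esub> c = a \<otimes>\<^bsub>?T\<^esub> (b \<otimes>\<^bsub>?T\<^esub> c)"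
    using p(2) q(2) r(2)
    by (simp add: p(3) q(3) r(3) tangent_mult[OF p(1) q(1)] tangent_mult[OF q(1) r(1)]
        tangent_mult[OF curve_mult[OF p(1) q(1)] r(1)] tangent_mult[OF p(1) curve_mult[OF q(1) r(1)]] m_assoc)
qed

text \<open>The given \<open>p\<close> may leave the group away from 0, so the cancellation is
  carried out for a representative \<open>q\<close> that does not, and \<open>jet_map\<close> of the
  inversion carries the result back to \<open>p\<close>.\<close>

lemma tangent_inv:
  assumes "curve (mfd G) p"
  shows "inv\<^bsub>tangent_group n G\<^esub> (jet (mfd G) n p) = jet (mfd G) n (\<lambda>t. inv\<^bsub>G\<^esub> (p t))"
proof -
  interpret group G by (rule lie_group_group[OF G])
  let ?T = "tangent_group n G"
  interpret T: group ?T by (rule tangent_group_group)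
  note [simp] = lie_group_points[OF G]
  obtain q where q: "curve (mfd G) q" "\<And>t. q t \<in> carrier G" "jet (mfd G) n p = jet (mfd G) n q"
    using jets_cases[OF jet_in_jets[OF assms, of n]] by auto
  have "inv\<^bsub>?T\<^esub> (jet (mfd G) n q) = jet (mfd G) n (\<lambda>t. inv\<^bsub>G\<^esub> (q t))"
  proof (rule T.inv_equality)
    show "jet (mfd G) n (\<lambda>t. inv\<^bsub>G\<^esub> (q t)) \<otimes>\<^bsub>?T\<^esub> jet (mfd G) n q = \<one>\<^bsub>?T\<^esub>"
      using q(2) by (simp add: tangent_mult[OF curve_inv[OF q(1)] q(1)])
  qed (use jet_in_jets[OF q(1)] jet_in_jets[OF curve_inv[OF q(1)]] in auto)
  moreover have "jet (mfd G) n (\<lambda>t. inv\<^bsub>G\<^esub> (r t)) = jet_map (mfd G) n (\<lambda>x. inv\<^bsub>G\<^esub> x) (jet (mfd G) n r)"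
    if "curve (mfd G) r" for r
    using jet_map_jet[OF lie_group_inv[OF G] lie_group_atlas[OF G] lie_group_atlas[OF G] that] by simp
  ultimately show ?thesis using q(1,3) assms by simp
qed

lemma lie_group_tangent: "lie_group (tangent_group n G)"
proof -
  note at = lie_group_atlas[OF G]
  let ?J = "jet_manifold (mfd G) n"
  have J: "atlas ?J" by (rule atlas_jet[OF at])
  have m: "smooth_map (product_manifold ?J ?J) ?J (\<lambda>(x, y). x \<otimes>\<^bsub>tangent_group n G\<^esub> y)"
  proof (rule smooth_map_cong)
    show "smooth_map (product_manifold ?J ?J) ?J (\<lambda>z. jet_map (mfd G) n (\<lambda>(x, y). x \<otimes>\<^bsub>G\<^esub> y)
        ((\<lambda>(a, b). jet_pair (mfd G) (mfd G) n a b) z))"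
      by (rule smooth_map_comp[OF smooth_map_jet_pair[OF at at] smooth_map_jet_map[OF lie_group_mult[OF G] atlas_product[OF at at] at]])
        (intro atlas_product J atlas_jet at)+
    fix z assume "z \<in> points (product_manifold ?J ?J)"
    then have "fst z \<in> jets (mfd G) n" "snd z \<in> jets (mfd G) n" by auto
    then obtain p q where "curve (mfd G) p" "fst z = jet (mfd G) n p" "curve (mfd G) q" "snd z = jet (mfd G) n q"
      by (metis jets_cases)
    then show "jet_map (mfd G) n (\<lambda>(x, y). x \<otimes>\<^bsub>G\<^esub> y) ((\<lambda>(a, b). jet_pair (mfd G) (mfd G) n a b) z) =
        (\<lambda>(x, y). x \<otimes>\<^bsub>tangent_group n G\<^esub> y) z"
      by (simp add: split_beta tangent_mult jet_mult_pair[symmetric])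
  qed (intro atlas_product J)+
  have i: "smooth_map ?J ?J (\<lambda>x. inv\<^bsub>tangent_group n G\<^esub> x)"
  proof (rule smooth_map_cong)
    show "smooth_map ?J ?J (jet_map (mfd G) n (\<lambda>x. inv\<^bsub>G\<^esub> x))"
      by (rule smooth_map_jet_map[OF lie_group_inv[OF G] at at])
    fix z assume "z \<in> points ?J"
    then have "z \<in> jets (mfd G) n" by simp
    then obtain p where p: "curve (mfd G) p" "z = jet (mfd G) n p" by (metis jets_cases)
    show "jet_map (mfd G) n (\<lambda>x. inv\<^bsub>G\<^esub> x) z = inv\<^bsub>tangent_group n G\<^esub> z"
      unfolding p(2) tangent_inv[OF p(1)] by (rule jet_map_jet[OF lie_group_inv[OF G] at at p(1)])
  qed (rule J)+
  show ?thesis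
    unfolding lie_group_def
    using tangent_group_group smooth_manifold_jet[OF lie_group_manifold[OF G]] m i by simp
qed

end

lemma jet_map_hom:
  assumes G: "lie_group G" and H: "lie_group H" and f: "f \<in> hom G H" "smooth_map (mfd G) (mfd H) f"
  shows "jet_map (mfd H) n f \<in> hom (tangent_group n G) (tangent_group n H)"
proof (rule homI)
  note at = lie_group_atlas[OF G] lie_group_atlas[OF H]
  note cm = curve_map[OF f(2) at] and jm = jet_map_jet[OF f(2) at]
  fix a assume "a \<in> carrier (tangent_group n G)"
  then obtain p where p: "curve (mfd G) p" "\<And>t. p t \<in> carrier G" "a = jet (mfd G) n p"
    using jets_cases[of a "mfd G" n] lie_group_points[OF G] by auto
  show "jet_map (mfd H) n f a \<in> carrier (tangent_group n H)" using p(1) by (simp add: p(3) jm cm jet_in_jets)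
  fix b assume "b \<in> carrier (tangent_group n G)"
  then obtain q where q: "curve (mfd G) q" "\<And>t. q t \<in> carrier G" "b = jet (mfd G) n q"
    using jets_cases[of b "mfd G" n] lie_group_points[OF G] by auto
  show "jet_map (mfd H) n f (a \<otimes>\<^bsub>tangent_group n G\<^esub> b) =
      jet_map (mfd H) n f a \<otimes>\<^bsub>tangent_group n H\<^esub> jet_map (mfd H) n f b"
    unfolding p(3) q(3) tangent_mult[OF G p(1) q(1)] jm[OF p(1)] jm[OF q(1)] jm[OF curve_mult[OF G p(1) q(1)]]
      tangent_mult[OF H cm[OF p(1)] cm[OF q(1)]]
    using p(2) q(2) hom_mult[OF f(1)] by simp
qed

subsection \<open>Transport of Lie groups\<close>

lemma transport_lie_simps [simp]:
  "carrier (transport_lie f G) = f ` carrier G"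
  "\<one>\<^bsub>transport_lie f G\<^esub> = f \<one>\<^bsub>G\<^esub>"
  "mfd (transport_lie f G) = transport_manifold (carrier G) f (mfd G)"
  by (simp_all add: transport_lie_def transport_manifold_def)

lemma transport_lie_mult:
  assumes "inj_on f (carrier G)" "x \<in> carrier G" "y \<in> carrier G"
  shows "f x \<otimes>\<^bsub>transport_lie f G\<^esub> f y = f (x \<otimes>\<^bsub>G\<^esub> y)"
  using assms by (simp add: transport_lie_def inv_into_f_f)

lemma lie_group_transport:
  assumes G: "lie_group G" and inj: "inj_on f (carrier G)"
  shows "lie_group (transport_lie f G)"
proof -
  interpret group G by (rule lie_group_group[OF G])
  let ?T = "transport_lie f G" and ?X = "transport_manifold (carrier G) f (mfd G)" and ?g = "inv_into (carrier G) f"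
  note at = lie_group_atlas[OF G] and pts = lie_group_points[OF G, symmetric]
  note tr = atlas_transport[OF inj pts at] smooth_map_transport[OF inj pts at] smooth_map_transport_inv[OF inj pts at]
    transport_points[OF inj pts at]
  note mult = transport_lie_mult[OF inj]
  have gT: "group ?T"
  proof (rule groupI)
    fix x y assume "x \<in> carrier ?T" "y \<in> carrier ?T"
    then show "x \<otimes>\<^bsub>?T\<^esub> y \<in> carrier ?T" using mult by auto
  next
    fix x y z assume "x \<in> carrier ?T" "y \<in> carrier ?T" "z \<in> carrier ?T"
    then show "x \<otimes>\<^bsub>?T\<^esub> y \<otimes>\<^bsub>?T\<^esub> z = x \<otimes>\<^bsub>?T\<^esub> (y \<otimes>\<^bsub>?T\<^esub> z)" using mult by (auto simp: m_assoc)
  next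
    fix x assume "x \<in> carrier ?T"
    then obtain a where a: "a \<in> carrier G" "x = f a" by auto
    then show "\<one>\<^bsub>?T\<^esub> \<otimes>\<^bsub>?T\<^esub> x = x" using mult by simp
    have "f (inv\<^bsub>G\<^esub> a) \<otimes>\<^bsub>?T\<^esub> x = \<one>\<^bsub>?T\<^esub>" using a mult by simp
    moreover have "f (inv\<^bsub>G\<^esub> a) \<in> carrier ?T" using a by simp
    ultimately show "\<exists>y\<in>carrier ?T. y \<otimes>\<^bsub>?T\<^esub> x = \<one>\<^bsub>?T\<^esub>" by blast
  qed simp
  have "smooth_map (product_manifold ?X ?X) ?X (\<lambda>z. f (?g (fst z) \<otimes>\<^bsub>G\<^esub> ?g (snd z)))"
    by (rule smooth_map_comp[OF smooth_map_mult[OF G _ smooth_map_comp[OF smooth_map_fst tr(3)] smooth_map_comp[OF smooth_map_snd tr(3)]] tr(2)])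
      (intro atlas_product tr at)+
  then have m: "smooth_map (product_manifold ?X ?X) ?X (\<lambda>(x, y). x \<otimes>\<^bsub>?T\<^esub> y)"
    by (simp add: transport_lie_def case_prod_unfold)
  have i: "smooth_map ?X ?X (\<lambda>x. inv\<^bsub>?T\<^esub> x)"
  proof (rule smooth_map_cong)
    show "smooth_map ?X ?X (\<lambda>x. f (inv\<^bsub>G\<^esub> (?g x)))"
      by (rule smooth_map_comp[OF smooth_map_inv[OF G _ tr(3)] tr(2)]) (intro tr at)+
    fix x assume "x \<in> points ?X"
    then obtain a where a: "a \<in> carrier G" "x = f a" unfolding tr(4) by auto
    have "inv\<^bsub>?T\<^esub> (f a) = f (inv\<^bsub>G\<^esub> a)"
      by (rule group.inv_equality[OF gT]) (use a mult in auto)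
    then show "f (inv\<^bsub>G\<^esub> (?g x)) = inv\<^bsub>?T\<^esub> x" using a inj by (simp add: inv_into_f_f)
  qed (rule tr(1))+
  show ?thesis
    unfolding lie_group_def
    using gT m i smooth_manifold_transport[OF inj pts at lie_group_manifold[OF G]] tr(4) by simp
qed

subsection \<open>Complemented subgroups\<close>

text \<open>\<open>\<theta>\<close> inverts the map that sends \<open>(x, h)\<close> to the product
  of \<open>s x\<close> and \<open>\<iota> h\<close>, so \<open>K\<close> is diffeomorphic to the
  product of a Euclidean space and \<open>H\<close>. Coordinates instead of an abstract manifold
  make the dimensions of successive complements add up. The section is not normalized at any point;
  \<open>complemented_matched_pair\<close> takes care of that.\<close>

definition complement :: "nat \<Rightarrow> 'h lie \<Rightarrow> 'k lie \<Rightarrow> ('h \<Rightarrow> 'k) \<Rightarrow> ((nat \<Rightarrow> real) \<Rightarrow> 'k) \<Rightarrow>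
    ('k \<Rightarrow> (nat \<Rightarrow> real) \<times> 'h) \<Rightarrow> bool" where
  "complement m H K \<iota> s \<theta> \<longleftrightarrow> \<iota> \<in> hom H K \<and> smooth_map (mfd H) (mfd K) \<iota> \<and> smooth_map (eucl m) (mfd K) s \<and>
    smooth_map (mfd K) (product_manifold (eucl m) (mfd H)) \<theta> \<and>
    (\<forall>x\<in>Eucl m. \<forall>h\<in>carrier H. \<theta> (s x \<otimes>\<^bsub>K\<^esub> \<iota> h) = (x, h)) \<and>
    (\<forall>k\<in>carrier K. s (fst (\<theta> k)) \<otimes>\<^bsub>K\<^esub> \<iota> (snd (\<theta> k)) = k)"

definition complemented :: "nat \<Rightarrow> 'h lie \<Rightarrow> 'k lie \<Rightarrow> bool" where
  "complemented m H K \<longleftrightarrow> (\<exists>\<iota> s \<theta>. complement m H K \<iota> s \<theta>)"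

context
  fixes m :: nat and H :: "'h lie" and K :: "'k lie" and \<iota> s \<theta>
  assumes H: "lie_group H" and K: "lie_group K" and c: "complement m H K \<iota> s \<theta>"
begin

lemma complement_hom: "\<iota> \<in> hom H K"
  and complement_embedding: "smooth_map (mfd H) (mfd K) \<iota>"
  and complement_section: "smooth_map (eucl m) (mfd K) s"
  and complement_smooth: "smooth_map (mfd K) (product_manifold (eucl m) (mfd H)) \<theta>"
  and complement_eq: "x \<in> Eucl m \<Longrightarrow> h \<in> carrier H \<Longrightarrow> \<theta> (s x \<otimes>\<^bsub>K\<^esub> \<iota> h) = (x, h)"
  and complement_split: "k \<in> carrier K \<Longrightarrow> s (fst (\<theta> k)) \<otimes>\<^bsub>K\<^esub> \<iota> (snd (\<theta> k)) = k"
  using c by (auto simp: complement_def)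

lemma complement_closed:
  "h \<in> carrier H \<Longrightarrow> \<iota> h \<in> carrier K"
  "x \<in> Eucl m \<Longrightarrow> s x \<in> carrier K"
  "k \<in> carrier K \<Longrightarrow> fst (\<theta> k) \<in> Eucl m"
  "k \<in> carrier K \<Longrightarrow> snd (\<theta> k) \<in> carrier H"
  using smooth_map_points[OF complement_embedding] smooth_map_points[OF complement_section]
    smooth_map_points[OF complement_smooth] lie_group_points[OF H] lie_group_points[OF K]
  by (auto simp: mem_Times_iff)

lemma complement_fst: "smooth_map (mfd K) (eucl m) (\<lambda>k. fst (\<theta> k))"
  and complement_snd: "smooth_map (mfd K) (mfd H) (\<lambda>k. snd (\<theta> k))"
  by (rule smooth_map_comp[OF complement_smooth smooth_map_fst] smooth_map_comp[OF complement_smooth smooth_map_snd];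
      intro atlas_product atlas_eucl lie_group_atlas H K)+

end

text \<open>Substituting the factorization in \<open>K\<close> into the one in \<open>L\<close>
  writes every element of \<open>L\<close> as the product of \<open>s2 x\<close>,
  \<open>\<iota>2 (s1 y)\<close> and \<open>\<iota>2 (\<iota>1 h)\<close>; the first two factors
  form the new section.\<close>

lemma complemented_trans:
  assumes H: "lie_group H" and K: "lie_group K" and L: "lie_group L"
    and c1: "complemented m1 H K" and c2: "complemented m2 K L"
  shows "complemented (m2 + m1) H L"
proof -
  obtain \<iota>1 s1 \<theta>1 where 1: "complement m1 H K \<iota>1 s1 \<theta>1" using c1 complemented_def by blast
  obtain \<iota>2 s2 \<theta>2 where 2: "complement m2 K L \<iota>2 s2 \<theta>2" using c2 complemented_def by blast
  note at = lie_group_atlas[OF H] lie_group_atlas[OF K] lie_group_atlas[OF L]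
  interpret L: group L by (rule lie_group_group[OF L])
  define s where "s z = s2 (trunc m2 z) \<otimes>\<^bsub>L\<^esub> \<iota>2 (s1 (shift m2 z))" for z
  define \<theta> where "\<theta> l = (append_at m2 (fst (\<theta>2 l)) (fst (\<theta>1 (snd (\<theta>2 l)))), snd (\<theta>1 (snd (\<theta>2 l))))" for l
  note cl1 = complement_closed[OF H K 1] and cl2 = complement_closed[OF K L 2]
  have "complement (m2 + m1) H L (\<lambda>h. \<iota>2 (\<iota>1 h)) s \<theta>"
    unfolding complement_def
  proof (intro conjI ballI)
    show "(\<lambda>h. \<iota>2 (\<iota>1 h)) \<in> hom H L"
      using hom_compose[OF complement_hom[OF H K 1] complement_hom[OF K L 2]] by (simp add: comp_def)
    show "smooth_map (mfd H) (mfd L) (\<lambda>h. \<iota>2 (\<iota>1 h))"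
      by (rule smooth_map_comp[OF complement_embedding[OF H K 1] complement_embedding[OF K L 2] at])
    show "smooth_map (eucl (m2 + m1)) (mfd L) s"
      unfolding s_def
    proof (rule smooth_map_mult[OF L atlas_eucl])
      show "smooth_map (eucl (m2 + m1)) (mfd L) (\<lambda>z. s2 (trunc m2 z))"
        by (rule smooth_map_comp[OF smooth_map_eucl complement_section[OF K L 2] atlas_eucl atlas_eucl at(3)])
          (auto intro: smooth_euclidean_trunc)
      show "smooth_map (eucl (m2 + m1)) (mfd L) (\<lambda>z. \<iota>2 (s1 (shift m2 z)))"
        by (rule smooth_map_comp[OF smooth_map_comp[OF smooth_map_eucl complement_section[OF H K 1] atlas_eucl atlas_eucl at(2)]
              complement_embedding[OF K L 2] atlas_eucl at(2,3)]) auto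
    qed
    have a: "smooth_map (mfd L) (eucl m2) (\<lambda>l. fst (\<theta>2 l))" by (rule complement_fst[OF K L 2])
    have b: "smooth_map (mfd L) (eucl m1) (\<lambda>l. fst (\<theta>1 (snd (\<theta>2 l))))"
      by (rule smooth_map_comp[OF complement_snd[OF K L 2] complement_fst[OF H K 1] at(3,2) atlas_eucl])
    have d: "smooth_map (mfd L) (mfd H) (\<lambda>l. snd (\<theta>1 (snd (\<theta>2 l))))"
      by (rule smooth_map_comp[OF complement_snd[OF K L 2] complement_snd[OF H K 1] at(3,2,1)])
    have "smooth_map (mfd L) (eucl (m2 + m1)) (\<lambda>l. append_at m2 (fst (\<theta>2 l)) (fst (\<theta>1 (snd (\<theta>2 l)))))"
      using smooth_map_comp[OF smooth_map_Pair[OF a b at(3) atlas_eucl atlas_eucl] smooth_map_append at(3)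
          atlas_product[OF atlas_eucl atlas_eucl] atlas_eucl] by simp
    from smooth_map_Pair[OF this d at(3) atlas_eucl at(1)]
    show "smooth_map (mfd L) (product_manifold (eucl (m2 + m1)) (mfd H)) \<theta>" unfolding \<theta>_def[abs_def] .
    have hm: "\<iota>2 (x \<otimes>\<^bsub>K\<^esub> y) = \<iota>2 x \<otimes>\<^bsub>L\<^esub> \<iota>2 y" if "x \<in> carrier K" "y \<in> carrier K" for x y
      using hom_mult[OF complement_hom[OF K L 2] that] .
    interpret K: group K by (rule lie_group_group[OF K])
    show "\<theta> (s x \<otimes>\<^bsub>L\<^esub> \<iota>2 (\<iota>1 h)) = (x, h)" if x: "x \<in> Eucl (m2 + m1)" and h: "h \<in> carrier H" for x h
    proof -
      have x1: "shift m2 x \<in> Eucl m1" using x by simp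
      have "s x \<otimes>\<^bsub>L\<^esub> \<iota>2 (\<iota>1 h) = s2 (trunc m2 x) \<otimes>\<^bsub>L\<^esub> \<iota>2 (s1 (shift m2 x) \<otimes>\<^bsub>K\<^esub> \<iota>1 h)"
        unfolding s_def using cl1 cl2 x1 h by (simp add: hm L.m_assoc)
      moreover have "s1 (shift m2 x) \<otimes>\<^bsub>K\<^esub> \<iota>1 h \<in> carrier K" using cl1 x1 h by simp
      ultimately have "\<theta>2 (s x \<otimes>\<^bsub>L\<^esub> \<iota>2 (\<iota>1 h)) = (trunc m2 x, s1 (shift m2 x) \<otimes>\<^bsub>K\<^esub> \<iota>1 h)"
        using complement_eq[OF K L 2 trunc_mem] by simp
      then show ?thesis unfolding \<theta>_def using complement_eq[OF H K 1 x1 h] by simp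
    qed
    show "s (fst (\<theta> l)) \<otimes>\<^bsub>L\<^esub> \<iota>2 (\<iota>1 (snd (\<theta> l))) = l" if l: "l \<in> carrier L" for l
    proof -
      define k where "k = snd (\<theta>2 l)"
      have k: "k \<in> carrier K" using cl2(4)[OF l] by (simp add: k_def)
      have "s (fst (\<theta> l)) \<otimes>\<^bsub>L\<^esub> \<iota>2 (\<iota>1 (snd (\<theta> l))) =
          s2 (fst (\<theta>2 l)) \<otimes>\<^bsub>L\<^esub> \<iota>2 (s1 (fst (\<theta>1 k)) \<otimes>\<^bsub>K\<^esub> \<iota>1 (snd (\<theta>1 k)))"
        unfolding s_def \<theta>_def fst_conv snd_conv k_def[symmetric]
        using cl1 cl2 k l by (simp add: hm L.m_assoc)
      then show ?thesis using complement_split[OF H K 1 k] complement_split[OF K L 2 l] by (simp add: k_def)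
    qed
  qed
  then show ?thesis unfolding complemented_def by blast
qed

text \<open>An isomorphism has the trivial complement, of dimension 0. Through
  \<open>complemented_trans\<close> this replaces a group by an isomorphic one without changing
  dimensions.\<close>

lemma complemented_iso:
  assumes H: "lie_group H" and K: "lie_group K" and f: "f \<in> hom H K" "smooth_map (mfd H) (mfd K) f"
    and g: "smooth_map (mfd K) (mfd H) g" "\<And>h. h \<in> carrier H \<Longrightarrow> g (f h) = h" "\<And>k. k \<in> carrier K \<Longrightarrow> f (g k) = k"
  shows "complemented 0 H K"
proof -
  note at = lie_group_atlas[OF H] lie_group_atlas[OF K]
  interpret K: group K by (rule lie_group_group[OF K])
  \<comment> \<open>\<open>Eucl 0\<close> is a single point, so there is only one possible first
    component.\<close>
  have E: "x = (\<lambda>i. 0)" if "x \<in> Eucl 0" for x using that by (auto simp: mem_Eucl)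
  have "complement 0 H K f (\<lambda>x. \<one>\<^bsub>K\<^esub>) (\<lambda>k. (\<lambda>i. 0, g k))"
    unfolding complement_def
  proof (intro conjI ballI f)
    show "smooth_map (eucl 0) (mfd K) (\<lambda>x. \<one>\<^bsub>K\<^esub>)"
      by (rule smooth_map_const[OF atlas_eucl at(2)]) (simp add: lie_group_points[OF K])
    show "smooth_map (mfd K) (product_manifold (eucl 0) (mfd H)) (\<lambda>k. (\<lambda>i. 0, g k))"
      by (rule smooth_map_Pair[OF smooth_map_const[OF at(2) atlas_eucl] g(1) at(2) atlas_eucl at(1)]) (simp add: mem_Eucl)
    fix h x assume "x \<in> Eucl 0" "h \<in> carrier H"
    then show "(\<lambda>i. 0, g (\<one>\<^bsub>K\<^esub> \<otimes>\<^bsub>K\<^esub> f h)) = (x, h)"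
      using g(2) hom_in_carrier[OF f(1)] E by simp
  next
    fix k assume k: "k \<in> carrier K"
    then have "f (g k) = k" using g(3) by simp
    then show "\<one>\<^bsub>K\<^esub> \<otimes>\<^bsub>K\<^esub> f (snd (\<lambda>i. 0, g k)) = k" using k by simp
  qed
  then show ?thesis unfolding complemented_def by blast
qed

lemma complemented_transport:
  assumes G: "lie_group G" and inj: "inj_on f (carrier G)"
  shows "complemented 0 G (transport_lie f G)"
proof -
  note at = lie_group_atlas[OF G] and pts = lie_group_points[OF G, symmetric]
  show ?thesis
  proof (rule complemented_iso[OF G lie_group_transport[OF G inj]])
    show "f \<in> hom G (transport_lie f G)" using transport_lie_mult[OF inj] by (auto intro!: homI)
    show "smooth_map (mfd G) (mfd (transport_lie f G)) f"
      using smooth_map_transport[OF inj pts at] by simp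
    show "smooth_map (mfd (transport_lie f G)) (mfd G) (inv_into (carrier G) f)"
      using smooth_map_transport_inv[OF inj pts at] by simp
  qed (use inj in \<open>auto simp: inv_into_f_f\<close>)
qed

text \<open>Embedding, section and both components of \<open>\<theta>\<close> are smooth, and jets
  are multiplied representative by representative, so the tangent functor carries the whole
  factorization over. The 1-jets of \<open>R^m\<close> have a global chart, which turns them into
  \<open>R^(2m)\<close>.\<close>

lemma complemented_tangent:
  assumes H: "lie_group H" and K: "lie_group K" and "complemented m H K"
  shows "complemented (2 * m) (tangent_group 1 H) (tangent_group 1 K)"
proof -
  obtain \<iota> s \<theta> where c: "complement m H K \<iota> s \<theta>" using assms(3) complemented_def by blast
  note at = lie_group_atlas[OF H] lie_group_atlas[OF K]
  note pts = lie_group_points[OF H] lie_group_points[OF K]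
  note \<iota> = complement_hom[OF H K c] complement_embedding[OF H K c]
  note s = complement_section[OF H K c]
  note f = complement_fst[OF H K c] and g = complement_snd[OF H K c]
  let ?E = "eucl m" and ?N = "(1 + 1) * m"
  \<comment> \<open>\<open>D\<close> is the set of all 1-jets of the Euclidean space and
    \<open>\<xi>\<close> a global chart on it.\<close>
  define D where "D = jet_domain ?E 1 (Eucl m)"
  define \<xi> where "\<xi> = jet_chart ?E 1 (\<lambda>x. x)"
  have ch: "(Eucl m, \<lambda>x. x) \<in> charts ?E" by simp
  have DX: "(D, \<xi>) \<in> charts (jet_manifold ?E 1)" unfolding D_def \<xi>_def by (rule charts_jetI[OF ch])
  have J: "atlas (jet_manifold ?E 1)" by (rule atlas_jet[OF atlas_eucl])
  have mJ: "mdim (jet_manifold ?E 1) = ?N" by simp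
  have im: "\<xi> ` D = Eucl ?N"
    unfolding \<xi>_def D_def using jet_chart_image[OF atlas_eucl ch order_refl, of 1] by (simp add: image_ident)
  have D: "D = jets ?E 1"
  proof -
    have "representative c 0 \<in> Eucl m" if "c \<in> jets ?E 1" for c
      using curve_0[OF jets_representative(1)[OF that]] by simp
    then show ?thesis unfolding D_def jet_domain_def by auto
  qed
  have inj: "inj_on \<xi> D" by (rule atlas_inj[OF J DX])
  define s' where "s' x = jet_map (mfd K) 1 s (inv_into D \<xi> x)" for x
  define \<theta>' where "\<theta>' k = (\<xi> (jet_map ?E 1 (\<lambda>k. fst (\<theta> k)) k), jet_map (mfd H) 1 (\<lambda>k. snd (\<theta> k)) k)" for k
  have "complement ?N (tangent_group 1 H) (tangent_group 1 K) (jet_map (mfd K) 1 \<iota>) s' \<theta>'"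
    unfolding complement_def
  proof (intro conjI ballI)
    show "jet_map (mfd K) 1 \<iota> \<in> hom (tangent_group 1 H) (tangent_group 1 K)" by (rule jet_map_hom[OF H K \<iota>])
    show "smooth_map (mfd (tangent_group 1 H)) (mfd (tangent_group 1 K)) (jet_map (mfd K) 1 \<iota>)"
      using smooth_map_jet_map[OF \<iota>(2) at] by simp
    have "smooth_map (eucl ?N) (jet_manifold ?E 1) (inv_into D \<xi>)"
      using smooth_map_inv_chart[OF _ atlas_eucl J DX, of ?N "\<lambda>x. x"] smooth_map_id[OF atlas_eucl, of ?N] im by simp
    from smooth_map_comp[OF this smooth_map_jet_map[OF s atlas_eucl at(2), of 1] atlas_eucl J atlas_jet[OF at(2)]]
    show "smooth_map (eucl ?N) (mfd (tangent_group 1 K)) s'" unfolding s'_def[abs_def] by simp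
    have p: "jet_map ?E 1 (\<lambda>k. fst (\<theta> k)) ` points (jet_manifold (mfd K) 1) \<subseteq> D"
      using smooth_map_points[OF smooth_map_jet_map[OF f at(2) atlas_eucl, of 1]] D by auto
    show "smooth_map (mfd (tangent_group 1 K)) (product_manifold (eucl ?N) (mfd (tangent_group 1 H))) \<theta>'"
      unfolding \<theta>'_def[abs_def] tangent_group_simps
      using smooth_map_Pair[OF smooth_map_chart[OF smooth_map_jet_map[OF f at(2) atlas_eucl, of 1] atlas_jet[OF at(2)] J DX p]
        smooth_map_jet_map[OF g at(2,1), of 1] atlas_jet[OF at(2)] atlas_eucl atlas_jet[OF at(1)]] by simp
    fix x h assume x: "x \<in> Eucl ?N" and h: "h \<in> carrier (tangent_group 1 H)"
    have "inv_into D \<xi> x \<in> D" using x im by (simp add: inv_into_into)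
    then obtain a where a: "curve ?E a" "\<And>t. a t \<in> Eucl m" "inv_into D \<xi> x = jet ?E 1 a"
      unfolding D using jets_cases[of "inv_into D \<xi> x" ?E 1] D by auto
    obtain b where b: "curve (mfd H) b" "\<And>t. b t \<in> carrier H" "h = jet (mfd H) 1 b"
      using h jets_cases[of h "mfd H" 1] pts by auto
    note ca = curve_map[OF s atlas_eucl at(2) a(1)] and cb = curve_map[OF \<iota>(2) at b(1)]
    have "s' x \<otimes>\<^bsub>tangent_group 1 K\<^esub> jet_map (mfd K) 1 \<iota> h = jet (mfd K) 1 (\<lambda>t. s (a t) \<otimes>\<^bsub>K\<^esub> \<iota> (b t))"
      unfolding s'_def a(3) b(3) jet_map_jet[OF s atlas_eucl at(2) a(1)] jet_map_jet[OF \<iota>(2) at b(1)]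
      by (rule tangent_mult[OF K ca cb])
    moreover have "\<theta> (s (a t) \<otimes>\<^bsub>K\<^esub> \<iota> (b t)) = (a t, b t)" for t
      by (rule complement_eq[OF H K c a(2) b(2)])
    moreover have "\<xi> (jet ?E 1 a) = x"
      unfolding a(3)[symmetric] using x im by (simp add: f_inv_into_f)
    ultimately show "\<theta>' (s' x \<otimes>\<^bsub>tangent_group 1 K\<^esub> jet_map (mfd K) 1 \<iota> h) = (x, h)"
      unfolding \<theta>'_def using jet_map_jet[OF f at(2) atlas_eucl curve_mult[OF K ca cb], of 1]
        jet_map_jet[OF g at(2,1) curve_mult[OF K ca cb], of 1] b(3) by simp
  next
    fix k assume k: "k \<in> carrier (tangent_group 1 K)"
    obtain p where p: "curve (mfd K) p" "\<And>t. p t \<in> carrier K" "k = jet (mfd K) 1 p"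
      using k jets_cases[of k "mfd K" 1] pts by auto
    note cf = curve_map[OF f at(2) atlas_eucl p(1)] and cg = curve_map[OF g at(2,1) p(1)]
    have kf: "jet_map ?E 1 (\<lambda>k. fst (\<theta> k)) k = jet ?E 1 (\<lambda>t. fst (\<theta> (p t)))"
      unfolding p(3) by (rule jet_map_jet[OF f at(2) atlas_eucl p(1)])
    have kg: "jet_map (mfd H) 1 (\<lambda>k. snd (\<theta> k)) k = jet (mfd H) 1 (\<lambda>t. snd (\<theta> (p t)))"
      unfolding p(3) by (rule jet_map_jet[OF g at(2,1) p(1)])
    have "jet ?E 1 (\<lambda>t. fst (\<theta> (p t))) \<in> D" unfolding D by (rule jet_in_jets[OF cf])
    then have "inv_into D \<xi> (\<xi> (jet ?E 1 (\<lambda>t. fst (\<theta> (p t))))) = jet ?E 1 (\<lambda>t. fst (\<theta> (p t)))"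
      by (rule inv_into_f_f[OF inj])
    then have "s' (fst (\<theta>' k)) \<otimes>\<^bsub>tangent_group 1 K\<^esub> jet_map (mfd K) 1 \<iota> (snd (\<theta>' k)) =
        jet (mfd K) 1 (\<lambda>t. s (fst (\<theta> (p t))) \<otimes>\<^bsub>K\<^esub> \<iota> (snd (\<theta> (p t))))"
      unfolding \<theta>'_def fst_conv snd_conv kf kg s'_def
      using tangent_mult[OF K curve_map[OF s atlas_eucl at(2) cf] curve_map[OF \<iota>(2) at cg], of 1]
        jet_map_jet[OF s atlas_eucl at(2) cf, of 1] jet_map_jet[OF \<iota>(2) at cg, of 1] by simp
    also have "\<dots> = k" using complement_split[OF H K c p(2)] p(3) by simp
    finally show "s' (fst (\<theta>' k)) \<otimes>\<^bsub>tangent_group 1 K\<^esub> jet_map (mfd K) 1 \<iota> (snd (\<theta>' k)) = k" .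
  qed
  then have "complemented ((1 + 1) * m) (tangent_group 1 H) (tangent_group 1 K)" unfolding complemented_def by blast
  then show ?thesis by (simp only: one_add_one)
qed

subsection \<open>The embedding of \<open>T\<^sup>n\<^sup>+\<^sup>1 G\<close> into \<open>T (T\<^sup>n G)\<close>\<close>

lemma jet_cong:
  assumes "curve X p" "eventually (\<lambda>t. p t = q t) (nhds 0)"
  shows "jet X n p = jet X n q"
  by (rule jet_eq_iff[THEN iffD2, OF assms(1) curve_cong[OF assms] same_derivs_cong[OF assms(2)]])

lemma base_hom:
  assumes G: "lie_group G"
  shows "(\<lambda>c. representative c 0) \<in> hom (tangent_group n G) G"
proof (rule homI)
  fix a assume "a \<in> carrier (tangent_group n G)"
  then obtain p where p: "curve (mfd G) p" "a = jet (mfd G) n p" using jets_cases[of a "mfd G" n] by auto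
  show "representative a 0 \<in> carrier G"
    using curve_0[OF p(1)] by (simp add: p(2) representative_jet[OF p(1)] lie_group_points[OF G])
  fix b assume "b \<in> carrier (tangent_group n G)"
  then obtain q where q: "curve (mfd G) q" "b = jet (mfd G) n q" using jets_cases[of b "mfd G" n] by auto
  show "representative (a \<otimes>\<^bsub>tangent_group n G\<^esub> b) 0 = representative a 0 \<otimes>\<^bsub>G\<^esub> representative b 0"
    unfolding p(2) q(2) tangent_mult[OF G p(1) q(1)] representative_jet(3)[OF p(1)] representative_jet(3)[OF q(1)]
      representative_jet(3)[OF curve_mult[OF G p(1) q(1)]] ..
qed

text \<open>A jet of order 0 is just its base point. This starts the induction on the order.\<close>

lemma complemented_tangent_0:
  assumes G: "lie_group G"
  shows "complemented 0 (tangent_group 0 G) G"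
proof (rule complemented_iso[OF lie_group_tangent[OF G] G base_hom[OF G]])
  note at = lie_group_atlas[OF G]
  show "smooth_map (mfd (tangent_group 0 G)) (mfd G) (\<lambda>c. representative c 0)"
    using smooth_map_jet_base[OF at] by simp
  show "smooth_map (mfd G) (mfd (tangent_group 0 G)) (\<lambda>x. jet (mfd G) 0 (\<lambda>t. x))"
    using smooth_map_jet_const[OF at] by simp
  have c: "curve (mfd G) (\<lambda>t. x)" if "x \<in> carrier G" for x
    using curve_const[OF at] that lie_group_points[OF G] by simp
  fix h assume "h \<in> carrier (tangent_group 0 G)"
  then obtain p where p: "curve (mfd G) p" "h = jet (mfd G) 0 p" using jets_cases[of h "mfd G" 0] by auto
  have p0: "p 0 \<in> carrier G" using curve_0[OF p(1)] lie_group_points[OF G] by simp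
  have "same_derivs (mfd G) 0 (\<lambda>t. p 0) p" by (auto simp: same_derivs_def)
  then show "jet (mfd G) 0 (\<lambda>t. representative h 0) = h"
    unfolding p(2) representative_jet(3)[OF p(1)] by (rule jet_eq_iff[THEN iffD2, OF c[OF p0] p(1)])
next
  fix x assume "x \<in> carrier G"
  then show "representative (jet (mfd G) 0 (\<lambda>t. x)) 0 = x"
    using representative_jet(3)[OF curve_const[OF lie_group_atlas[OF G]], of x] lie_group_points[OF G] by simp
qed

text \<open>The prolongation of \<open>p\<close> to a curve of \<open>n\<close>-jets:
  \<open>t\<close> is the variable consumed by the jet, \<open>u\<close> the parameter of the new
  curve.\<close>

definition jet_path :: "'a manifold \<Rightarrow> nat \<Rightarrow> (real \<Rightarrow> 'a) \<Rightarrow> real \<Rightarrow> (real \<Rightarrow> 'a) set" where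
  "jet_path X n p u = jet X n (\<lambda>t. p (t + u))"

lemma jet_path_0 [simp]: "jet_path X n p 0 = jet X n p"
  by (simp add: jet_path_def)

text \<open>Shifting time by \<open>u\<close> leaves an interval of radius
  \<open>e - \<bar>u\<bar>\<close> around 0, and the derivatives of the shifted curve at 0 are those
  of \<open>p\<close> at \<open>u\<close>.\<close>

lemma chart_curve_jet_path:
  assumes X: "atlas X" and U: "(U, \<phi>) \<in> charts X" and p: "chart_curve X U \<phi> e p" and u: "\<bar>u\<bar> < e"
  shows "curve X (\<lambda>t. p (t + u))" "jet_path X n p u \<in> jet_domain X n U"
    "jet_chart X n \<phi> (jet_path X n p u) = jet_coords n (mdim X) (\<lambda>t. \<phi> (p t)) u"
proof -
  have "chart_curve X U \<phi> (e - \<bar>u\<bar>) (\<lambda>t. p (t + u))"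
    unfolding chart_curve_def
  proof (intro conjI ballI allI impI)
    have m: "t + u \<in> {-e<..<e}" if "t \<in> {- (e - \<bar>u\<bar>)<..<e - \<bar>u\<bar>}" for t using that by auto
    show "p (t + u) \<in> U" if "t \<in> {- (e - \<bar>u\<bar>)<..<e - \<bar>u\<bar>}" for t
      using p m[OF that] unfolding chart_curve_def by blast
    fix i assume "i < mdim X"
    then have s: "smooth_real {-e<..<e} (\<lambda>s. \<phi> (p s) i)" using p unfolding chart_curve_def by blast
    show "smooth_real {- (e - \<bar>u\<bar>)<..<e - \<bar>u\<bar>} (\<lambda>s. \<phi> (p (s + u)) i)"
      unfolding smooth_real_def higher_deriv_shift[of _ "\<lambda>s. \<phi> (p s) i" u]
    proof (intro allI ballI)
      fix k t assume t: "t \<in> {- (e - \<bar>u\<bar>)<..<e - \<bar>u\<bar>}"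
      have "(deriv ^^ k) (\<lambda>s. \<phi> (p s) i) differentiable (at (t + u))" using s m[OF t] unfolding smooth_real_def by blast
      then obtain D where "((deriv ^^ k) (\<lambda>s. \<phi> (p s) i) has_real_derivative D) (at (t + u))"
        unfolding real_differentiable_def by blast
      then have "((\<lambda>t. (deriv ^^ k) (\<lambda>s. \<phi> (p s) i) (t + u)) has_real_derivative D) (at t)" by (simp only: DERIV_shift)
      then show "(\<lambda>t. (deriv ^^ k) (\<lambda>s. \<phi> (p s) i) (t + u)) differentiable (at t)"
        unfolding real_differentiable_def by blast
    qed
  qed (use u in auto)
  then show c: "curve X (\<lambda>t. p (t + u))" by (rule curveI[OF U])
  have u0: "p (0 + u) \<in> U" using chart_curve_mem[OF p u] by simp
  show "jet_path X n p u \<in> jet_domain X n U" unfolding jet_path_def using c u0 by simp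
  show "jet_chart X n \<phi> (jet_path X n p u) = jet_coords n (mdim X) (\<lambda>t. \<phi> (p t)) u"
    unfolding jet_path_def jet_chart_jet[where p = "\<lambda>t. p (t + u)", OF U c u0]
  proof -
    have "(deriv ^^ k) (\<lambda>s. \<phi> (p (s + u)) i) 0 = (deriv ^^ k) (\<lambda>s. \<phi> (p s) i) u" for k i
      unfolding higher_deriv_shift[of k "\<lambda>s. \<phi> (p s) i" u] by simp
    then show "jet_coords n (mdim X) (\<lambda>t. \<phi> (p (t + u))) 0 = jet_coords n (mdim X) (\<lambda>t. \<phi> (p t)) u"
      by (simp add: jet_coords_def cong: if_cong)
  qed
qed

lemma curve_jet_path:
  assumes X: "atlas X" and p: "curve X p"
  shows "curve (jet_manifold X n) (jet_path X n p)"
proof -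
  obtain U \<phi> e where U: "(U, \<phi>) \<in> charts X" and e: "chart_curve X U \<phi> e p" using p curve_iff by blast
  note cp = chart_curve_jet_path[OF X U e]
  have e0: "e > 0" using e by (simp add: chart_curve_def)
  have "chart_curve (jet_manifold X n) (jet_domain X n U) (jet_chart X n \<phi>) e (jet_path X n p)"
    unfolding chart_curve_def
  proof (intro conjI ballI allI impI e0)
    fix t assume "t \<in> {-e<..<e}"
    then have "\<bar>t\<bar> < e" by auto
    then show "jet_path X n p t \<in> jet_domain X n U" by (rule cp(2))
  next
    fix a assume "a < mdim (jet_manifold X n)"
    then have a: "a < (n + 1) * mdim X" by simp
    then have "mdim X > 0" by (cases "mdim X") auto
    then have "smooth_real {-e<..<e} (\<lambda>t. \<phi> (p t) (a mod mdim X))" using e unfolding chart_curve_def by simp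
    then have s: "smooth_real {-e<..<e} ((deriv ^^ (a div mdim X)) (\<lambda>t. \<phi> (p t) (a mod mdim X)))"
      by (rule smooth_real_higher_deriv)
    show "smooth_real {-e<..<e} (\<lambda>s. jet_chart X n \<phi> (jet_path X n p s) a)"
    proof (rule smooth_real_cong[OF _ s])
      fix t assume "t \<in> {-e<..<e}"
      then have "\<bar>t\<bar> < e" by auto
      from cp(3)[OF this] show "(deriv ^^ (a div mdim X)) (\<lambda>t. \<phi> (p t) (a mod mdim X)) t = jet_chart X n \<phi> (jet_path X n p t) a"
        using a by (simp add: jet_coords_def)
    qed simp
  qed
  then show ?thesis by (rule curveI[OF charts_jetI[OF U]])
qed

section \<open>The embedding in coordinates\<close>

lemma jet_coords_1:
  assumes "q t \<in> Eucl N"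
  shows "jet_coords 1 N q t = append_at N (q t) (\<lambda>i. if i < N then deriv (\<lambda>s. q s i) t else 0)"
proof
  fix a
  consider "a < N" | "N \<le> a" "a < (1 + 1) * N" | "(1 + 1) * N \<le> a" by linarith
  then show "jet_coords 1 N q t a = append_at N (q t) (\<lambda>i. if i < N then deriv (\<lambda>s. q s i) t else 0) a"
  proof cases
    case 1
    then show ?thesis by (simp add: jet_coords_def append_at_def)
  next
    case 2
    then have "a div N = 1" "a mod N = a - N"
      by (auto simp: div_nat_eqI le_mod_geq)
    then show ?thesis using 2 by (simp add: jet_coords_def append_at_def)
  next
    case 3
    then show ?thesis by (simp add: jet_coords_def append_at_def)
  qed
qed

text \<open>Differentiating the coordinates of the \<open>n\<close>-jet in time raises each order by
  one, which is a shift by \<open>d\<close>. The leading coordinates of the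
  \<open>(n + 1)\<close>-jet are those of the \<open>n\<close>-jet, and \<open>append_at\<close>
  reads no others from its first sequence.\<close>

lemma jet_coords_jet_coords:
  "jet_coords 1 ((n + 1) * d) (jet_coords n d q) 0 =
    append_at ((n + 1) * d) (jet_coords (Suc n) d q 0) (shift d (jet_coords (Suc n) d q 0))"
proof -
  let ?N = "(n + 1) * d" and ?J = "jet_coords (Suc n) d q 0"
  have "(if i < ?N then deriv (\<lambda>s. jet_coords n d q s i) 0 else 0) = shift d ?J i" for i
  proof (cases "i < ?N")
    case True
    then have "d > 0" by (cases d) auto
    then show ?thesis using True by (simp add: jet_coords_def shift_def)
  qed (simp add: jet_coords_def shift_def)
  moreover have "append_at ?N (jet_coords n d q 0) v = append_at ?N ?J v" for v
    by (auto simp: append_at_def jet_coords_def fun_eq_iff)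
  ultimately show ?thesis using jet_coords_1[where q = "jet_coords n d q" and t = 0, OF jet_coords_mem] by simp
qed

text \<open>The canonical embedding of \<open>(n + 1)\<close>-jets into the tangent vectors of the
  manifold of \<open>n\<close>-jets, which exists on any manifold, here evaluated at a chosen
  representative.\<close>

definition jet_split :: "'a manifold \<Rightarrow> nat \<Rightarrow> (real \<Rightarrow> 'a) set \<Rightarrow> (real \<Rightarrow> (real \<Rightarrow> 'a) set) set" where
  "jet_split X n c = jet (jet_manifold X n) 1 (jet_path X n (representative c))"

lemma jet_chart_jet_path:
  assumes X: "atlas X" and U: "(U, \<phi>) \<in> charts X" and p: "curve X p" "p 0 \<in> U"
  shows "jet_chart (jet_manifold X n) 1 (jet_chart X n \<phi>) (jet (jet_manifold X n) 1 (jet_path X n p)) =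
    append_at ((n + 1) * mdim X) (jet_chart X (Suc n) \<phi> (jet X (Suc n) p)) (shift (mdim X) (jet_chart X (Suc n) \<phi> (jet X (Suc n) p)))"
proof -
  obtain e where e: "chart_curve X U \<phi> e p" using curve_in_chart[OF X p(1) U p(2)] .
  have e0: "e > 0" using e by (simp add: chart_curve_def)
  have "eventually (\<lambda>u. jet_chart X n \<phi> (jet_path X n p u) = jet_coords n (mdim X) (\<lambda>t. \<phi> (p t)) u) (nhds 0)"
    by (rule eventually_nhds_0[OF e0]) (rule chart_curve_jet_path(3)[OF X U e])
  then have "jet_coords 1 ((n + 1) * mdim X) (\<lambda>u. jet_chart X n \<phi> (jet_path X n p u)) 0 =
      jet_coords 1 ((n + 1) * mdim X) (jet_coords n (mdim X) (\<lambda>t. \<phi> (p t))) 0"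
    by (rule jet_coords_cong)
  moreover have "jet_path X n p 0 \<in> jet_domain X n U" using p by simp
  ultimately show ?thesis
    unfolding jet_chart_jet[OF U p] jet_coords_jet_coords[symmetric]
    using jet_chart_jet[where p = "jet_path X n p" and n = 1, OF charts_jetI[OF U] curve_jet_path[OF X p(1)]] by simp
qed

text \<open>By \<open>jet_chart_jet_path\<close> the coordinates of the velocity depend only on the
  \<open>(n + 1)\<close>-jet of the curve.\<close>

lemma jet_split_jet:
  assumes X: "atlas X" and p: "curve X p"
  shows "jet_split X n (jet X (Suc n) p) = jet (jet_manifold X n) 1 (jet_path X n p)"
proof -
  obtain U \<phi> where U: "(U, \<phi>) \<in> charts X" "p 0 \<in> U" using points_cover[OF curve_0[OF p]] .
  note r = representative_jet[OF p, of "Suc n"]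
  have r0: "representative (jet X (Suc n) p) 0 \<in> U" using r U by simp
  have "jet X (Suc n) (representative (jet X (Suc n) p)) = jet X (Suc n) p"
    by (rule jets_representative(2)[OF jet_in_jets[OF p]])
  then have "jet_chart (jet_manifold X n) 1 (jet_chart X n \<phi>) (jet_split X n (jet X (Suc n) p)) =
      jet_chart (jet_manifold X n) 1 (jet_chart X n \<phi>) (jet (jet_manifold X n) 1 (jet_path X n p))"
    unfolding jet_split_def jet_chart_jet_path[OF X U(1) r(1) r0] jet_chart_jet_path[OF X U(1) p U(2)] by simp
  moreover have "jet_split X n (jet X (Suc n) p) \<in> jet_domain (jet_manifold X n) 1 (jet_domain X n U)"
    unfolding jet_split_def using curve_jet_path[OF X r(1)] r(1) r0 by simp
  moreover have "jet (jet_manifold X n) 1 (jet_path X n p) \<in> jet_domain (jet_manifold X n) 1 (jet_domain X n U)"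
    using curve_jet_path[OF X p] p U(2) by simp
  ultimately show ?thesis
    using inj_onD[OF inj_on_jet_chart[OF atlas_jet[OF X] charts_jetI[OF U(1)]]] by blast
qed

lemma smooth_map_jet_split:
  assumes X: "atlas X"
  shows "smooth_map (jet_manifold X (Suc n)) (jet_manifold (jet_manifold X n) 1) (jet_split X n)"
proof (rule smooth_mapI[OF atlas_jet[OF X] atlas_jet[OF atlas_jet[OF X]]])
  let ?N = "(n + 1) * mdim X" and ?J = "jet_manifold X n"
  fix c assume "c \<in> points (jet_manifold X (Suc n))"
  then have c: "c \<in> jets X (Suc n)" by simp
  obtain U \<phi> where U: "(U, \<phi>) \<in> charts X" "representative c 0 \<in> U"
    using points_cover[OF curve_0[OF jets_representative(1)[OF c]]] .
  let ?D = "jet_domain X (Suc n) U" and ?G = "\<lambda>x. append_at ?N x (shift (mdim X) x)"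
  have key: "jet_split X n a \<in> jet_domain ?J 1 (jet_domain X n U) \<and>
      ?G (jet_chart X (Suc n) \<phi> a) = jet_chart ?J 1 (jet_chart X n \<phi>) (jet_split X n a)" if a: "a \<in> ?D" for a
  proof -
    obtain p where p: "curve X p" "a = jet X (Suc n) p" "p 0 \<in> U" using jet_domain_cases[OF a] by metis
    have 1: "jet_split X n a \<in> jet_domain ?J 1 (jet_domain X n U)"
      unfolding p(2) jet_split_jet[OF X p(1)] using curve_jet_path[OF X p(1)] p by simp
    have 2: "?G (jet_chart X (Suc n) \<phi> a) = jet_chart ?J 1 (jet_chart X n \<phi>) (jet_split X n a)"
      unfolding p(2) jet_split_jet[OF X p(1)] jet_chart_jet_path[OF X U(1) p(1,3)] ..
    from 1 2 show ?thesis ..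
  qed
  show "smooth_near (jet_manifold X (Suc n)) (jet_manifold ?J 1) (jet_split X n) c"
  proof (rule smooth_nearI)
    show "(?D, jet_chart X (Suc n) \<phi>) \<in> charts (jet_manifold X (Suc n))" by (rule charts_jetI[OF U(1)])
    then show "eopen (mdim (jet_manifold X (Suc n))) (jet_chart X (Suc n) \<phi> ` ?D)" by (rule atlas_open[OF atlas_jet[OF X]])
    show "(jet_domain ?J 1 (jet_domain X n U), jet_chart ?J 1 (jet_chart X n \<phi>)) \<in> charts (jet_manifold ?J 1)"
      by (intro charts_jetI U(1))
    show "smooth_euclidean (mdim (jet_manifold X (Suc n))) (mdim (jet_manifold ?J 1)) (jet_chart X (Suc n) \<phi> ` ?D) ?G"
      unfolding smooth_euclidean_iff append_at_def shift_def by (auto intro!: smooth_on_if)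
    show "\<forall>a\<in>?D. ?G (jet_chart X (Suc n) \<phi> a) = jet_chart ?J 1 (jet_chart X n \<phi>) (jet_split X n a)"
      using key by blast
    show "jet_split X n ` ?D \<subseteq> jet_domain ?J 1 (jet_domain X n U)" using key by blast
  qed (use c U in \<open>auto simp: jet_domain_def\<close>)
qed

text \<open>Pointwise products commute with shifts of time, so the prolongation of a product is the
  product of the prolongations. This is available for small \<open>u\<close>, where the shifted maps
  are curves, and that is enough for a velocity.\<close>

lemma jet_split_hom:
  assumes G: "lie_group G"
  shows "jet_split (mfd G) n \<in> hom (tangent_group (Suc n) G) (tangent_group 1 (tangent_group n G))"
proof (rule homI)
  let ?X = "mfd G" and ?H = "tangent_group n G"
  note at = lie_group_atlas[OF G]
  note H = lie_group_tangent[OF G, of n]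
  fix a assume "a \<in> carrier (tangent_group (Suc n) G)"
  then obtain p where p: "curve ?X p" "a = jet ?X (Suc n) p" using jets_cases[of a ?X "Suc n"] by auto
  have cp: "curve (mfd ?H) (jet_path ?X n p)" using curve_jet_path[OF at p(1)] by simp
  show "jet_split ?X n a \<in> carrier (tangent_group 1 ?H)"
    unfolding p(2) jet_split_jet[OF at p(1)] using jet_in_jets[OF cp] by simp
  fix b assume "b \<in> carrier (tangent_group (Suc n) G)"
  then obtain q where q: "curve ?X q" "b = jet ?X (Suc n) q" using jets_cases[of b ?X "Suc n"] by auto
  have cq: "curve (mfd ?H) (jet_path ?X n q)" using curve_jet_path[OF at q(1)] by simp
  note pq = curve_mult[OF G p(1) q(1)]
  obtain U \<phi> e where U: "(U, \<phi>) \<in> charts ?X" "chart_curve ?X U \<phi> e p" using p(1) curve_iff by blast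
  obtain V \<psi> r where V: "(V, \<psi>) \<in> charts ?X" "chart_curve ?X V \<psi> r q" using q(1) curve_iff by blast
  have "eventually (\<lambda>u. jet_path ?X n p u \<otimes>\<^bsub>?H\<^esub> jet_path ?X n q u = jet_path ?X n (\<lambda>t. p t \<otimes>\<^bsub>G\<^esub> q t) u) (nhds 0)"
  proof (rule eventually_nhds_0[of "min e r"])
    show "min e r > 0" using U(2) V(2) by (simp add: chart_curve_def)
    fix u assume "\<bar>u\<bar> < min e r"
    then have u: "\<bar>u\<bar> < e" "\<bar>u\<bar> < r" by auto
    show "jet_path ?X n p u \<otimes>\<^bsub>?H\<^esub> jet_path ?X n q u = jet_path ?X n (\<lambda>t. p t \<otimes>\<^bsub>G\<^esub> q t) u"
      unfolding jet_path_def
      by (rule tangent_mult[OF G chart_curve_jet_path(1)[OF at U u(1)] chart_curve_jet_path(1)[OF at V u(2)]])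
  qed
  from jet_cong[OF curve_mult[OF H cp cq] this, of 1]
  show "jet_split ?X n (a \<otimes>\<^bsub>tangent_group (Suc n) G\<^esub> b) = jet_split ?X n a \<otimes>\<^bsub>tangent_group 1 ?H\<^esub> jet_split ?X n b"
    unfolding p(2) q(2) tangent_mult[OF G p(1) q(1)] jet_split_jet[OF at p(1)] jet_split_jet[OF at q(1)] jet_split_jet[OF at pq]
    using tangent_mult[OF H cp cq, of 1] by simp
qed

subsection \<open>Tangent vectors at the identity\<close>

lemma sum_lessThan_add: "(\<Sum>j<M + N. g j) = (\<Sum>j<M. g j) + (\<Sum>j<N. g (M + j :: nat) :: real)"
  by (induction N) auto

text \<open>The derivative is linear in the two velocities; each summand is found by making the other curve constant.\<close>

lemma deriv_mult_at_one:
  assumes G: "lie_group G" and V: "(V, \<psi>) \<in> charts (mfd G)"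
    and p: "curve (mfd G) p" "p 0 = \<one>\<^bsub>G\<^esub>" and q: "curve (mfd G) q" "q 0 = \<one>\<^bsub>G\<^esub>"
    and V1: "\<one>\<^bsub>G\<^esub> \<in> V" and i: "i < mdim (mfd G)"
  shows "deriv (\<lambda>t. \<psi> (p t \<otimes>\<^bsub>G\<^esub> q t) i) 0 = deriv (\<lambda>t. \<psi> (p t) i) 0 + deriv (\<lambda>t. \<psi> (q t) i) 0"
proof -
  interpret G: group G by (rule lie_group_group[OF G])
  let ?X = "mfd G"
  let ?N = "mdim ?X" and ?m = "\<lambda>(x, y). x \<otimes>\<^bsub>G\<^esub> y"
  let ?P = "product_manifold ?X ?X" and ?c = "\<lambda>(x, y). append_at ?N (\<psi> x) (\<psi> y)"
  note at = lie_group_atlas[OF G]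
  note c = charts_productI[OF V V]
  obtain F where F: "eopen (mdim ?P) (?c ` ((V \<times> V) \<inter> ?m -` V))"
    "smooth_euclidean (mdim ?P) ?N (?c ` ((V \<times> V) \<inter> ?m -` V)) F"
    "\<And>z. z \<in> V \<times> V \<Longrightarrow> ?m z \<in> V \<Longrightarrow> F (?c z) = \<psi> (?m z)"
    using smooth_mapE[OF lie_group_mult[OF G] atlas_product[OF at at] c V] by blast
  define f where "f = (\<lambda>x. F x i)"
  define z0 where "z0 = ?c (\<one>\<^bsub>G\<^esub>, \<one>\<^bsub>G\<^esub>)"
  have f: "smooth_on (mdim ?P) (?c ` ((V \<times> V) \<inter> ?m -` V)) f" using F(2) i by (simp add: smooth_euclidean_iff f_def)
  have D: "((\<lambda>t. \<psi> (a t) j) has_real_derivative deriv (\<lambda>t. \<psi> (a t) j) 0) (at 0)"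
    if a: "curve ?X a" "a 0 = \<one>\<^bsub>G\<^esub>" "j < ?N" for a j
  proof -
    have "a 0 \<in> V" using a V1 by simp
    from curve_in_chart[OF at a(1) V this] obtain e where e: "chart_curve ?X V \<psi> e a" by blast
    have "smooth_real {-e<..<e} (\<lambda>t. \<psi> (a t) j)" "0 \<in> {-e<..<e}" using e a(3) unfolding chart_curve_def by auto
    then show ?thesis by (rule smooth_real_has_derivative)
  qed
  \<comment> \<open>The chain rule at the pair of identities. The partial derivatives of the
    multiplication stay unknown, but they are the same for all curves through the identity.\<close>
  have key: "deriv (\<lambda>t. \<psi> (a t \<otimes>\<^bsub>G\<^esub> b t) i) 0 =
      (\<Sum>j<?N. pd j f z0 * deriv (\<lambda>t. \<psi> (a t) j) 0) + (\<Sum>j<?N. pd (?N + j) f z0 * deriv (\<lambda>t. \<psi> (b t) j) 0)"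
    if a: "curve ?X a" "a 0 = \<one>\<^bsub>G\<^esub>" and b: "curve ?X b" "b 0 = \<one>\<^bsub>G\<^esub>" for a b
  proof -
    define w where "w t = append_at ?N (\<psi> (a t)) (\<psi> (b t))" for t
    define w' where "w' j = (if j < ?N then deriv (\<lambda>t. \<psi> (a t) j) 0 else deriv (\<lambda>t. \<psi> (b t) (j - ?N)) 0)" for j
    have ab: "curve ?X (\<lambda>t. a t \<otimes>\<^bsub>G\<^esub> b t)" by (rule curve_mult[OF G a(1) b(1)])
    have eV: "eventually (\<lambda>t. a t \<in> V) (nhds 0)" "eventually (\<lambda>t. b t \<in> V) (nhds 0)"
        "eventually (\<lambda>t. a t \<otimes>\<^bsub>G\<^esub> b t \<in> V) (nhds 0)"
      using eventually_in_chart[OF at a(1) V] eventually_in_chart[OF at b(1) V] eventually_in_chart[OF at ab V] a(2) b(2) V1 by auto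
    then have "eventually (\<lambda>t. \<psi> (a t \<otimes>\<^bsub>G\<^esub> b t) i = f (w t)) (nhds 0)"
    proof eventually_elim
      case (elim t)
      then show ?case using F(3)[of "(a t, b t)"] by (simp add: f_def w_def)
    qed
    then have "deriv (\<lambda>t. \<psi> (a t \<otimes>\<^bsub>G\<^esub> b t) i) 0 = deriv (\<lambda>t. f (w t)) 0" by (rule deriv_cong_ev) simp
    also have "\<dots> = (\<Sum>j<mdim ?P. pd j f (w 0) * w' j)"
    proof (rule deriv_compose[OF F(1) f])
      have "(\<one>\<^bsub>G\<^esub>, \<one>\<^bsub>G\<^esub>) \<in> (V \<times> V) \<inter> ?m -` V" using V1 by simp
      moreover have "w 0 = ?c (\<one>\<^bsub>G\<^esub>, \<one>\<^bsub>G\<^esub>)" by (simp add: w_def a(2) b(2))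
      ultimately show "w 0 \<in> ?c ` ((V \<times> V) \<inter> ?m -` V)" by (metis imageI)
      show "eventually (\<lambda>t. w t \<in> Eucl (mdim ?P)) (nhds 0)"
        using eV(2) by eventually_elim (use atlas_mem[OF at V] in \<open>simp add: w_def\<close>)
      fix j assume j: "j < mdim ?P"
      show "((\<lambda>s. w s j) has_real_derivative w' j) (at 0)"
      proof (cases "j < ?N")
        case True
        then show ?thesis using D[OF a True] by (simp add: w_def w'_def append_at_def)
      next
        case False
        then have "j - ?N < ?N" using j by simp
        from D[OF b this] show ?thesis using False by (simp add: w_def w'_def append_at_def)
      qed
    qed
    also have "\<dots> = (\<Sum>j<?N. pd j f (w 0) * w' j) + (\<Sum>j<?N. pd (?N + j) f (w 0) * w' (?N + j))"
      unfolding mdim_product by (rule sum_lessThan_add)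
    also have "w 0 = z0" by (simp add: w_def z0_def a(2) b(2))
    finally show ?thesis by (simp add: w'_def)
  qed
  have one: "curve ?X (\<lambda>t. \<one>\<^bsub>G\<^esub>)" by (rule curve_one[OF G])
  \<comment> \<open>The unit laws are available for group elements only, hence near 0.\<close>
  have ev: "eventually (\<lambda>t. a t \<in> carrier G) (nhds 0)" if "curve ?X a" "a 0 = \<one>\<^bsub>G\<^esub>" for a
    using eventually_in_chart[OF at that(1) V] that(2) V1
    by (auto elim!: eventually_mono simp: lie_group_points[OF G, symmetric] intro: in_points[OF V])
  have "deriv (\<lambda>t. \<psi> (p t) i) 0 = deriv (\<lambda>t. \<psi> (p t \<otimes>\<^bsub>G\<^esub> \<one>\<^bsub>G\<^esub>) i) 0"
    using ev[OF p] by (intro deriv_cong_ev) (auto elim: eventually_mono)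
  also have "\<dots> = (\<Sum>j<?N. pd j f z0 * deriv (\<lambda>t. \<psi> (p t) j) 0)"
    using key[OF p one refl] by simp
  finally have P: "deriv (\<lambda>t. \<psi> (p t) i) 0 = (\<Sum>j<?N. pd j f z0 * deriv (\<lambda>t. \<psi> (p t) j) 0)" .
  have "deriv (\<lambda>t. \<psi> (q t) i) 0 = deriv (\<lambda>t. \<psi> (\<one>\<^bsub>G\<^esub> \<otimes>\<^bsub>G\<^esub> q t) i) 0"
    using ev[OF q] by (intro deriv_cong_ev) (auto elim: eventually_mono)
  also have "\<dots> = (\<Sum>j<?N. pd (?N + j) f z0 * deriv (\<lambda>t. \<psi> (q t) j) 0)"
    using key[OF one refl q] by simp
  finally have Q: "deriv (\<lambda>t. \<psi> (q t) i) 0 = (\<Sum>j<?N. pd (?N + j) f z0 * deriv (\<lambda>t. \<psi> (q t) j) 0)" .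
  show ?thesis using key[OF p q] P Q by simp
qed

text \<open>The fibre of the tangent group over the identity is the additive group of tangent
  vectors: the base coordinates stay those of the identity and the velocities add by
  \<open>deriv_mult_at_one\<close>.\<close>

lemma jet_chart_mult_at_one:
  assumes G: "lie_group G" and V: "(V, \<psi>) \<in> charts (mfd G)" "\<one>\<^bsub>G\<^esub> \<in> V"
    and a: "a \<in> jets (mfd G) 1" "representative a 0 = \<one>\<^bsub>G\<^esub>" and b: "b \<in> jets (mfd G) 1" "representative b 0 = \<one>\<^bsub>G\<^esub>"
  shows "jet_chart (mfd G) 1 \<psi> (a \<otimes>\<^bsub>tangent_group 1 G\<^esub> b) = append_at (mdim (mfd G)) (\<psi> \<one>\<^bsub>G\<^esub>)
    (\<lambda>i. shift (mdim (mfd G)) (jet_chart (mfd G) 1 \<psi> a) i + shift (mdim (mfd G)) (jet_chart (mfd G) 1 \<psi> b) i)"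
proof -
  interpret G: group G by (rule lie_group_group[OF G])
  let ?X = "mfd G" let ?N = "mdim ?X"
  note at = lie_group_atlas[OF G]
  define p where "p = representative a"
  define q where "q = representative b"
  have p: "curve ?X p" "a = jet ?X 1 p" "p 0 = \<one>\<^bsub>G\<^esub>" using jets_representative[OF a(1)] a(2) by (simp_all add: p_def)
  have q: "curve ?X q" "b = jet ?X 1 q" "q 0 = \<one>\<^bsub>G\<^esub>" using jets_representative[OF b(1)] b(2) by (simp_all add: q_def)
  note pq = curve_mult[OF G p(1) q(1)]
  have chart: "jet_chart ?X 1 \<psi> (jet ?X 1 r) = append_at ?N (\<psi> \<one>\<^bsub>G\<^esub>) (\<lambda>i. if i < ?N then deriv (\<lambda>s. \<psi> (r s) i) 0 else 0)"
    if r: "curve ?X r" "r 0 = \<one>\<^bsub>G\<^esub>" for r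
  proof -
    have r0: "r 0 \<in> V" using r V by simp
    show ?thesis
      unfolding jet_chart_jet[where p = r, OF V(1) r(1) r0]
      using jet_coords_1[of "\<lambda>s. \<psi> (r s)" 0 ?N] atlas_mem[OF at V(1) r0] r(2) by simp
  qed
  have "(\<lambda>i. if i < ?N then deriv (\<lambda>s. \<psi> (p s \<otimes>\<^bsub>G\<^esub> q s) i) 0 else 0) =
    (\<lambda>i. (if i < ?N then deriv (\<lambda>s. \<psi> (p s) i) 0 else 0) + (if i < ?N then deriv (\<lambda>s. \<psi> (q s) i) 0 else 0))"
    using deriv_mult_at_one[OF G V(1) p(1,3) q(1,3) V(2)] by (auto simp: fun_eq_iff)
  then show ?thesis
    unfolding p(2) q(2) tangent_mult[OF G p(1) q(1)]
    using chart[OF p(1,3)] chart[OF q(1,3)] chart[OF pq] p(3) q(3) by simp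
qed

lemma hom_inverse:
  assumes "group G" "group H" "h \<in> hom G H" "x \<in> carrier G"
  shows "h (inv\<^bsub>G\<^esub> x) = inv\<^bsub>H\<^esub> (h x)"
  by (rule group_hom.hom_inv[OF group_hom.intro[OF assms(1,2) group_hom_axioms.intro[OF assms(3)]] assms(4)])

lemma append_at_trunc_shift: "trunc a x = u \<Longrightarrow> x = append_at a u (shift a x)"
  by (metis append_trunc_shift)

text \<open>
  The coordinates of a jet of order \<open>n + 1\<close> in \<open>T (T\<^sup>n G)\<close> are those of its derivatives of orders
  \<open>0..n\<close> followed by those of orders \<open>1..n+1\<close>.  Hence a vector tangent to \<open>T\<^sup>n G\<close> at the
  identity is uniquely the product of one whose last \<open>mdim (mfd G)\<close> coordinates vanish and of the image of an
  \<open>(n+1)\<close>-jet that is trivial up to order \<open>n\<close>; the section \<open>\<tau>\<close> of \<open>T\<^sup>n\<^sup>+\<^sup>1 G \<rightarrow> T\<^sup>n G\<close> reduces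
  the general case to that one.
\<close>

lemma complemented_jet_split:
  fixes G :: "'g lie"
  assumes G: "lie_group G"
  shows "complemented (n * mdim (mfd G)) (tangent_group (Suc n) G) (tangent_group 1 (tangent_group n G))"
proof -
  let ?X = "mfd G" and ?H = "tangent_group n G"
  let ?L = "tangent_group (Suc n) G" and ?T = "tangent_group 1 ?H"
  let ?d = "mdim ?X" and ?j = "jet_split ?X n"
  let ?J = "jet_manifold ?X n" and ?JL = "jet_manifold ?X (Suc n)"
  define N where "N = (n + 1) * ?d"
  note H = lie_group_tangent[OF G, of n] and L = lie_group_tangent[OF G, of "Suc n"]
  note T = lie_group_tangent[OF H, of 1]
  interpret G: group G by (rule lie_group_group[OF G])
  interpret H: group ?H by (rule lie_group_group[OF H])
  interpret L: group ?L by (rule lie_group_group[OF L])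
  interpret T: group ?T by (rule lie_group_group[OF T])
  note at = lie_group_atlas[OF G]
  have J: "atlas ?J" and JL: "atlas ?JL" and JT: "atlas (jet_manifold ?J 1)" by (intro atlas_jet at)+
  have dims: "mdim ?J = N" "mdim ?JL = N + ?d" "mdim (jet_manifold ?J 1) = N + N"
    by (simp_all add: N_def)
  have Nd: "N = n * ?d + ?d" by (simp add: N_def)
  have E_mono: "x \<in> Eucl b" if "x \<in> Eucl a" "a \<le> b" for x a b using that by (auto simp: mem_Eucl)
  have "\<one>\<^bsub>G\<^esub> \<in> points ?X" by (simp add: lie_group_points[OF G])
  then obtain U \<phi> where U: "(U, \<phi>) \<in> charts ?X" "\<one>\<^bsub>G\<^esub> \<in> U" by (rule points_cover)
  \<comment> \<open>One chart of \<open>G\<close> around the identity induces charts around the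
    identities of \<open>T\<^sup>n G\<close>, \<open>T\<^sup>n\<^sup>+\<^sup>1 G\<close> and
    \<open>T (T\<^sup>n G)\<close>.\<close>
  define V \<psi> where "V = jet_domain ?X n U" and "\<psi> = jet_chart ?X n \<phi>"
  define VL \<psi>L where "VL = jet_domain ?X (Suc n) U" and "\<psi>L = jet_chart ?X (Suc n) \<phi>"
  define W \<xi> where "W = jet_domain ?J 1 V" and "\<xi> = jet_chart ?J 1 \<psi>"
  have V: "(V, \<psi>) \<in> charts ?J" unfolding V_def \<psi>_def by (rule charts_jetI[OF U(1)])
  have VL: "(VL, \<psi>L) \<in> charts ?JL" unfolding VL_def \<psi>L_def by (rule charts_jetI[OF U(1)])
  have W: "(W, \<xi>) \<in> charts (jet_manifold ?J 1)" unfolding W_def \<xi>_def by (rule charts_jetI[OF V])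
  have imV: "\<psi> ` V = {x \<in> Eucl N. trunc ?d x \<in> \<phi> ` U}"
    unfolding V_def \<psi>_def N_def by (rule jet_chart_image[OF at U(1) order_refl])
  have imVL: "\<psi>L ` VL = {x \<in> Eucl (N + ?d). trunc ?d x \<in> \<phi> ` U}"
    unfolding VL_def \<psi>L_def using jet_chart_image[OF at U(1) order_refl, of "Suc n"] by (simp add: N_def add_ac)
  have imW: "\<xi> ` W = {x \<in> Eucl (N + N). trunc N x \<in> \<psi> ` V}"
    unfolding W_def \<xi>_def using jet_chart_image[OF J V order_refl, of 1] dims(1) by simp
  \<comment> \<open>A constant curve has vanishing derivatives, so the identities of all these
    groups have the coordinates \<open>c0\<close> followed by zeros. Thus \<open>c0\<close> serves
    as a point of \<open>Eucl ?d\<close> and of \<open>Eucl N\<close> alike.\<close>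
  define c0 where "c0 = \<phi> \<one>\<^bsub>G\<^esub>"
  have c0: "c0 \<in> Eucl ?d" "c0 \<in> Eucl N" "c0 \<in> \<phi> ` U"
    using atlas_mem[OF at U] U(2) E_mono[of c0 ?d N] by (auto simp: c0_def Nd)
  have tc0: "trunc ?d (append_at N c0 v) = c0" for v
    using c0(1) by (auto simp: trunc_def append_at_def Nd mem_Eucl fun_eq_iff)
  note cone = curve_one[OF G]
  have oneV: "\<one>\<^bsub>?H\<^esub> \<in> V" unfolding V_def using cone U(2) by simp
  have psi1: "\<psi> \<one>\<^bsub>?H\<^esub> = c0"
    unfolding \<psi>_def c0_def tangent_group_simps jet_chart_jet[OF U(1) cone U(2)]
    by (rule jet_coords_const[OF atlas_mem[OF at U]])
  have c0V: "c0 \<in> \<psi> ` V" using psi1 oneV by blast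

  define \<pi> where "\<pi> = (\<lambda>w. representative w 0 :: (real \<Rightarrow> 'g) set)"
  have \<pi>: "\<pi> \<in> hom ?T ?H" unfolding \<pi>_def by (rule base_hom[OF H])
  have \<pi>s: "smooth_map (jet_manifold ?J 1) ?J \<pi>" unfolding \<pi>_def by (rule smooth_map_jet_base[OF J])
  note j = jet_split_hom[OF G, of n] and js = smooth_map_jet_split[OF at, of n]
  \<comment> \<open>The truncation of jets from order \<open>n + 1\<close> to order
    \<open>n\<close>. Factoring it through the embedding and the base point makes it multiplicative
    at once.\<close>
  define pr where "pr h = \<pi> (?j h)" for h
  have pr_mult: "pr (a \<otimes>\<^bsub>?L\<^esub> b) = pr a \<otimes>\<^bsub>?H\<^esub> pr b" if "a \<in> carrier ?L" "b \<in> carrier ?L" for a b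
    using hom_mult[OF j that] hom_mult[OF \<pi> hom_in_carrier[OF j that(1)] hom_in_carrier[OF j that(2)]] by (simp add: pr_def)
  have pr_jet: "pr (jet ?X (Suc n) p) = jet ?X n p" if "curve ?X p" for p
    unfolding pr_def \<pi>_def jet_split_jet[OF at that] using representative_jet(3)[OF curve_jet_path[OF at that]] by simp
  have pr_closed: "pr a \<in> carrier ?H" if "a \<in> carrier ?L" for a
    unfolding pr_def by (intro hom_in_carrier[OF \<pi>] hom_in_carrier[OF j] that)
  have pr_inv: "pr (inv\<^bsub>?L\<^esub> a) = inv\<^bsub>?H\<^esub> (pr a)" if a: "a \<in> carrier ?L" for a
  proof -
    have "pr \<one>\<^bsub>?L\<^esub> = \<one>\<^bsub>?H\<^esub>" using pr_jet[OF cone] by simp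
    then have "pr (inv\<^bsub>?L\<^esub> a) \<otimes>\<^bsub>?H\<^esub> pr a = \<one>\<^bsub>?H\<^esub>" using pr_mult[of "inv\<^bsub>?L\<^esub> a" a] a L.l_inv L.inv_closed by metis
    then show ?thesis using H.inv_equality[of "pr (inv\<^bsub>?L\<^esub> a)" "pr a"] pr_closed a L.inv_closed by metis
  qed
  have psi_pr: "pr a \<in> V \<and> \<psi> (pr a) = trunc N (\<psi>L a)" if a: "a \<in> VL" for a
  proof -
    obtain p where p: "curve ?X p" "a = jet ?X (Suc n) p" "p 0 \<in> U"
      using jet_domain_cases[OF a[unfolded VL_def]] by metis
    have "jet_coords n ?d (\<lambda>t. \<phi> (p t)) 0 = trunc N (jet_coords (Suc n) ?d (\<lambda>t. \<phi> (p t)) 0)"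
      by (auto simp: jet_coords_def trunc_def N_def fun_eq_iff)
    then show ?thesis
      unfolding p(2) pr_jet[OF p(1)] \<psi>_def \<psi>L_def jet_chart_jet[OF U(1) p(1,3)] V_def using p by simp
  qed
  have xi_j: "\<xi> (?j a) = append_at N (\<psi>L a) (shift ?d (\<psi>L a))" if a: "a \<in> VL" for a
  proof -
    obtain p where p: "curve ?X p" "a = jet ?X (Suc n) p" "p 0 \<in> U"
      using jet_domain_cases[OF a[unfolded VL_def]] by metis
    show ?thesis
      unfolding p(2) jet_split_jet[OF at p(1)] \<xi>_def \<psi>_def \<psi>L_def N_def by (rule jet_chart_jet_path[OF at U(1) p(1,3)])
  qed
  have jL: "?j a \<in> carrier ?T" if "a \<in> carrier ?L" for a by (rule hom_in_carrier[OF j that])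

  \<comment> \<open>\<open>top u\<close> is the jet that is trivial up to order \<open>n\<close> and
    has top derivative \<open>u\<close>; \<open>s v\<close> is the tangent vector at the identity
    with velocity \<open>v\<close>, whose last \<open>?d\<close> coordinates are zero.\<close>
  define top where "top u = inv_into VL \<psi>L (append_at N c0 u)" for u
  define s where "s v = inv_into W \<xi> (append_at N c0 v)" for v
  have top_im: "append_at N c0 u \<in> \<psi>L ` VL" if "u \<in> Eucl ?d" for u
    unfolding imVL using that tc0 c0(3) by simp
  have s_im: "append_at N c0 v \<in> \<xi> ` W" if "v \<in> Eucl (n * ?d)" for v
    unfolding imW using E_mono[OF that, of N] c0V c0(2) by (simp add: Nd)
  have top: "top u \<in> VL" "\<psi>L (top u) = append_at N c0 u" "pr (top u) = \<one>\<^bsub>?H\<^esub>" if u: "u \<in> Eucl ?d" for u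
  proof -
    show 1: "top u \<in> VL" "\<psi>L (top u) = append_at N c0 u"
      unfolding top_def using top_im[OF u] by (auto intro: inv_into_into f_inv_into_f)
    have "\<psi> (pr (top u)) = \<psi> \<one>\<^bsub>?H\<^esub>" using psi_pr[OF 1(1)] 1(2) psi1 c0(2) by simp
    then show "pr (top u) = \<one>\<^bsub>?H\<^esub>" using inj_onD[OF atlas_inj[OF J V]] psi_pr[OF 1(1)] oneV by blast
  qed
  have VLc: "a \<in> carrier ?L" if "a \<in> VL" for a using that by (simp add: VL_def jet_domain_def)
  have Wc: "w \<in> carrier ?T" if "w \<in> W" for w using that by (simp add: W_def jet_domain_def)
  have trW: "\<pi> w \<in> V \<and> trunc N (\<xi> w) = \<psi> (\<pi> w)" if "w \<in> W" for w
    using trunc_jet_chart[OF J V, of w 1] that dims(1) by (simp add: W_def \<xi>_def \<pi>_def jet_domain_def)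
  have s: "s v \<in> W" "\<xi> (s v) = append_at N c0 v" "\<pi> (s v) = \<one>\<^bsub>?H\<^esub>" if v: "v \<in> Eucl (n * ?d)" for v
  proof -
    show 1: "s v \<in> W" "\<xi> (s v) = append_at N c0 v"
      unfolding s_def using s_im[OF v] by (auto intro: inv_into_into f_inv_into_f)
    have "\<psi> (\<pi> (s v)) = \<psi> \<one>\<^bsub>?H\<^esub>" using trW[OF 1(1)] 1(2) psi1 c0(2) by simp
    then show "\<pi> (s v) = \<one>\<^bsub>?H\<^esub>" using inj_onD[OF atlas_inj[OF J V]] trW[OF 1(1)] oneV by blast
  qed
  \<comment> \<open>The velocity of the embedded \<open>top u\<close> has the orders 1 to
    \<open>n + 1\<close>, hence is \<open>u\<close> preceded by \<open>n * ?d\<close> zeros, and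
    \<open>s v\<close> fills exactly those places. Adding the velocities concatenates
    \<open>v\<close> and \<open>u\<close>.\<close>
  have s_top: "\<xi> (s v \<otimes>\<^bsub>?T\<^esub> ?j (top u)) = append_at N c0 (append_at (n * ?d) v u)"
    "s v \<otimes>\<^bsub>?T\<^esub> ?j (top u) \<in> W"
    if v: "v \<in> Eucl (n * ?d)" and u: "u \<in> Eucl ?d" for v u
  proof -
    note tu = top[OF u] and sv = s[OF v]
    have 1: "s v \<in> carrier ?T" "?j (top u) \<in> carrier ?T" using Wc sv(1) jL VLc tu(1) by auto
    have 2: "\<pi> (?j (top u)) = \<one>\<^bsub>?H\<^esub>" using tu(3) by (simp add: pr_def)
    have "\<xi> (s v \<otimes>\<^bsub>?T\<^esub> ?j (top u)) = append_at N (\<psi> \<one>\<^bsub>?H\<^esub>) (\<lambda>i. shift N (\<xi> (s v)) i + shift N (\<xi> (?j (top u))) i)"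
      using jet_chart_mult_at_one[OF H, of V \<psi> "s v" "?j (top u)"] V oneV 1 sv(3) 2 dims(1)
      by (simp add: \<xi>_def \<pi>_def)
    also have "(\<lambda>i. shift N (\<xi> (s v)) i + shift N (\<xi> (?j (top u))) i) = append_at (n * ?d) v u"
      unfolding sv(2) xi_j[OF tu(1)] tu(2) shift_append
      using v c0(1) by (auto simp: append_at_def shift_def fun_eq_iff mem_Eucl Nd)
    finally show "\<xi> (s v \<otimes>\<^bsub>?T\<^esub> ?j (top u)) = append_at N c0 (append_at (n * ?d) v u)" unfolding psi1 .
    have "\<pi> (s v \<otimes>\<^bsub>?T\<^esub> ?j (top u)) = \<one>\<^bsub>?H\<^esub>" using hom_mult[OF \<pi> 1] unfolding sv(3) 2 H.l_one[OF H.one_closed] .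
    then show "s v \<otimes>\<^bsub>?T\<^esub> ?j (top u) \<in> W"
      using T.m_closed[OF 1] oneV unfolding W_def jet_domain_def \<pi>_def by simp
  qed

  \<comment> \<open>Construction of the section \<open>\<tau>\<close>. Completing a jet by a zero
    top derivative, \<open>ext\<close>, makes sense only inside the chart around the identity.
    Dividing by the constant jet at the base point brings every jet there, and multiplying by the
    constant jet of order \<open>n + 1\<close> brings the result back.\<close>
  define Z where "Z x = jet ?X (Suc n) (\<lambda>t. x)" for x
  define Z' where "Z' x = jet ?X n (\<lambda>t. x)" for x
  define \<beta> where "\<beta> a = (representative a 0 :: 'g)" for a
  define r where "r a = inv\<^bsub>?H\<^esub> (Z' (\<beta> a)) \<otimes>\<^bsub>?H\<^esub> a" for a
  define ext where "ext b = inv_into VL \<psi>L (\<psi> b)" for b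
  define \<tau> where "\<tau> a = Z (\<beta> a) \<otimes>\<^bsub>?L\<^esub> ext (r a)" for a
  have cst: "curve ?X (\<lambda>t. x)" if "x \<in> carrier G" for x
    using curve_const[OF at] that lie_group_points[OF G] by simp
  have Zc: "Z x \<in> carrier ?L" "Z' x \<in> carrier ?H" "pr (Z x) = Z' x" if "x \<in> carrier G" for x
    using jet_in_jets[OF cst[OF that]] pr_jet[OF cst[OF that]] by (simp_all add: Z_def Z'_def)
  have \<beta>: "\<beta> \<in> hom ?H G" unfolding \<beta>_def[abs_def] by (rule base_hom[OF G])
  note \<beta>c = hom_in_carrier[OF \<beta>]
  have r: "r a \<in> V" "r a \<in> carrier ?H" if a: "a \<in> carrier ?H" for a
  proof -
    note z = Zc(2)[OF \<beta>c[OF a]]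
    show 1: "r a \<in> carrier ?H" unfolding r_def by (intro H.m_closed H.inv_closed z a)
    have "\<beta> (Z' (\<beta> a)) = \<beta> a"
      unfolding Z'_def using representative_jet(3)[OF cst[OF \<beta>c[OF a]]] by (simp add: \<beta>_def)
    moreover have "\<beta> (inv\<^bsub>?H\<^esub> (Z' (\<beta> a))) = inv\<^bsub>G\<^esub> (\<beta> (Z' (\<beta> a)))"
      by (rule hom_inverse[OF H.is_group G.is_group \<beta> z])
    ultimately have "\<beta> (r a) = \<one>\<^bsub>G\<^esub>"
      unfolding r_def using hom_mult[OF \<beta> H.inv_closed[OF z] a] \<beta>c[OF a] by simp
    then show "r a \<in> V" using 1 U(2) by (simp add: V_def jet_domain_def \<beta>_def)
  qed
  have psiV: "\<psi> b \<in> \<psi>L ` VL" "\<psi> b \<in> Eucl N" if "b \<in> V" for b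
  proof -
    have "\<psi> b \<in> \<psi> ` V" using that by simp
    then have "\<psi> b \<in> Eucl N" "trunc ?d (\<psi> b) \<in> \<phi> ` U" unfolding imV by auto
    then show "\<psi> b \<in> \<psi>L ` VL" "\<psi> b \<in> Eucl N" unfolding imVL using E_mono[of "\<psi> b" N "N + ?d"] by auto
  qed
  have ext: "ext b \<in> VL" "pr (ext b) = b" if b: "b \<in> V" for b
  proof -
    show 1: "ext b \<in> VL" unfolding ext_def using psiV[OF b] by (auto intro: inv_into_into)
    have "\<psi>L (ext b) = \<psi> b" unfolding ext_def using psiV[OF b] by (auto intro: f_inv_into_f)
    then have "\<psi> (pr (ext b)) = \<psi> b" using psi_pr[OF 1] psiV[OF b] by simp
    then show "pr (ext b) = b" using inj_onD[OF atlas_inj[OF J V]] psi_pr[OF 1] b by blast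
  qed
  have \<tau>: "\<tau> a \<in> carrier ?L" "pr (\<tau> a) = a" if a: "a \<in> carrier ?H" for a
  proof -
    note z = Zc[OF \<beta>c[OF a]] and e = ext[OF r(1)[OF a]]
    show "\<tau> a \<in> carrier ?L" unfolding \<tau>_def by (rule L.m_closed[OF z(1) VLc[OF e(1)]])
    have "pr (\<tau> a) = Z' (\<beta> a) \<otimes>\<^bsub>?H\<^esub> r a"
      unfolding \<tau>_def pr_mult[OF z(1) VLc[OF e(1)]] e(2) z(3) ..
    also have "\<dots> = a"
      unfolding r_def H.m_assoc[OF z(2) H.inv_closed[OF z(2)] a, symmetric] H.r_inv[OF z(2)] by (rule H.l_one[OF a])
    finally show "pr (\<tau> a) = a" .
  qed
  have \<beta>s: "smooth_map ?J ?X \<beta>" unfolding \<beta>_def[abs_def] by (rule smooth_map_jet_base[OF at])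
  have Zs: "smooth_map ?X ?JL Z" unfolding Z_def[abs_def] by (rule smooth_map_jet_const[OF at])
  have Z's: "smooth_map ?X ?J Z'" unfolding Z'_def[abs_def] by (rule smooth_map_jet_const[OF at])
  note mH = smooth_map_mult[OF H, unfolded tangent_group_simps(3)] and iH = smooth_map_inv[OF H, unfolded tangent_group_simps(3)]
  note mL = smooth_map_mult[OF L, unfolded tangent_group_simps(3)]
  note mT = smooth_map_mult[OF T, unfolded tangent_group_simps(3)] and iT = smooth_map_inv[OF T, unfolded tangent_group_simps(3)]
  have rs: "smooth_map ?J ?J r"
    unfolding r_def[abs_def]
    by (rule mH[OF J iH[OF J smooth_map_comp[OF \<beta>s Z's J at J]] smooth_map_id[OF J]])
  have "smooth_map ?J (eucl N) (\<lambda>a. \<psi> (r a))"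
    using smooth_map_chart[OF rs J J V] r(1) dims(1) by auto
  from smooth_map_comp[OF this smooth_map_eucl[of "\<lambda>x. x" N "N + ?d"] J atlas_eucl atlas_eucl]
  have "smooth_map ?J (eucl (N + ?d)) (\<lambda>a. \<psi> (r a))"
    using E_mono[of _ N "N + ?d"] by (auto simp: smooth_euclidean_iff)
  then have "smooth_map ?J (eucl (mdim ?JL)) (\<lambda>a. \<psi> (r a))" by (simp only: dims)
  from smooth_map_inv_chart[OF this J JL VL] have "smooth_map ?J ?JL (\<lambda>a. ext (r a))"
    using psiV(1)[OF r(1)] by (auto simp: ext_def)
  then have \<tau>s: "smooth_map ?J ?JL \<tau>"
    unfolding \<tau>_def[abs_def] by (intro mL[OF J smooth_map_comp[OF \<beta>s Zs J at JL]])
  have tops: "smooth_map (eucl ?d) ?JL top"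
    unfolding top_def[abs_def]
  proof (rule smooth_map_inv_chart[OF _ atlas_eucl JL VL])
    show "smooth_map (eucl ?d) (eucl (mdim ?JL)) (append_at N c0)"
      unfolding dims
    proof (rule smooth_map_eucl)
      show "smooth_euclidean ?d (N + ?d) (Eucl ?d) (append_at N c0)"
        unfolding smooth_euclidean_iff append_at_def by (auto intro!: smooth_on_if)
    qed auto
  qed (use top_im in auto)
  have ss: "smooth_map (eucl (n * ?d)) (jet_manifold ?J 1) s"
    unfolding s_def[abs_def]
  proof (rule smooth_map_inv_chart[OF _ atlas_eucl JT W])
    show "smooth_map (eucl (n * ?d)) (eucl (mdim (jet_manifold ?J 1))) (append_at N c0)"
      unfolding dims
    proof (rule smooth_map_eucl)
      show "smooth_euclidean (n * ?d) (N + N) (Eucl (n * ?d)) (append_at N c0)"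
        unfolding smooth_euclidean_iff append_at_def by (auto intro!: smooth_on_if)
      show "append_at N c0 ` Eucl (n * ?d) \<subseteq> Eucl (N + N)"
        using E_mono[of _ "n * ?d" N] by (auto simp: Nd intro!: append_at_mem)
    qed
  qed (use s_im in auto)

  \<comment> \<open>\<open>\<omega> w\<close> is \<open>w\<close> moved to the fibre over the
    identity by an embedded jet with base point \<open>\<pi> w\<close>, and \<open>y w\<close> is
    its velocity. The first \<open>n * ?d\<close> coordinates of \<open>y w\<close> give the
    complement, the last \<open>?d\<close> a top derivative, and the factor
    \<open>\<tau> (\<pi> w)\<close> undoes the move.\<close>
  define \<omega> where "\<omega> w = w \<otimes>\<^bsub>?T\<^esub> inv\<^bsub>?T\<^esub> (?j (\<tau> (\<pi> w)))" for w
  define y where "y w = shift N (\<xi> (\<omega> w))" for w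
  define \<theta> where "\<theta> w = (trunc (n * ?d) (y w), top (shift (n * ?d) (y w)) \<otimes>\<^bsub>?L\<^esub> \<tau> (\<pi> w))" for w
  note \<pi>c = hom_in_carrier[OF \<pi>]
  have \<omega>: "\<omega> w \<in> W" "\<xi> (\<omega> w) = append_at N c0 (y w)" "y w \<in> Eucl N" if w: "w \<in> carrier ?T" for w
  proof -
    note t = \<tau>[OF \<pi>c[OF w]]
    have c: "\<omega> w \<in> carrier ?T" unfolding \<omega>_def by (intro T.m_closed T.inv_closed w jL t(1))
    have "\<pi> (inv\<^bsub>?T\<^esub> (?j (\<tau> (\<pi> w)))) = inv\<^bsub>?H\<^esub> (\<pi> (?j (\<tau> (\<pi> w))))"
      by (rule hom_inverse[OF T.is_group H.is_group \<pi> jL[OF t(1)]])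
    also have "\<pi> (?j (\<tau> (\<pi> w))) = \<pi> w" using t(2) by (simp add: pr_def)
    finally have i: "\<pi> (inv\<^bsub>?T\<^esub> (?j (\<tau> (\<pi> w)))) = inv\<^bsub>?H\<^esub> (\<pi> w)" .
    have 1: "\<pi> (\<omega> w) = \<one>\<^bsub>?H\<^esub>"
      unfolding \<omega>_def hom_mult[OF \<pi> w T.inv_closed[OF jL[OF t(1)]]] i by (rule H.r_inv[OF \<pi>c[OF w]])
    show 2: "\<omega> w \<in> W" using 1 c oneV unfolding W_def jet_domain_def \<pi>_def by simp
    have "trunc N (\<xi> (\<omega> w)) = c0" using trW[OF 2] 1 psi1 by simp
    then show "\<xi> (\<omega> w) = append_at N c0 (y w)" unfolding y_def by (rule append_at_trunc_shift)
    have "\<xi> (\<omega> w) \<in> \<xi> ` W" using 2 by simp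
    then show "y w \<in> Eucl N" unfolding imW y_def by auto
  qed
  have yd: "shift (n * ?d) (y w) \<in> Eucl ?d" if "w \<in> carrier ?T" for w
    using \<omega>(3)[OF that] unfolding Nd by simp
  \<comment> \<open>Both sides lie in \<open>W\<close> and have the same coordinates.\<close>
  have split: "\<omega> w = s (trunc (n * ?d) (y w)) \<otimes>\<^bsub>?T\<^esub> ?j (top (shift (n * ?d) (y w)))" if w: "w \<in> carrier ?T" for w
    using inj_onD[OF atlas_inj[OF JT W] _ \<omega>(1)[OF w] s_top(2)[OF trunc_mem yd[OF w]]]
      s_top(1)[OF trunc_mem yd[OF w]] \<omega>(2)[OF w] by simp
  have "complement (n * ?d) ?L ?T ?j s \<theta>"
    unfolding complement_def
  proof (intro conjI ballI)
    show "?j \<in> hom ?L ?T" by (rule j)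
    show "smooth_map (mfd ?L) (mfd ?T) ?j" using js by simp
    show "smooth_map (eucl (n * ?d)) (mfd ?T) s" using ss by simp
    have p\<tau>: "smooth_map (jet_manifold ?J 1) ?JL (\<lambda>w. \<tau> (\<pi> w))" by (rule smooth_map_comp[OF \<pi>s \<tau>s JT J JL])
    have "smooth_map (jet_manifold ?J 1) (jet_manifold ?J 1) \<omega>"
      unfolding \<omega>_def[abs_def] by (rule mT[OF JT smooth_map_id[OF JT] iT[OF JT smooth_map_comp[OF p\<tau> js JT JL JT]]])
    from smooth_map_chart[OF this JT JT W] have xs: "smooth_map (jet_manifold ?J 1) (eucl (N + N)) (\<lambda>w. \<xi> (\<omega> w))"
      using \<omega>(1) dims(3) by auto
    have "smooth_map (eucl (N + N)) (eucl N) (shift N)" by (rule smooth_map_eucl) auto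
    from smooth_map_comp[OF xs this JT atlas_eucl atlas_eucl] have ys: "smooth_map (jet_manifold ?J 1) (eucl N) y"
      unfolding y_def[abs_def] .
    have "smooth_map (eucl N) (eucl (n * ?d)) (trunc (n * ?d))" by (rule smooth_map_eucl) (auto intro: smooth_euclidean_trunc)
    note t1 = smooth_map_comp[OF ys this JT atlas_eucl atlas_eucl]
    have "smooth_map (eucl N) (eucl ?d) (shift (n * ?d))" by (rule smooth_map_eucl) (auto simp: Nd)
    note t2 = smooth_map_comp[OF smooth_map_comp[OF ys this JT atlas_eucl atlas_eucl] tops JT atlas_eucl JL]
    show "smooth_map (mfd ?T) (product_manifold (eucl (n * ?d)) (mfd ?L)) \<theta>"
      unfolding \<theta>_def[abs_def] tangent_group_simps by (rule smooth_map_Pair[OF t1 mL[OF JT t2 p\<tau>] JT atlas_eucl JL])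
  next
    fix v h assume v: "v \<in> Eucl (n * ?d)" and h: "h \<in> carrier ?L"
    define w where "w = s v \<otimes>\<^bsub>?T\<^esub> ?j h"
    \<comment> \<open>\<open>k\<close> is \<open>h\<close> with its truncation divided out. It is
      trivial up to order \<open>n\<close>, hence it is \<open>top u\<close> for its own top
      derivative \<open>u\<close>.\<close>
    define k where "k = h \<otimes>\<^bsub>?L\<^esub> inv\<^bsub>?L\<^esub> (\<tau> (pr h))"
    note t = \<tau>[OF pr_closed[OF h]]
    note sc = Wc[OF s(1)[OF v]]
    have w: "w \<in> carrier ?T" unfolding w_def by (intro T.m_closed sc jL h)
    have \<pi>w: "\<pi> w = pr h"

      unfolding w_def hom_mult[OF \<pi> sc jL[OF h]] s(3)[OF v] pr_def[symmetric] by (rule H.l_one[OF pr_closed[OF h]])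
    have k: "k \<in> carrier ?L" unfolding k_def by (intro L.m_closed L.inv_closed h t(1))
    have "pr k = \<one>\<^bsub>?H\<^esub>"
      unfolding k_def pr_mult[OF h L.inv_closed[OF t(1)]] pr_inv[OF t(1)] t(2) by (rule H.r_inv[OF pr_closed[OF h]])
    moreover obtain p where p: "curve ?X p" "k = jet ?X (Suc n) p" using k jets_cases[of k ?X "Suc n"] by auto
    ultimately have "jet ?X n p = jet ?X n (\<lambda>t. \<one>\<^bsub>G\<^esub>)" using pr_jet[OF p(1)] by simp
    then have "p 0 = \<one>\<^bsub>G\<^esub>" using representative_jet(3)[OF p(1), of n] representative_jet(3)[OF cone, of n] by simp
    then have kV: "k \<in> VL" unfolding VL_def p(2) using p(1) U(2) by simp
    have "trunc N (\<psi>L k) = c0" using psi_pr[OF kV] \<open>pr k = \<one>\<^bsub>?H\<^esub>\<close> psi1 by simp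
    then have k1: "\<psi>L k = append_at N c0 (shift N (\<psi>L k))" by (rule append_at_trunc_shift)
    define u where "u = shift N (\<psi>L k)"
    have "\<psi>L k \<in> \<psi>L ` VL" using kV by simp
    then have u: "u \<in> Eucl ?d" unfolding imVL u_def by auto
    have topu: "top u = k"
      unfolding top_def u_def k1[symmetric] by (rule inv_into_f_f[OF atlas_inj[OF JL VL] kV])
    have "?j (inv\<^bsub>?L\<^esub> (\<tau> (pr h))) = inv\<^bsub>?T\<^esub> (?j (\<tau> (pr h)))"
      by (rule hom_inverse[OF L.is_group T.is_group j t(1)])
    then have jk: "?j k = ?j h \<otimes>\<^bsub>?T\<^esub> inv\<^bsub>?T\<^esub> (?j (\<tau> (pr h)))"
      unfolding k_def hom_mult[OF j h L.inv_closed[OF t(1)]] by simp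
    have "\<omega> w = w \<otimes>\<^bsub>?T\<^esub> inv\<^bsub>?T\<^esub> (?j (\<tau> (pr h)))" unfolding \<omega>_def \<pi>w ..
    also have "\<dots> = s v \<otimes>\<^bsub>?T\<^esub> ?j k"
      unfolding w_def jk by (rule T.m_assoc[OF sc jL[OF h] T.inv_closed[OF jL[OF t(1)]]])
    finally have "\<omega> w = s v \<otimes>\<^bsub>?T\<^esub> ?j k" .
    then have "y w = append_at (n * ?d) v u" unfolding y_def using s_top(1)[OF v u] topu by simp
    then have "\<theta> w = (v, k \<otimes>\<^bsub>?L\<^esub> \<tau> (pr h))" unfolding \<theta>_def \<pi>w using v topu by simp
    also have "k \<otimes>\<^bsub>?L\<^esub> \<tau> (pr h) = h"
      unfolding k_def L.m_assoc[OF h L.inv_closed[OF t(1)] t(1)] L.l_inv[OF t(1)] by (rule L.r_one[OF h])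
    finally show "\<theta> (s v \<otimes>\<^bsub>?T\<^esub> ?j h) = (v, h)" unfolding w_def .
  next
    fix w assume w: "w \<in> carrier ?T"
    note t = \<tau>[OF \<pi>c[OF w]]
    note tc = VLc[OF top(1)[OF yd[OF w]]] and sc = Wc[OF s(1)[OF trunc_mem, of "y w"]]
    have "s (fst (\<theta> w)) \<otimes>\<^bsub>?T\<^esub> ?j (snd (\<theta> w)) = \<omega> w \<otimes>\<^bsub>?T\<^esub> ?j (\<tau> (\<pi> w))"
      unfolding \<theta>_def fst_conv snd_conv split[OF w] hom_mult[OF j tc t(1)]
      using T.m_assoc[OF sc jL[OF tc] jL[OF t(1)]] by simp
    also have "\<dots> = w"
      unfolding \<omega>_def T.m_assoc[OF w T.inv_closed[OF jL[OF t(1)]] jL[OF t(1)]] T.l_inv[OF jL[OF t(1)]]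
      by (rule T.r_one[OF w])
    finally show "s (fst (\<theta> w)) \<otimes>\<^bsub>?T\<^esub> ?j (snd (\<theta> w)) = w" .
  qed
  then show ?thesis unfolding complemented_def by blast
qed

section \<open>Powers of the Lie algebra\<close>

context
  fixes G :: "'g lie"
  assumes G: "lie_group G"
begin

lemma lie_algebra_memD:
  assumes "c \<in> lie_algebra G"
  shows "c \<in> jets (mfd G) 1" "representative c 0 = \<one>\<^bsub>G\<^esub>"
  using assms jet_in_jets representative_jet(3) unfolding lie_algebra_def by fastforce+

definition tangent_coords :: "('g \<Rightarrow> nat \<Rightarrow> real) \<Rightarrow> (real \<Rightarrow> 'g) set \<Rightarrow> nat \<Rightarrow> real" where
  "tangent_coords \<phi> c = (\<lambda>i. if i < mdim (mfd G) then deriv (\<lambda>t. \<phi> (representative c t) i) 0 else 0)"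

lemma jet_chart_lie_algebra:
  assumes U: "(U, \<phi>) \<in> charts (mfd G)" "\<one>\<^bsub>G\<^esub> \<in> U" and c: "c \<in> lie_algebra G"
  shows "jet_chart (mfd G) 1 \<phi> c = append_at (mdim (mfd G)) (\<phi> \<one>\<^bsub>G\<^esub>) (tangent_coords \<phi> c)"
  unfolding jet_chart_def tangent_coords_def
  using jet_coords_1[of "\<lambda>t. \<phi> (representative c t)" 0 "mdim (mfd G)"] lie_algebra_memD[OF c]
    atlas_mem[OF lie_group_atlas[OF G] U] by simp

lemma tangent_coords_mem [simp]: "tangent_coords \<phi> c \<in> Eucl (mdim (mfd G))"
  by (auto simp: tangent_coords_def mem_Eucl)

lemma tangent_coords_inj:
  assumes U: "(U, \<phi>) \<in> charts (mfd G)" "\<one>\<^bsub>G\<^esub> \<in> U" and c: "c \<in> lie_algebra G" "c' \<in> lie_algebra G"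
    and eq: "tangent_coords \<phi> c = tangent_coords \<phi> c'"
  shows "c = c'"
proof (rule inj_onD[OF inj_on_jet_chart[OF lie_group_atlas[OF G] U(1), of 1]])
  show "jet_chart (mfd G) 1 \<phi> c = jet_chart (mfd G) 1 \<phi> c'"
    unfolding jet_chart_lie_algebra[OF U c(1)] jet_chart_lie_algebra[OF U c(2)] eq ..
qed (use lie_algebra_memD[OF c(1)] lie_algebra_memD[OF c(2)] U in \<open>auto simp: jet_domain_def\<close>)

lemma tangent_coords_surj:
  assumes U: "(U, \<phi>) \<in> charts (mfd G)" "\<one>\<^bsub>G\<^esub> \<in> U" and x: "x \<in> Eucl (mdim (mfd G))"
  obtains c where "c \<in> lie_algebra G" "tangent_coords \<phi> c = x"
proof -
  let ?d = "mdim (mfd G)"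
  note at = lie_group_atlas[OF G]
  have "append_at ?d (\<phi> \<one>\<^bsub>G\<^esub>) x \<in> jet_chart (mfd G) 1 \<phi> ` jet_domain (mfd G) 1 U"
    unfolding jet_chart_image[OF at U(1) order_refl] using x U(2) atlas_mem[OF at U] by simp
  then obtain c where c: "c \<in> jet_domain (mfd G) 1 U" "jet_chart (mfd G) 1 \<phi> c = append_at ?d (\<phi> \<one>\<^bsub>G\<^esub>) x" by auto
  obtain p where p: "curve (mfd G) p" "c = jet (mfd G) 1 p" "p 0 \<in> U" using jet_domain_cases[OF c(1)] by metis
  have "\<phi> (p 0) = \<phi> \<one>\<^bsub>G\<^esub>"
    using trunc_jet_chart[OF at U(1) c(1)] c(2) atlas_mem[OF at U] representative_jet(3)[OF p(1)] by (simp add: p(2))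
  then have "p 0 = \<one>\<^bsub>G\<^esub>" using inj_onD[OF atlas_inj[OF at U(1)]] p(3) U(2) by blast
  then have l: "c \<in> lie_algebra G" unfolding lie_algebra_def p(2) using p(1) by blast
  have "tangent_coords \<phi> c = x"
    using c(2) unfolding jet_chart_lie_algebra[OF U l] by (metis shift_append)
  with l show thesis by (rule that)
qed

text \<open>Velocities transform by the Jacobi matrix of the change of charts. It is taken at the
  coordinates of the identity, so the same matrix serves all elements of the Lie algebra.\<close>

lemma tangent_coords_change:
  assumes U: "(U, \<phi>) \<in> charts (mfd G)" "\<one>\<^bsub>G\<^esub> \<in> U" and V: "(V, \<psi>) \<in> charts (mfd G)" "\<one>\<^bsub>G\<^esub> \<in> V"
  obtains A where "\<And>c i. c \<in> lie_algebra G \<Longrightarrow> i < mdim (mfd G) \<Longrightarrow>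
    tangent_coords \<psi> c i = (\<Sum>k<mdim (mfd G). A i k * tangent_coords \<phi> c k)"
proof -
  let ?X = "mfd G" and ?d = "mdim (mfd G)"
  note at = lie_group_atlas[OF G]
  obtain F where F: "eopen ?d (\<phi> ` (U \<inter> V))" "smooth_euclidean ?d ?d (\<phi> ` (U \<inter> V)) F"
    "\<And>x. x \<in> U \<Longrightarrow> x \<in> V \<Longrightarrow> F (\<phi> x) = \<psi> x" using atlas_changeE[OF at U(1) V(1)] by blast
  show thesis
  proof (rule that)
    fix c i assume c: "c \<in> lie_algebra G" and i: "i < ?d"
    define p where "p = representative c"
    have p: "curve ?X p" "p 0 = \<one>\<^bsub>G\<^esub>"
      using lie_algebra_memD[OF c] jets_representative(1) by (auto simp: p_def)
    then have p0: "p 0 \<in> U" "p 0 \<in> V" using U V by auto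
    obtain e where e: "chart_curve ?X U \<phi> e p" using curve_in_chart[OF at p(1) U(1) p0(1)] .
    note evU = eventually_in_chart[OF at p(1) U(1) p0(1)] and evV = eventually_in_chart[OF at p(1) V(1) p0(2)]
    have "deriv (\<lambda>t. \<psi> (p t) i) 0 = deriv (\<lambda>t. F (\<phi> (p t)) i) 0"
      by (rule deriv_cong_ev[OF eventually_mono[OF eventually_conj[OF evU evV]] refl]) (use F(3) in simp)
    also have "\<dots> = (\<Sum>k<?d. pd k (\<lambda>x. F x i) (\<phi> (p 0)) * tangent_coords \<phi> c k)"
    proof (rule deriv_compose[OF F(1)])
      show "smooth_on ?d (\<phi> ` (U \<inter> V)) (\<lambda>x. F x i)" using F(2) i by (simp add: smooth_euclidean_iff)
      show "\<phi> (p 0) \<in> \<phi> ` (U \<inter> V)" using p0 by blast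
      show "eventually (\<lambda>t. \<phi> (p t) \<in> Eucl ?d) (nhds 0)"
        by (rule eventually_mono[OF evU]) (rule atlas_mem[OF at U(1)])
      fix k assume k: "k < ?d"
      have "smooth_real {-e<..<e} (\<lambda>t. \<phi> (p t) k)" "0 \<in> {-e<..<e}" using e k unfolding chart_curve_def by auto
      from smooth_real_has_derivative[OF this]
      show "((\<lambda>s. \<phi> (p s) k) has_real_derivative tangent_coords \<phi> c k) (at 0)"
        using k by (simp add: tangent_coords_def p_def)
    qed
    finally show "tangent_coords \<psi> c i = (\<Sum>k<?d. pd k (\<lambda>x. F x i) (\<phi> \<one>\<^bsub>G\<^esub>) * tangent_coords \<phi> c k)"
      using i p(2) by (simp add: tangent_coords_def p_def)
  qed
qed

text \<open>The coordinate map of \<open>lie_algebra_power\<close>, with the differential of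
  \<open>\<phi>\<close> isolated as \<open>tangent_coords\<close>.\<close>

definition power_coords :: "nat \<Rightarrow> ('g \<Rightarrow> nat \<Rightarrow> real) \<Rightarrow> (nat \<Rightarrow> (real \<Rightarrow> 'g) set) \<Rightarrow> nat \<Rightarrow> real" where
  "power_coords m \<phi> X = (\<lambda>j. if j < m * mdim (mfd G)
     then tangent_coords \<phi> (X (j div mdim (mfd G))) (j mod mdim (mfd G)) else 0)"

lemma charts_lie_algebra_power:
  "charts (lie_algebra_power G m) =
    {(\<Pi>\<^sub>E l\<in>{..<m}. lie_algebra G, power_coords m \<phi>) | U \<phi>. (U, \<phi>) \<in> charts (mfd G) \<and> \<one>\<^bsub>G\<^esub> \<in> U}"
proof -
  have "(\<lambda>X j. if j < m * mdim (mfd G)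
      then deriv (\<lambda>t. \<phi> (representative (X (j div mdim (mfd G))) t) (j mod mdim (mfd G))) 0 else 0) = power_coords m \<phi>" for \<phi>
  proof (intro ext)
    fix X j
    have "j mod mdim (mfd G) < mdim (mfd G)" if "j < m * mdim (mfd G)" using that by (cases "mdim (mfd G)") auto
    then show "(if j < m * mdim (mfd G)
      then deriv (\<lambda>t. \<phi> (representative (X (j div mdim (mfd G))) t) (j mod mdim (mfd G))) 0 else 0) = power_coords m \<phi> X j"
      by (simp add: power_coords_def tangent_coords_def)
  qed
  then show ?thesis by (simp add: lie_algebra_power_def Let_def)
qed

lemma mdim_lie_algebra_power [simp]: "mdim (lie_algebra_power G m) = m * mdim (mfd G)"
  by (simp add: lie_algebra_power_def Let_def)

lemma index_less: "l < m \<Longrightarrow> i < d \<Longrightarrow> l * d + i < m * (d :: nat)"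
  using mult_le_mono1[of "Suc l" m d] by simp

lemma power_coords_inj:
  assumes U: "(U, \<phi>) \<in> charts (mfd G)" "\<one>\<^bsub>G\<^esub> \<in> U"
  shows "inj_on (power_coords m \<phi>) (\<Pi>\<^sub>E l\<in>{..<m}. lie_algebra G)"
proof (rule inj_onI)
  let ?d = "mdim (mfd G)"
  fix X Y assume X: "X \<in> (\<Pi>\<^sub>E l\<in>{..<m}. lie_algebra G)" and Y: "Y \<in> (\<Pi>\<^sub>E l\<in>{..<m}. lie_algebra G)"
    and eq: "power_coords m \<phi> X = power_coords m \<phi> Y"
  show "X = Y"
  proof (rule PiE_ext[OF X Y])
    fix l assume l: "l \<in> {..<m}"
    show "X l = Y l"
    proof (rule tangent_coords_inj[OF U])
      show "tangent_coords \<phi> (X l) = tangent_coords \<phi> (Y l)"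
      proof
        fix i
        show "tangent_coords \<phi> (X l) i = tangent_coords \<phi> (Y l) i"
        proof (cases "i < ?d")
          case True
          then show ?thesis
            using fun_cong[OF eq, of "l * ?d + i"] index_less[OF _ True, of l m] l by (simp add: power_coords_def)
        qed (simp add: tangent_coords_def)
      qed
    qed (use PiE_mem[OF X l] PiE_mem[OF Y l] in auto)
  qed
qed

text \<open>Each block of \<open>mdim (mfd G)\<close> numbers is the velocity of some tangent vector
  at the identity, so the chart reaches the whole Euclidean space.\<close>

lemma power_coords_image:
  assumes U: "(U, \<phi>) \<in> charts (mfd G)" "\<one>\<^bsub>G\<^esub> \<in> U"
  shows "power_coords m \<phi> ` (\<Pi>\<^sub>E l\<in>{..<m}. lie_algebra G) = Eucl (m * mdim (mfd G))"
proof
  let ?d = "mdim (mfd G)"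
  show "power_coords m \<phi> ` (\<Pi>\<^sub>E l\<in>{..<m}. lie_algebra G) \<subseteq> Eucl (m * ?d)"
    by (auto simp: power_coords_def mem_Eucl)
  show "Eucl (m * ?d) \<subseteq> power_coords m \<phi> ` (\<Pi>\<^sub>E l\<in>{..<m}. lie_algebra G)"
  proof
    fix x assume x: "x \<in> Eucl (m * ?d)"
    have "\<exists>c. c \<in> lie_algebra G \<and> tangent_coords \<phi> c = trunc ?d (\<lambda>i. x (l * ?d + i))" for l
      using tangent_coords_surj[OF U trunc_mem] by metis
    then obtain c where c: "\<And>l. c l \<in> lie_algebra G" "\<And>l. tangent_coords \<phi> (c l) = trunc ?d (\<lambda>i. x (l * ?d + i))"
      by metis
    \<comment> \<open>Outside the index set \<open>PiE\<close> demands the value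
      \<open>undefined\<close>, which \<open>restrict\<close> supplies.\<close>
    have "power_coords m \<phi> (restrict c {..<m}) = x"
    proof
      fix j
      show "power_coords m \<phi> (restrict c {..<m}) j = x j"
      proof (cases "j < m * ?d")
        case True
        then have "j mod ?d < ?d" by (cases ?d) auto
        moreover have "j div ?d < m" using less_mult_imp_div_less[OF True] .
        ultimately show ?thesis using True by (simp add: power_coords_def c(2) trunc_def)
      next
        case False
        then show ?thesis using x by (simp add: power_coords_def mem_Eucl)
      qed
    qed
    moreover have "restrict c {..<m} \<in> (\<Pi>\<^sub>E l\<in>{..<m}. lie_algebra G)" using c(1) by auto
    ultimately show "x \<in> power_coords m \<phi> ` (\<Pi>\<^sub>E l\<in>{..<m}. lie_algebra G)" by blast
  qed
qed

text \<open>Changing the chart of \<open>G\<close> acts on every entry of a tuple by one and the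
  same matrix, so the transition maps are linear.\<close>

lemma atlas_lie_algebra_power: "atlas (lie_algebra_power G m)"
proof (rule atlasI)
  let ?d = "mdim (mfd G)" and ?P = "\<Pi>\<^sub>E l\<in>{..<m}. lie_algebra G"
  fix U' \<phi>' assume "(U', \<phi>') \<in> charts (lie_algebra_power G m)"
  then obtain U \<phi> where U: "(U, \<phi>) \<in> charts (mfd G)" "\<one>\<^bsub>G\<^esub> \<in> U" "U' = ?P" "\<phi>' = power_coords m \<phi>"
    unfolding charts_lie_algebra_power by blast
  show "inj_on \<phi>' U'" unfolding U(3,4) by (rule power_coords_inj[OF U(1,2)])
  fix V' \<psi>' assume "(V', \<psi>') \<in> charts (lie_algebra_power G m)"
  then obtain V \<psi> where V: "(V, \<psi>) \<in> charts (mfd G)" "\<one>\<^bsub>G\<^esub> \<in> V" "V' = ?P" "\<psi>' = power_coords m \<psi>"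
    unfolding charts_lie_algebra_power by blast
  have im: "\<phi>' ` (U' \<inter> V') = Eucl (m * ?d)" unfolding U(3,4) V(3) Int_absorb by (rule power_coords_image[OF U(1,2)])
  then show "eopen (mdim (lie_algebra_power G m)) (\<phi>' ` (U' \<inter> V'))" by simp
  obtain A where A: "\<And>c i. c \<in> lie_algebra G \<Longrightarrow> i < ?d \<Longrightarrow>
      tangent_coords \<psi> c i = (\<Sum>k<?d. A i k * tangent_coords \<phi> c k)"
    using tangent_coords_change[OF U(1,2) V(1,2)] by blast
  define F where "F x j = (if j < m * ?d then \<Sum>k<?d. A (j mod ?d) k * x (j div ?d * ?d + k) else 0)" for x :: "nat \<Rightarrow> real" and j
  have "smooth_euclidean (m * ?d) (m * ?d) (\<phi>' ` (U' \<inter> V')) F"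
    unfolding smooth_euclidean_iff F_def
    by (intro allI impI smooth_on_if smooth_on_sum smooth_on_mult smooth_on_const smooth_on_coordinate)
  moreover have "F (\<phi>' X) = \<psi>' X" if "X \<in> U' \<inter> V'" for X
  proof
    fix j
    have X: "X \<in> ?P" using that U(3) by simp
    show "F (\<phi>' X) j = \<psi>' X j"
    proof (cases "j < m * ?d")
      case True
      then have i: "j mod ?d < ?d" by (cases ?d) auto
      have l: "j div ?d < m" using less_mult_imp_div_less[OF True] .
      have "power_coords m \<phi> X (j div ?d * ?d + k) = tangent_coords \<phi> (X (j div ?d)) k" if "k < ?d" for k
        using index_less[OF l that] that by (simp add: power_coords_def)
      moreover have "X (j div ?d) \<in> lie_algebra G" using PiE_mem[OF X, of "j div ?d"] l by simp
      ultimately show ?thesis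
        using True A[OF _ i] by (simp add: F_def U(4) V(4) power_coords_def[of m \<psi>])
    next
      case False
      then show ?thesis by (simp add: F_def V(4) power_coords_def)
    qed
  qed
  ultimately show "\<exists>F. smooth_euclidean (mdim (lie_algebra_power G m)) (mdim (lie_algebra_power G m)) (\<phi>' ` (U' \<inter> V')) F \<and>
      (\<forall>x\<in>U' \<inter> V'. F (\<phi>' x) = \<psi>' x)" by auto
qed

lemma exists_chart_at_one:
  obtains U \<phi> where "(U, \<phi>) \<in> charts (mfd G)" "\<one>\<^bsub>G\<^esub> \<in> U"
proof -
  interpret group G by (rule lie_group_group[OF G])
  show thesis using points_cover[of "\<one>\<^bsub>G\<^esub>" "mfd G"] lie_group_points[OF G] that by auto
qed

lemma smooth_manifold_lie_algebra_power: "smooth_manifold (lie_algebra_power G m)"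
proof (rule smooth_manifold_global_charts[OF atlas_lie_algebra_power])
  obtain U \<phi> where "(U, \<phi>) \<in> charts (mfd G)" "\<one>\<^bsub>G\<^esub> \<in> U" using exists_chart_at_one .
  then have "(\<Pi>\<^sub>E l\<in>{..<m}. lie_algebra G, power_coords m \<phi>) \<in> charts (lie_algebra_power G m)"
    unfolding charts_lie_algebra_power by blast
  then show "charts (lie_algebra_power G m) \<noteq> {}" by auto
  show "U = (\<Pi>\<^sub>E l\<in>{..<m}. lie_algebra G)" if "(U, \<phi>) \<in> charts (lie_algebra_power G m)" for U \<phi>
    using that unfolding charts_lie_algebra_power by blast
qed

text \<open>Any single chart is global and onto, so together with its inverse it is a
  diffeomorphism.\<close>

lemma lie_algebra_power_eucl:
  obtains e e' where "smooth_map (lie_algebra_power G m) (eucl (m * mdim (mfd G))) e"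
    "smooth_map (eucl (m * mdim (mfd G))) (lie_algebra_power G m) e'"
    "\<And>x. x \<in> points (lie_algebra_power G m) \<Longrightarrow> e' (e x) = x"
    "\<And>y. y \<in> Eucl (m * mdim (mfd G)) \<Longrightarrow> e (e' y) = y"
proof -
  let ?M = "lie_algebra_power G m" and ?P = "\<Pi>\<^sub>E l\<in>{..<m}. lie_algebra G"
  note at = atlas_lie_algebra_power
  obtain U \<phi> where U: "(U, \<phi>) \<in> charts (mfd G)" "\<one>\<^bsub>G\<^esub> \<in> U" using exists_chart_at_one .
  have c: "(?P, power_coords m \<phi>) \<in> charts ?M" unfolding charts_lie_algebra_power using U by blast
  have p: "points ?M = ?P"
  proof
    show "points ?M \<subseteq> ?P" unfolding points_def charts_lie_algebra_power by auto
    show "?P \<subseteq> points ?M" by (rule subsetI) (rule in_points[OF c])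
  qed
  show thesis
  proof (rule that)
    show "smooth_map ?M (eucl (m * mdim (mfd G))) (power_coords m \<phi>)"
      using smooth_map_chart[OF smooth_map_id[OF at] at at c] p by simp
    show "smooth_map (eucl (m * mdim (mfd G))) ?M (inv_into ?P (power_coords m \<phi>))"
      using smooth_map_inv_chart[OF _ atlas_eucl at c, of "m * mdim (mfd G)" "\<lambda>x. x"]
        smooth_map_id[OF atlas_eucl, of "m * mdim (mfd G)"] power_coords_image[OF U] by simp
    show "inv_into ?P (power_coords m \<phi>) (power_coords m \<phi> x) = x" if "x \<in> points ?M" for x
      using that p inv_into_f_f[OF power_coords_inj[OF U]] by simp
    show "power_coords m \<phi> (inv_into ?P (power_coords m \<phi>) y) = y" if "y \<in> Eucl (m * mdim (mfd G))" for y
      using that f_inv_into_f[of y "power_coords m \<phi>" ?P] power_coords_image[OF U] by simp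
  qed
qed

end

section \<open>Cocycle matched pairs from complements\<close>

lemma matched_pair_of_decomposition:
  fixes K :: "'k lie" and H :: "'h lie" and M :: "'m manifold"
  assumes K: "lie_group K" and H: "lie_group H" and M: "smooth_manifold M"
    and \<iota>: "\<iota> \<in> hom H K" "smooth_map (mfd H) (mfd K) \<iota>"
    and S: "smooth_map M (mfd K) S" and P: "smooth_map (mfd K) M P" and Q: "smooth_map (mfd K) (mfd H) Q"
    and eqP: "\<And>m h. m \<in> points M \<Longrightarrow> h \<in> carrier H \<Longrightarrow> P (S m \<otimes>\<^bsub>K\<^esub> \<iota> h) = m"
    and eqQ: "\<And>m h. m \<in> points M \<Longrightarrow> h \<in> carrier H \<Longrightarrow> Q (S m \<otimes>\<^bsub>K\<^esub> \<iota> h) = h"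
    and split: "\<And>k. k \<in> carrier K \<Longrightarrow> S (P k) \<otimes>\<^bsub>K\<^esub> \<iota> (Q k) = k"
    and z: "z \<in> points M" "S z = \<one>\<^bsub>K\<^esub>"
  defines "act \<equiv> \<lambda>h m. P (\<iota> h \<otimes>\<^bsub>K\<^esub> S m)" and "\<sigma> \<equiv> \<lambda>h m. Q (\<iota> h \<otimes>\<^bsub>K\<^esub> S m)"
    and "\<Phi> \<equiv> \<lambda>m m'. P (S m \<otimes>\<^bsub>K\<^esub> S m')" and "\<gamma> \<equiv> \<lambda>m m'. Q (S m \<otimes>\<^bsub>K\<^esub> S m')"
  shows "cocycle_matched_pair M z H act \<sigma> \<Phi> \<gamma>"
    and "lie_group_isomorphic K (cocycle_double_cross_product M z H act \<sigma> \<Phi> \<gamma>)"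
proof -
  interpret K: group K by (rule lie_group_group[OF K])
  interpret H: group H by (rule lie_group_group[OF H])
  note atK = lie_group_atlas[OF K] and atH = lie_group_atlas[OF H] and atM = smooth_manifold_atlas[OF M]
  have [simp]: "\<iota> h \<in> carrier K" if "h \<in> carrier H" for h using hom_in_carrier[OF \<iota>(1) that] .
  have [simp]: "S m \<in> carrier K" if "m \<in> points M" for m
    using smooth_map_points[OF S that] lie_group_points[OF K] by simp
  have [simp]: "P k \<in> points M" "Q k \<in> carrier H" if "k \<in> carrier K" for k
    using smooth_map_points[OF P] smooth_map_points[OF Q] that lie_group_points[OF K] lie_group_points[OF H] by auto
  have [simp]: "act h m \<in> points M" "\<sigma> h m \<in> carrier H" if "h \<in> carrier H" "m \<in> points M" for h m
    using that by (simp_all add: act_def \<sigma>_def)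
  have [simp]: "\<Phi> m m' \<in> points M" "\<gamma> m m' \<in> carrier H" if "m \<in> points M" "m' \<in> points M" for m m'
    using that by (simp_all add: \<Phi>_def \<gamma>_def)
  have \<iota>m: "\<iota> (h \<otimes>\<^bsub>H\<^esub> h') = \<iota> h \<otimes>\<^bsub>K\<^esub> \<iota> h'" if "h \<in> carrier H" "h' \<in> carrier H" for h h'
    using hom_mult[OF \<iota>(1) that] .
  have \<iota>1: "\<iota> \<one>\<^bsub>H\<^esub> = \<one>\<^bsub>K\<^esub>" using hom_one[OF \<iota>(1) H.is_group K.is_group] .
  \<comment> \<open>\<open>P\<close> and \<open>Q\<close> recover the two factors from the
    product.\<close>
  have unique: "m = m' \<and> h = h'"
    if "S m \<otimes>\<^bsub>K\<^esub> \<iota> h = S m' \<otimes>\<^bsub>K\<^esub> \<iota> h'" "m \<in> points M" "m' \<in> points M" "h \<in> carrier H" "h' \<in> carrier H" for m m' h h'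
    using eqP[of m h] eqP[of m' h'] eqQ[of m h] eqQ[of m' h'] that by simp
  \<comment> \<open>The two rewriting rules behind the four operations; \<open>A'\<close> and
    \<open>B'\<close> are their forms inside a longer word associated to the right.\<close>
  have A: "\<iota> h \<otimes>\<^bsub>K\<^esub> S m = S (act h m) \<otimes>\<^bsub>K\<^esub> \<iota> (\<sigma> h m)" if "h \<in> carrier H" "m \<in> points M" for h m
    using split[of "\<iota> h \<otimes>\<^bsub>K\<^esub> S m"] that by (simp add: act_def \<sigma>_def)
  have B: "S m \<otimes>\<^bsub>K\<^esub> S m' = S (\<Phi> m m') \<otimes>\<^bsub>K\<^esub> \<iota> (\<gamma> m m')" if "m \<in> points M" "m' \<in> points M" for m m'
    using split[of "S m \<otimes>\<^bsub>K\<^esub> S m'"] that by (simp add: \<Phi>_def \<gamma>_def)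
  have A': "\<iota> h \<otimes>\<^bsub>K\<^esub> (S m \<otimes>\<^bsub>K\<^esub> k) = S (act h m) \<otimes>\<^bsub>K\<^esub> (\<iota> (\<sigma> h m) \<otimes>\<^bsub>K\<^esub> k)"
    if "h \<in> carrier H" "m \<in> points M" "k \<in> carrier K" for h m k
    using arg_cong[OF A[OF that(1,2)], of "\<lambda>x. x \<otimes>\<^bsub>K\<^esub> k"] that by (simp add: K.m_assoc)
  have B': "S m \<otimes>\<^bsub>K\<^esub> (S m' \<otimes>\<^bsub>K\<^esub> k) = S (\<Phi> m m') \<otimes>\<^bsub>K\<^esub> (\<iota> (\<gamma> m m') \<otimes>\<^bsub>K\<^esub> k)"
    if "m \<in> points M" "m' \<in> points M" "k \<in> carrier K" for m m' k
    using arg_cong[OF B[OF that(1,2)], of "\<lambda>x. x \<otimes>\<^bsub>K\<^esub> k"] that by (simp add: K.m_assoc)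

  have act1: "act \<one>\<^bsub>H\<^esub> m = m" "\<sigma> \<one>\<^bsub>H\<^esub> m = \<one>\<^bsub>H\<^esub>" if m: "m \<in> points M" for m
    using unique[of m "\<one>\<^bsub>H\<^esub>" "act \<one>\<^bsub>H\<^esub> m" "\<sigma> \<one>\<^bsub>H\<^esub> m"] A[OF H.one_closed m] m \<iota>1 by auto
  have actz: "act h z = z" "\<sigma> h z = h" if h: "h \<in> carrier H" for h
    using unique[of z h "act h z" "\<sigma> h z"] A[OF h z(1)] h z by auto
  have zl: "\<Phi> z m = m" "\<gamma> z m = \<one>\<^bsub>H\<^esub>" if m: "m \<in> points M" for m
    using unique[of m "\<one>\<^bsub>H\<^esub>" "\<Phi> z m" "\<gamma> z m"] B[OF z(1) m] m z \<iota>1 by auto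
  have zr: "\<Phi> m z = m" "\<gamma> m z = \<one>\<^bsub>H\<^esub>" if m: "m \<in> points M" for m
    using unique[of m "\<one>\<^bsub>H\<^esub>" "\<Phi> m z" "\<gamma> m z"] B[OF m z(1)] m z \<iota>1 by auto
  \<comment> \<open>From the word \<open>h1 h2 m\<close>; its two components give the action law and
    the rule for \<open>\<sigma>\<close>.\<close>
  have actm: "act (h1 \<otimes>\<^bsub>H\<^esub> h2) m = act h1 (act h2 m)" "\<sigma> (h1 \<otimes>\<^bsub>H\<^esub> h2) m = \<sigma> h1 (act h2 m) \<otimes>\<^bsub>H\<^esub> \<sigma> h2 m"
    if h: "h1 \<in> carrier H" "h2 \<in> carrier H" and m: "m \<in> points M" for h1 h2 m
  proof -
    have "S (act (h1 \<otimes>\<^bsub>H\<^esub> h2) m) \<otimes>\<^bsub>K\<^esub> \<iota> (\<sigma> (h1 \<otimes>\<^bsub>H\<^esub> h2) m) = \<iota> h1 \<otimes>\<^bsub>K\<^esub> (\<iota> h2 \<otimes>\<^bsub>K\<^esub> S m)"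
      using A[of "h1 \<otimes>\<^bsub>H\<^esub> h2" m] h m by (simp add: \<iota>m K.m_assoc)
    also have "\<dots> = S (act h1 (act h2 m)) \<otimes>\<^bsub>K\<^esub> \<iota> (\<sigma> h1 (act h2 m) \<otimes>\<^bsub>H\<^esub> \<sigma> h2 m)"
      using h m by (simp add: A[OF h(2) m] A' \<iota>m)
    finally show "act (h1 \<otimes>\<^bsub>H\<^esub> h2) m = act h1 (act h2 m)" "\<sigma> (h1 \<otimes>\<^bsub>H\<^esub> h2) m = \<sigma> h1 (act h2 m) \<otimes>\<^bsub>H\<^esub> \<sigma> h2 m"
      using unique h m by (metis (no_types, lifting) H.m_closed \<open>\<And>m h. \<lbrakk>h \<in> carrier H; m \<in> points M\<rbrakk> \<Longrightarrow> act h m \<in> points M\<close> \<open>\<And>m h. \<lbrakk>h \<in> carrier H; m \<in> points M\<rbrakk> \<Longrightarrow> \<sigma> h m \<in> carrier H\<close>)+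
  qed
  \<comment> \<open>From the word \<open>h m1 m2\<close>, reduced beginning with
    \<open>m1 m2\<close> and beginning with \<open>h m1\<close>.\<close>
  have dist: "act h (\<Phi> m1 m2) = \<Phi> (act h m1) (act (\<sigma> h m1) m2)"
      "\<sigma> h (\<Phi> m1 m2) \<otimes>\<^bsub>H\<^esub> \<gamma> m1 m2 = \<gamma> (act h m1) (act (\<sigma> h m1) m2) \<otimes>\<^bsub>H\<^esub> \<sigma> (\<sigma> h m1) m2"
    if h: "h \<in> carrier H" and m: "m1 \<in> points M" "m2 \<in> points M" for h m1 m2
  proof -
    have "S (act h (\<Phi> m1 m2)) \<otimes>\<^bsub>K\<^esub> \<iota> (\<sigma> h (\<Phi> m1 m2) \<otimes>\<^bsub>H\<^esub> \<gamma> m1 m2) = \<iota> h \<otimes>\<^bsub>K\<^esub> (S m1 \<otimes>\<^bsub>K\<^esub> S m2)"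
      using h m by (simp add: B[OF m] A' \<iota>m)
    also have "\<dots> = S (act h m1) \<otimes>\<^bsub>K\<^esub> (\<iota> (\<sigma> h m1) \<otimes>\<^bsub>K\<^esub> S m2)" using h m by (simp add: A')
    also have "\<dots> = S (\<Phi> (act h m1) (act (\<sigma> h m1) m2)) \<otimes>\<^bsub>K\<^esub> \<iota> (\<gamma> (act h m1) (act (\<sigma> h m1) m2) \<otimes>\<^bsub>H\<^esub> \<sigma> (\<sigma> h m1) m2)"
      using h m by (simp add: A B' \<iota>m)
    finally have "act h (\<Phi> m1 m2) = \<Phi> (act h m1) (act (\<sigma> h m1) m2) \<and>
      \<sigma> h (\<Phi> m1 m2) \<otimes>\<^bsub>H\<^esub> \<gamma> m1 m2 = \<gamma> (act h m1) (act (\<sigma> h m1) m2) \<otimes>\<^bsub>H\<^esub> \<sigma> (\<sigma> h m1) m2"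
      by (rule unique) (use h m in simp_all)
    then show "act h (\<Phi> m1 m2) = \<Phi> (act h m1) (act (\<sigma> h m1) m2)"
      "\<sigma> h (\<Phi> m1 m2) \<otimes>\<^bsub>H\<^esub> \<gamma> m1 m2 = \<gamma> (act h m1) (act (\<sigma> h m1) m2) \<otimes>\<^bsub>H\<^esub> \<sigma> (\<sigma> h m1) m2" by auto
  qed
  \<comment> \<open>From the word \<open>m1 m2 m3\<close>, reduced from the right and from the
    left.\<close>
  have assoc: "\<Phi> m1 (\<Phi> m2 m3) = \<Phi> (\<Phi> m1 m2) (act (\<gamma> m1 m2) m3)"
      "\<gamma> m1 (\<Phi> m2 m3) \<otimes>\<^bsub>H\<^esub> \<gamma> m2 m3 = \<gamma> (\<Phi> m1 m2) (act (\<gamma> m1 m2) m3) \<otimes>\<^bsub>H\<^esub> \<sigma> (\<gamma> m1 m2) m3"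
    if m: "m1 \<in> points M" "m2 \<in> points M" "m3 \<in> points M" for m1 m2 m3
  proof -
    have "S (\<Phi> m1 (\<Phi> m2 m3)) \<otimes>\<^bsub>K\<^esub> \<iota> (\<gamma> m1 (\<Phi> m2 m3) \<otimes>\<^bsub>H\<^esub> \<gamma> m2 m3) = S m1 \<otimes>\<^bsub>K\<^esub> (S (\<Phi> m2 m3) \<otimes>\<^bsub>K\<^esub> \<iota> (\<gamma> m2 m3))"
      using m by (simp add: B'[OF m(1), of "\<Phi> m2 m3"] \<iota>m)
    also have "\<dots> = S m1 \<otimes>\<^bsub>K\<^esub> (S m2 \<otimes>\<^bsub>K\<^esub> S m3)" using B[OF m(2,3)] by simp
    also have "\<dots> = S (\<Phi> m1 m2) \<otimes>\<^bsub>K\<^esub> (\<iota> (\<gamma> m1 m2) \<otimes>\<^bsub>K\<^esub> S m3)" using m by (simp add: B'[OF m(1,2)])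
    also have "\<dots> = S (\<Phi> (\<Phi> m1 m2) (act (\<gamma> m1 m2) m3)) \<otimes>\<^bsub>K\<^esub> \<iota> (\<gamma> (\<Phi> m1 m2) (act (\<gamma> m1 m2) m3) \<otimes>\<^bsub>H\<^esub> \<sigma> (\<gamma> m1 m2) m3)"
      using m by (simp add: A B' \<iota>m)
    finally have "\<Phi> m1 (\<Phi> m2 m3) = \<Phi> (\<Phi> m1 m2) (act (\<gamma> m1 m2) m3) \<and>
      \<gamma> m1 (\<Phi> m2 m3) \<otimes>\<^bsub>H\<^esub> \<gamma> m2 m3 = \<gamma> (\<Phi> m1 m2) (act (\<gamma> m1 m2) m3) \<otimes>\<^bsub>H\<^esub> \<sigma> (\<gamma> m1 m2) m3"
      by (rule unique) (use m in simp_all)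
    then show "\<Phi> m1 (\<Phi> m2 m3) = \<Phi> (\<Phi> m1 m2) (act (\<gamma> m1 m2) m3)"
      "\<gamma> m1 (\<Phi> m2 m3) \<otimes>\<^bsub>H\<^esub> \<gamma> m2 m3 = \<gamma> (\<Phi> m1 m2) (act (\<gamma> m1 m2) m3) \<otimes>\<^bsub>H\<^esub> \<sigma> (\<gamma> m1 m2) m3" by auto
  qed
  \<comment> \<open>The right inverse is the \<open>M\<close>-component of the inverse of
    \<open>S m\<close> in \<open>K\<close>.\<close>
  have rinv: "\<exists>mr\<in>points M. \<Phi> m mr = z" if m: "m \<in> points M" for m
  proof (rule bexI)
    define k where "k = inv\<^bsub>K\<^esub> (S m)"
    have k: "k \<in> carrier K" using m by (simp add: k_def)
    have "S m \<otimes>\<^bsub>K\<^esub> S (P k) \<otimes>\<^bsub>K\<^esub> \<iota> (Q k) = \<one>\<^bsub>K\<^esub>"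
      using split[OF k] m k by (simp add: K.m_assoc) (simp add: k_def)
    moreover have "S m \<otimes>\<^bsub>K\<^esub> S (P k) \<otimes>\<^bsub>K\<^esub> \<iota> (Q k) = S (\<Phi> m (P k)) \<otimes>\<^bsub>K\<^esub> \<iota> (\<gamma> m (P k) \<otimes>\<^bsub>H\<^esub> Q k)"
      using m k by (simp add: B \<iota>m K.m_assoc)
    ultimately have "S (\<Phi> m (P k)) \<otimes>\<^bsub>K\<^esub> \<iota> (\<gamma> m (P k) \<otimes>\<^bsub>H\<^esub> Q k) = S z \<otimes>\<^bsub>K\<^esub> \<iota> \<one>\<^bsub>H\<^esub>" using z \<iota>1 by simp
    then have "\<Phi> m (P k) = z \<and> \<gamma> m (P k) \<otimes>\<^bsub>H\<^esub> Q k = \<one>\<^bsub>H\<^esub>" by (rule unique) (use m k z in simp_all)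
    then show "\<Phi> m (P (inv\<^bsub>K\<^esub> (S m))) = z" by (simp add: k_def)
    show "P (inv\<^bsub>K\<^esub> (S m)) \<in> points M" using m by simp
  qed
  have prodsm: "smooth_map (product_manifold (mfd H) M) (mfd K) (\<lambda>x. \<iota> (fst x) \<otimes>\<^bsub>K\<^esub> S (snd x))"
    by (rule smooth_map_mult[OF K atlas_product[OF atH atM] smooth_map_comp[OF smooth_map_fst \<iota>(2)] smooth_map_comp[OF smooth_map_snd S]])
      (intro atlas_product atH atM atK)+
  have prodsm2: "smooth_map (product_manifold M M) (mfd K) (\<lambda>x. S (fst x) \<otimes>\<^bsub>K\<^esub> S (snd x))"
    by (rule smooth_map_mult[OF K atlas_product[OF atM atM] smooth_map_comp[OF smooth_map_fst S] smooth_map_comp[OF smooth_map_snd S]])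
      (intro atlas_product atM atK)+
  have sm: "smooth_map (product_manifold (mfd H) M) M (\<lambda>(h, m). act h m)"
      "smooth_map (product_manifold (mfd H) M) (mfd H) (\<lambda>(h, m). \<sigma> h m)"
      "smooth_map (product_manifold M M) M (\<lambda>(m, m'). \<Phi> m m')"
      "smooth_map (product_manifold M M) (mfd H) (\<lambda>(m, m'). \<gamma> m m')"
    using smooth_map_comp[OF prodsm P atlas_product[OF atH atM] atK atM] smooth_map_comp[OF prodsm Q atlas_product[OF atH atM] atK atH]
      smooth_map_comp[OF prodsm2 P atlas_product[OF atM atM] atK atM] smooth_map_comp[OF prodsm2 Q atlas_product[OF atM atM] atK atH]
    by (simp_all add: act_def \<sigma>_def \<Phi>_def \<gamma>_def case_prod_unfold)
  show "cocycle_matched_pair M z H act \<sigma> \<Phi> \<gamma>"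
    unfolding cocycle_matched_pair_def
    by (intro conjI ballI M H z(1) sm act1 actz actm zl zr dist assoc rinv) (use z(1) zl(2) in auto)

  let ?C = "cocycle_double_cross_product M z H act \<sigma> \<Phi> \<gamma>"
  let ?X = "product_manifold M (mfd H)"
  define f where "f k = (P k, Q k)" for k
  \<comment> \<open>The group axioms for pairs are pulled back from \<open>K\<close> along
    \<open>g\<close>, which is multiplicative and injective.\<close>
  define g where "g x = S (fst x) \<otimes>\<^bsub>K\<^esub> \<iota> (snd x)" for x
  have cC: "carrier ?C = points M \<times> carrier H" and oC: "\<one>\<^bsub>?C\<^esub> = (z, \<one>\<^bsub>H\<^esub>)" and mC: "mfd ?C = ?X"
    and mulC: "(m1, h1) \<otimes>\<^bsub>?C\<^esub> (m2, h2) = (\<Phi> m1 (act h1 m2), \<gamma> m1 (act h1 m2) \<otimes>\<^bsub>H\<^esub> \<sigma> h1 m2 \<otimes>\<^bsub>H\<^esub> h2)" for m1 h1 m2 h2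
    by (simp_all add: cocycle_double_cross_product_def)
  have gc: "g x \<in> carrier K" if "x \<in> carrier ?C" for x using that by (auto simp: g_def cC)
  have fc: "f k \<in> carrier ?C" if "k \<in> carrier K" for k using that by (simp add: f_def cC)
  have fg: "f (g x) = x" if "x \<in> carrier ?C" for x using that eqP eqQ by (auto simp: f_def g_def cC)
  have gf: "g (f k) = k" if "k \<in> carrier K" for k using split[OF that] by (simp add: f_def g_def)
  have mc: "x \<otimes>\<^bsub>?C\<^esub> y \<in> carrier ?C" if "x \<in> carrier ?C" "y \<in> carrier ?C" for x y
    using that unfolding cC by (auto simp: mulC)
  have gm: "g (x \<otimes>\<^bsub>?C\<^esub> y) = g x \<otimes>\<^bsub>K\<^esub> g y" if xy: "x \<in> carrier ?C" "y \<in> carrier ?C" for x y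
  proof -
    obtain m1 h1 m2 h2 where x: "x = (m1, h1)" and y: "y = (m2, h2)" by (cases x, cases y)
    have c: "m1 \<in> points M" "h1 \<in> carrier H" "m2 \<in> points M" "h2 \<in> carrier H" using xy by (auto simp: x y cC)
    have "g x \<otimes>\<^bsub>K\<^esub> g y = S m1 \<otimes>\<^bsub>K\<^esub> (\<iota> h1 \<otimes>\<^bsub>K\<^esub> (S m2 \<otimes>\<^bsub>K\<^esub> \<iota> h2))" using c by (simp add: g_def x y K.m_assoc)
    also have "\<dots> = S (\<Phi> m1 (act h1 m2)) \<otimes>\<^bsub>K\<^esub> (\<iota> (\<gamma> m1 (act h1 m2)) \<otimes>\<^bsub>K\<^esub> (\<iota> (\<sigma> h1 m2) \<otimes>\<^bsub>K\<^esub> \<iota> h2))"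
      using c by (simp add: A' B')
    also have "\<dots> = g (x \<otimes>\<^bsub>?C\<^esub> y)" unfolding x y mulC using c by (simp add: g_def \<iota>m K.m_assoc)
    finally show ?thesis by simp
  qed
  have g1: "g \<one>\<^bsub>?C\<^esub> = \<one>\<^bsub>K\<^esub>" by (simp add: g_def oC z \<iota>1)
  have o: "\<one>\<^bsub>?C\<^esub> \<in> carrier ?C" by (simp add: oC cC z)
  have inj: "x = y" if "g x = g y" "x \<in> carrier ?C" "y \<in> carrier ?C" for x y using fg that by metis
  have C: "group ?C"
  proof (rule groupI)
    fix x assume x: "x \<in> carrier ?C"
    show "\<one>\<^bsub>?C\<^esub> \<otimes>\<^bsub>?C\<^esub> x = x" by (rule inj) (use x o mc gm g1 gc in auto)
    have k: "inv\<^bsub>K\<^esub> (g x) \<in> carrier K" using gc[OF x] by simp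
    show "\<exists>y\<in>carrier ?C. y \<otimes>\<^bsub>?C\<^esub> x = \<one>\<^bsub>?C\<^esub>"
    proof (rule bexI[OF _ fc[OF k]])
      show "f (inv\<^bsub>K\<^esub> (g x)) \<otimes>\<^bsub>?C\<^esub> x = \<one>\<^bsub>?C\<^esub>"
        by (rule inj) (use x o mc fc[OF k] gm g1 gf[OF k] gc[OF x] in auto)
    qed
    fix y w assume y: "y \<in> carrier ?C" "w \<in> carrier ?C"
    show "x \<otimes>\<^bsub>?C\<^esub> y \<otimes>\<^bsub>?C\<^esub> w = x \<otimes>\<^bsub>?C\<^esub> (y \<otimes>\<^bsub>?C\<^esub> w)"
      by (rule inj) (use x y mc gm gc K.m_assoc in simp_all)
  qed (use mc o in auto)
  have X: "atlas ?X" by (rule atlas_product[OF atM atH])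
  have sf: "smooth_map (mfd K) ?X f" unfolding f_def[abs_def] by (rule smooth_map_Pair[OF P Q atK atM atH])
  have sg: "smooth_map ?X (mfd K) g"
    unfolding g_def[abs_def]
    by (rule smooth_map_mult[OF K X smooth_map_comp[OF smooth_map_fst S] smooth_map_comp[OF smooth_map_snd \<iota>(2)]])
      (intro X atM atH atK)+
  have XX: "atlas (product_manifold ?X ?X)" by (rule atlas_product[OF X X])
  have pX: "points ?X = carrier ?C" by (simp add: cC lie_group_points[OF H])
  have "smooth_map (product_manifold ?X ?X) (mfd K) (\<lambda>x. g (fst x) \<otimes>\<^bsub>K\<^esub> g (snd x))"
    by (rule smooth_map_mult[OF K XX smooth_map_comp[OF smooth_map_fst[OF X X] sg XX X atK] smooth_map_comp[OF smooth_map_snd[OF X X] sg XX X atK]])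
  from smooth_map_comp[OF this sf XX atK X]
  have "smooth_map (product_manifold ?X ?X) ?X (\<lambda>(x, y). x \<otimes>\<^bsub>?C\<^esub> y)"
  proof (rule smooth_map_cong[OF _ XX X])
    fix p assume "p \<in> points (product_manifold ?X ?X)"
    then have p: "fst p \<in> carrier ?C" "snd p \<in> carrier ?C" unfolding points_product[of ?X ?X] pX by auto
    have "f (g (fst p) \<otimes>\<^bsub>K\<^esub> g (snd p)) = fst p \<otimes>\<^bsub>?C\<^esub> snd p" using gm[OF p] fg[OF mc[OF p]] by simp
    then show "f (g (fst p) \<otimes>\<^bsub>K\<^esub> g (snd p)) = (\<lambda>(x, y). x \<otimes>\<^bsub>?C\<^esub> y) p" by (simp add: case_prod_unfold)
  qed
  moreover have "smooth_map ?X ?X (\<lambda>x. inv\<^bsub>?C\<^esub> x)"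
  proof (rule smooth_map_cong[OF smooth_map_comp[OF smooth_map_inv[OF K X sg] sf X atK X] X X])
    fix x assume "x \<in> points ?X"
    then have x: "x \<in> carrier ?C" unfolding pX .
    have k: "inv\<^bsub>K\<^esub> (g x) \<in> carrier K" using gc[OF x] by simp
    have "f (inv\<^bsub>K\<^esub> (g x)) \<otimes>\<^bsub>?C\<^esub> x = \<one>\<^bsub>?C\<^esub>"
      by (rule inj) (use x o mc fc[OF k] gm g1 gf[OF k] gc[OF x] in auto)
    then show "f (inv\<^bsub>K\<^esub> (g x)) = inv\<^bsub>?C\<^esub> x" using group.inv_equality[OF C _ x fc[OF k]] by simp
  qed
  ultimately have "lie_group ?C"
    unfolding lie_group_def mC pX
    using C smooth_manifold_product[OF M lie_group_manifold[OF H]] by simp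
  moreover have "f \<in> iso K ?C"
  proof (rule isoI)
    show "f \<in> hom K ?C"
    proof (rule homI)
      fix x y assume x: "x \<in> carrier K" "y \<in> carrier K"
      show "f (x \<otimes>\<^bsub>K\<^esub> y) = f x \<otimes>\<^bsub>?C\<^esub> f y"
        by (rule inj) (use x gf gm[OF fc fc] fc mc[OF fc fc] in simp_all)
    qed (rule fc)
    show "bij_betw f (carrier K) (carrier ?C)" by (rule bij_betw_byWitness[of _ g]) (use gf fg fc gc in auto)
  qed
  moreover have "smooth_map (mfd K) (mfd ?C) f" unfolding mC by (rule sf)
  moreover have "smooth_map (mfd ?C) (mfd K) (inv_into (carrier K) f)"
    unfolding mC
  proof (rule smooth_map_cong[OF sg X atK])
    fix x assume "x \<in> points ?X"
    then have x: "x \<in> carrier ?C" unfolding pX .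
    have "inj_on f (carrier K)" by (rule inj_on_inverseI[of _ g]) (rule gf)
    then show "g x = inv_into (carrier K) f x" using inv_into_f_f[of f "carrier K" "g x"] gc[OF x] fg[OF x] by simp
  qed
  ultimately show "lie_group_isomorphic K ?C" unfolding lie_group_isomorphic_def using K by blast
qed

text \<open>The identity of \<open>K\<close> factors with some \<open>h0\<close> that may be
  nontrivial, whereas the section of a matched pair has to pass through the identity. Multiplying
  the section by \<open>\<iota> h0\<close> on the right and the second component by the inverse of
  \<open>h0\<close> on the left achieves this, with \<open>z\<close> at the first component of the
  identity. The maps \<open>e\<close> and \<open>e'\<close> exchange the Euclidean space for
  \<open>M\<close>.\<close>

lemma complemented_matched_pair:
  fixes K :: "'k lie" and H :: "'h lie" and M :: "'m manifold"
  assumes K: "lie_group K" and H: "lie_group H" and M: "smooth_manifold M" and c: "complemented N H K"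
    and e: "smooth_map M (eucl N) e" and e': "smooth_map (eucl N) M e'"
    and inv: "\<And>x. x \<in> points M \<Longrightarrow> e' (e x) = x" "\<And>y. y \<in> Eucl N \<Longrightarrow> e (e' y) = y"
  shows "\<exists>z act \<sigma> \<Phi> \<gamma>. cocycle_matched_pair M z H act \<sigma> \<Phi> \<gamma> \<and>
    lie_group_isomorphic K (cocycle_double_cross_product M z H act \<sigma> \<Phi> \<gamma>)"
proof -
  obtain \<iota> s \<theta> where c: "complement N H K \<iota> s \<theta>" using c complemented_def by blast
  interpret K: group K by (rule lie_group_group[OF K])
  interpret H: group H by (rule lie_group_group[OF H])
  note atK = lie_group_atlas[OF K] and atH = lie_group_atlas[OF H] and atM = smooth_manifold_atlas[OF M]
  note cl = complement_closed[OF H K c]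
  note \<iota> = complement_hom[OF H K c]
  have eM: "e m \<in> Eucl N" if "m \<in> points M" for m using smooth_map_points[OF e that] by simp
  define h0 where "h0 = snd (\<theta> \<one>\<^bsub>K\<^esub>)"
  define z where "z = e' (fst (\<theta> \<one>\<^bsub>K\<^esub>))"
  have h0: "h0 \<in> carrier H" using cl(4)[OF K.one_closed] by (simp add: h0_def)
  have \<theta>1: "fst (\<theta> \<one>\<^bsub>K\<^esub>) \<in> Eucl N" by (rule cl(3)[OF K.one_closed])
  define S where "S m = s (e m) \<otimes>\<^bsub>K\<^esub> \<iota> h0" for m
  define P where "P k = e' (fst (\<theta> k))" for k
  define Q where "Q k = inv\<^bsub>H\<^esub> h0 \<otimes>\<^bsub>H\<^esub> snd (\<theta> k)" for k
  have \<theta>S: "\<theta> (S m \<otimes>\<^bsub>K\<^esub> \<iota> h) = (e m, h0 \<otimes>\<^bsub>H\<^esub> h)" if "m \<in> points M" "h \<in> carrier H" for m h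
  proof -
    have "S m \<otimes>\<^bsub>K\<^esub> \<iota> h = s (e m) \<otimes>\<^bsub>K\<^esub> \<iota> (h0 \<otimes>\<^bsub>H\<^esub> h)"
      unfolding S_def hom_mult[OF \<iota> h0 that(2)]
      by (rule K.m_assoc[OF cl(2)[OF eM[OF that(1)]] cl(1)[OF h0] cl(1)[OF that(2)]])
    then show ?thesis using complement_eq[OF H K c eM[OF that(1)], of "h0 \<otimes>\<^bsub>H\<^esub> h"] h0 that(2) by simp
  qed
  note * = matched_pair_of_decomposition[OF K H M \<iota> complement_embedding[OF H K c], of S P Q z]
  have a1: "smooth_map M (mfd K) S"
    unfolding S_def[abs_def]
    by (rule smooth_map_mult[OF K atM smooth_map_comp[OF e complement_section[OF H K c] atM atlas_eucl atK]
          smooth_map_const[OF atM atK]]) (use cl(1)[OF h0] lie_group_points[OF K] in simp)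
  have a2: "smooth_map (mfd K) M P"
    unfolding P_def[abs_def] by (rule smooth_map_comp[OF complement_fst[OF H K c] e' atK atlas_eucl atM])
  have a3: "smooth_map (mfd K) (mfd H) Q"
    unfolding Q_def[abs_def]
    by (rule smooth_map_mult[OF H atK smooth_map_const[OF atK atH] complement_snd[OF H K c]])
      (use h0 lie_group_points[OF H] in simp)
  have a4: "P (S m \<otimes>\<^bsub>K\<^esub> \<iota> h) = m" if "m \<in> points M" "h \<in> carrier H" for m h
    using \<theta>S[OF that] inv(1)[OF that(1)] by (simp add: P_def)
  have a5: "Q (S m \<otimes>\<^bsub>K\<^esub> \<iota> h) = h" if "m \<in> points M" "h \<in> carrier H" for m h
    using \<theta>S[OF that] h0 that(2) by (simp add: Q_def H.m_assoc[symmetric])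
  have a6: "S (P k) \<otimes>\<^bsub>K\<^esub> \<iota> (Q k) = k" if k: "k \<in> carrier K" for k
  proof -
    note k' = cl(3,4)[OF k]
    have q: "Q k \<in> carrier H" using h0 k' by (simp add: Q_def)
    have "h0 \<otimes>\<^bsub>H\<^esub> Q k = snd (\<theta> k)" using h0 k' by (simp add: Q_def H.m_assoc[symmetric])
    then have "\<iota> h0 \<otimes>\<^bsub>K\<^esub> \<iota> (Q k) = \<iota> (snd (\<theta> k))" using hom_mult[OF \<iota> h0 q] by simp
    then have "S (P k) \<otimes>\<^bsub>K\<^esub> \<iota> (Q k) = s (fst (\<theta> k)) \<otimes>\<^bsub>K\<^esub> \<iota> (snd (\<theta> k))"
      using K.m_assoc[OF cl(2)[OF k'(1)] cl(1)[OF h0] cl(1)[OF q]] inv(2)[OF k'(1)] by (simp add: S_def P_def)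
    then show ?thesis using complement_split[OF H K c k] by simp
  qed
  have a7: "z \<in> points M" unfolding z_def using smooth_map_points[OF e'] \<theta>1 by simp
  have a8: "S z = \<one>\<^bsub>K\<^esub>"
    unfolding S_def z_def inv(2)[OF \<theta>1] h0_def by (rule complement_split[OF H K c K.one_closed])
  from *[OF a1 a2 a3 a4 a5 a6 a7 a8] show ?thesis by (intro exI conjI)
qed

section \<open>Iterated tangent groups\<close>

text \<open>The \<open>(n + 1)\<close>-jets embed into the tangent group of the
  \<open>n\<close>-jets by \<open>complemented_jet_split\<close>, and this into the tangent group of
  the \<open>n\<close>-th iterate by applying the tangent functor to the induction hypothesis. The
  renaming adds a complement of dimension 0.\<close>

lemma iterated_tangent_group_complemented:
  fixes G :: "'g lie"
  assumes G: "lie_group G"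
  shows "lie_group (iterated_tangent_group n G) \<and>
    complemented ((2 ^ n - 1 - n) * mdim (mfd G)) (tangent_group n G) (iterated_tangent_group n G)"
proof (induction n)
  case 0
  have "inj_on Point (carrier G)" by (rule inj_onI) simp
  note t = lie_group_transport[OF G this] complemented_transport[OF G this]
  show ?case
    using t(1) complemented_trans[OF lie_group_tangent[OF G] G t(1) complemented_tangent_0[OF G] t(2)] by simp
next
  case (Suc n)
  let ?K = "iterated_tangent_group n G" and ?d = "mdim (mfd G)"
  define N where "N = (2 ^ n - 1 - n) * ?d"
  have K: "lie_group ?K" and c: "complemented N (tangent_group n G) ?K" using Suc.IH by (auto simp: N_def)
  note T = lie_group_tangent[OF G]
  \<comment> \<open>A jet is determined by its representative, so the renaming loses
    nothing.\<close>
  have "inj_on (\<lambda>c. Velocity (representative c)) (carrier (tangent_group 1 ?K))"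
    by (rule inj_onI) (metis iterated_vector.inject(2) jets_representative(2) tangent_group_simps(1))
  note t = lie_group_transport[OF lie_group_tangent[OF K] this] complemented_transport[OF lie_group_tangent[OF K] this]
  have "complemented (2 * N + n * ?d) (tangent_group (Suc n) G) (tangent_group 1 ?K)"
    by (rule complemented_trans[OF T lie_group_tangent[OF T] lie_group_tangent[OF K]
          complemented_jet_split[OF G] complemented_tangent[OF T K c]])
  from complemented_trans[OF T lie_group_tangent[OF K] t(1) this t(2)]
  have "complemented (2 * N + n * ?d) (tangent_group (Suc n) G) (iterated_tangent_group (Suc n) G)" by simp
  moreover have "2 * N + n * ?d = (2 ^ Suc n - 1 - Suc n) * ?d"
  proof -
    \<comment> \<open>By \<open>n < 2 ^ n\<close> the truncated subtractions are exact.\<close>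
    have "2 * (2 ^ n - 1 - n) + n = 2 ^ Suc n - 1 - Suc n" using less_exp[of n] unfolding power_Suc by linarith
    then show ?thesis unfolding N_def by (metis add_mult_distrib mult.assoc)
  qed
  ultimately show ?case using t(1) by simp
qed

theorem proposition5p1:
  fixes G :: "'g lie" and n :: nat
  assumes "lie_group G" and "n \<ge> 1"
  shows "\<exists>z act \<sigma> \<Phi> \<gamma>.
    cocycle_matched_pair (lie_algebra_power G (2 ^ n - 1 - n)) z (tangent_group n G) act \<sigma> \<Phi> \<gamma> \<and>
    lie_group_isomorphic (iterated_tangent_group n G)
      (cocycle_double_cross_product (lie_algebra_power G (2 ^ n - 1 - n)) z (tangent_group n G)
         act \<sigma> \<Phi> \<gamma>)"
proof -
  let ?m = "2 ^ n - 1 - n"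
  obtain e e' where e: "smooth_map (lie_algebra_power G ?m) (eucl (?m * mdim (mfd G))) e"
    "smooth_map (eucl (?m * mdim (mfd G))) (lie_algebra_power G ?m) e'"
    "\<And>x. x \<in> points (lie_algebra_power G ?m) \<Longrightarrow> e' (e x) = x"
    "\<And>y. y \<in> Eucl (?m * mdim (mfd G)) \<Longrightarrow> e (e' y) = y"
    using lie_algebra_power_eucl[OF assms(1)] by blast
  show ?thesis
    using iterated_tangent_group_complemented[OF assms(1), of n]
    by (intro complemented_matched_pair[where e = e and e' = e' and N = "?m * mdim (mfd G)",
          OF _ lie_group_tangent[OF assms(1)] smooth_manifold_lie_algebra_power[OF assms(1)] _ e]) auto
qed

end
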